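(* Let $\Omega\subset\mathbb{R}^d$ be a convex domain of finite diameter with $C^1$ boundary $\partial\Omega$, and let $f\colon\overline\Omega\to\mathbb{R}$ be a continuous function. Then the equation $$-\Delta_\infty u=f\ \text{ in }\Omega,\qquad \nabla_\nu u=0\ \text{ on }\partial\Omega$$ has a viscosity solution $u$ if and only if $\overline c_f=0$.
   Context: A domain is an open, bounded, connected subset of $\mathbb{R}^d$. The constant $\overline c_f$: equip $\overline\Omega$ with the intrinsic metric $d(x,y)$, the infimum of lengths of rectifiable paths contained in $\overline\Omega$ between $x$ and $y$ (for convex $\Omega$ this is the Euclidean metric), and let $B(x,\epsilon)=\{y\in\overline\Omega:d(x,y)\le\epsilon\}$. For $\epsilon>0$ and continuous $u_0\colon\overline\Omega\to\mathbb{R}$ define $(u_n)_{n\ge0}$ starting from $u_0$ by $$u_{n+1}(x)=\tfrac12\big(\min_{B(x,\epsilon)}u_n+\max_{B(x,\epsilon)}u_n\big)+f(x).$$ $c_f(\epsilon)$ is the unique real constant $c$ such that, for any such $u_0$, the sequence of functions $(u_n-nc)$ is uniformly bounded (it exists and is independent of $u_0$). Then $\overline c_f=\lim_{\epsilon\downarrow0}c_f(\epsilon)$ (this limit exists). Viscosity solutions: $\nu(x)$ is the outward normal vector to $\partial\Omega$ at $x\in\partial\Omega$, and $\nabla_\nu$ the derivative in its direction. For a twice differentiable $\varphi$ with $\nabla\varphi(x)\ne0$ set $\Delta_\infty^+\varphi(x)=\Delta_\infty\varphi(x)=|\nabla\varphi(x)|^{-2}\sum_{i,j}\varphi_{x_i}(x)\varphi_{x_ix_j}(x)\varphi_{x_j}(x)$;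 if $\nabla\varphi(x)=0$ set $\Delta_\infty^+\varphi(x)=\max_{|\mathbf v|=1}\sum_{i,j}\varphi_{x_ix_j}(x)\mathbf v_i\mathbf v_j$. $C^\infty(\overline\Omega)$ denotes functions infinitely differentiable on an open set containing $\overline\Omega$. A continuous $u\colon\overline\Omega\to\mathbb{R}$ is a viscosity subsolution of the equation if for any $\varphi\in C^\infty(\overline\Omega)$ and $x_0\in\overline\Omega$ such that $u-\varphi$ has a strict local maximum at $x_0$ (on $\overline\Omega$), either (a) $-\Delta_\infty^+\varphi(x_0)\le f(x_0)$, or (b) $x_0\in\partial\Omega$ and $\nabla_{\nu(x_0)}\varphi(x_0)\le0$. It is a viscosity supersolution if $-u$ is a viscosity subsolution of the equation with $f$ replaced by $-f$. It is a viscosity solution if it is both. *)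

theory Defs
  imports "HOL-Analysis.Analysis"
begin

section \<open>Domains and the intrinsic metric\<close>

definition bounded_domain :: "(real ^ 'n) set \<Rightarrow> bool" where
  "bounded_domain \<Omega> \<longleftrightarrow> open \<Omega> \<and> bounded \<Omega> \<and> connected \<Omega> \<and> \<Omega> \<noteq> {}"

text \<open>Lengths and distances take values in the extended nonnegative reals: a path is rectifiable
  iff its length is finite, so that paths of infinite length do not affect the infimum below, and
  the distance of two points that no rectifiable path joins is infinite.\<close>

definition path_length :: "(real \<Rightarrow> 'a::metric_space) \<Rightarrow> ennreal" where
  "path_length g =
     (SUP (n, t) \<in> {(n :: nat, t :: nat \<Rightarrow> real). mono t \<and> range t \<subseteq> {0..1}}.
        \<Sum>i<n. ennreal (dist (g (t i)) (g (t (Suc i)))))"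

definition intrinsic_dist :: "(real ^ 'n) set \<Rightarrow> real ^ 'n \<Rightarrow> real ^ 'n \<Rightarrow> ennreal" where
  "intrinsic_dist \<Omega> x y =
     (INF g \<in> {g. path g \<and> path_image g \<subseteq> closure \<Omega> \<and> pathstart g = x \<and> pathfinish g = y}.
        path_length g)"

definition finite_intrinsic_diameter :: "(real ^ 'n) set \<Rightarrow> bool" where
  "finite_intrinsic_diameter \<Omega> \<longleftrightarrow>
     (SUP x \<in> closure \<Omega>. SUP y \<in> closure \<Omega>. intrinsic_dist \<Omega> x y) < \<infinity>"

definition intrinsic_cball :: "(real ^ 'n) set \<Rightarrow> real ^ 'n \<Rightarrow> real \<Rightarrow> (real ^ 'n) set" where
  "intrinsic_cball \<Omega> x \<epsilon> = {y \<in> closure \<Omega>. intrinsic_dist \<Omega> x y \<le> ennreal \<epsilon>}"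

section \<open>The value iteration and its growth constant\<close>

text \<open>Only the values of functions on the closure of the domain matter. The minimum and the maximum
  over a ball are written as infimum and supremum.\<close>

primrec game_iter ::
  "(real ^ 'n) set \<Rightarrow> (real ^ 'n \<Rightarrow> real) \<Rightarrow> real \<Rightarrow> (real ^ 'n \<Rightarrow> real) \<Rightarrow> nat \<Rightarrow> real ^ 'n \<Rightarrow> real" where
  "game_iter \<Omega> f \<epsilon> u0 0 = u0"
| "game_iter \<Omega> f \<epsilon> u0 (Suc n) = (\<lambda>x.
     1 / 2 * ((INF y \<in> intrinsic_cball \<Omega> x \<epsilon>. game_iter \<Omega> f \<epsilon> u0 n y)
            + (SUP y \<in> intrinsic_cball \<Omega> x \<epsilon>. game_iter \<Omega> f \<epsilon> u0 n y)) + f x)"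

definition growth_const :: "(real ^ 'n) set \<Rightarrow> (real ^ 'n \<Rightarrow> real) \<Rightarrow> real \<Rightarrow> real" where
  "growth_const \<Omega> f \<epsilon> =
     (THE c. \<forall>u0. continuous_on (closure \<Omega>) u0 \<longrightarrow>
        (\<exists>M. \<forall>n. \<forall>x \<in> closure \<Omega>. \<bar>game_iter \<Omega> f \<epsilon> u0 n x - real n * c\<bar> \<le> M))"

definition limit_growth_const :: "(real ^ 'n) set \<Rightarrow> (real ^ 'n \<Rightarrow> real) \<Rightarrow> real" where
  "limit_growth_const \<Omega> f = Lim (at_right 0) (growth_const \<Omega> f)"

section \<open>Partial derivatives and smoothness\<close>

definition partial_deriv :: "'n \<Rightarrow> (real ^ 'n \<Rightarrow> real) \<Rightarrow> real ^ 'n \<Rightarrow> real" where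
  "partial_deriv i \<phi> x = frechet_derivative \<phi> (at x) (axis i 1)"

definition grad :: "(real ^ 'n \<Rightarrow> real) \<Rightarrow> real ^ 'n \<Rightarrow> real ^ 'n" where
  "grad \<phi> x = (\<chi> i. partial_deriv i \<phi> x)"

definition hessian :: "(real ^ 'n \<Rightarrow> real) \<Rightarrow> real ^ 'n \<Rightarrow> real ^ 'n ^ 'n" where
  "hessian \<phi> x = (\<chi> i j. partial_deriv j (partial_deriv i \<phi>) x)"

text \<open>Used for open sets \<open>U\<close> only.\<close>

primrec Ck_on :: "nat \<Rightarrow> (real ^ 'n \<Rightarrow> real) \<Rightarrow> (real ^ 'n) set \<Rightarrow> bool" where
  "Ck_on 0 \<phi> U \<longleftrightarrow> continuous_on U \<phi>"
| "Ck_on (Suc k) \<phi> U \<longleftrightarrow>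
     (\<forall>x \<in> U. \<phi> differentiable (at x)) \<and> (\<forall>i. Ck_on k (partial_deriv i \<phi>) U)"

definition smooth_on_closure :: "(real ^ 'n) set \<Rightarrow> (real ^ 'n \<Rightarrow> real) \<Rightarrow> bool" where
  "smooth_on_closure \<Omega> \<phi> \<longleftrightarrow> (\<exists>U. open U \<and> closure \<Omega> \<subseteq> U \<and> (\<forall>k. Ck_on k \<phi> U))"

section \<open>Boundaries of class \<open>C\<^sup>1\<close> and the outward normal\<close>

text \<open>\<open>\<rho>\<close> is a local \<open>C\<^sup>1\<close> defining function of \<open>\<Omega>\<close> near the boundary point \<open>x\<close>. As \<open>grad \<rho>\<close> does not
  vanish on \<open>U\<close>, the boundary of \<open>\<Omega>\<close> within \<open>U\<close> is the regular level set \<open>\<rho> = 0\<close>, with \<open>\<Omega>\<close> on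
  one side of it only, and \<open>grad \<rho>\<close> points out of \<open>\<Omega>\<close> there.\<close>

definition C1_defining_function ::
  "(real ^ 'n) set \<Rightarrow> real ^ 'n \<Rightarrow> (real ^ 'n) set \<Rightarrow> (real ^ 'n \<Rightarrow> real) \<Rightarrow> bool" where
  "C1_defining_function \<Omega> x U \<rho> \<longleftrightarrow>
     open U \<and> x \<in> U \<and> Ck_on 1 \<rho> U \<and> (\<forall>y \<in> U. grad \<rho> y \<noteq> 0) \<and>
     \<Omega> \<inter> U = {y \<in> U. \<rho> y < 0}"

definition C1_boundary :: "(real ^ 'n) set \<Rightarrow> bool" where
  "C1_boundary \<Omega> \<longleftrightarrow> (\<forall>x \<in> frontier \<Omega>. \<exists>U \<rho>. C1_defining_function \<Omega> x U \<rho>)"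

definition outward_normal :: "(real ^ 'n) set \<Rightarrow> real ^ 'n \<Rightarrow> real ^ 'n" where
  "outward_normal \<Omega> x =
     (THE \<nu>. \<exists>U \<rho>. C1_defining_function \<Omega> x U \<rho> \<and> \<nu> = sgn (grad \<rho> x))"

section \<open>The infinity Laplacian and viscosity solutions\<close>

definition infinity_laplacian_plus :: "(real ^ 'n \<Rightarrow> real) \<Rightarrow> real ^ 'n \<Rightarrow> real" where
  "infinity_laplacian_plus \<phi> x =
     (if grad \<phi> x \<noteq> 0
      then (\<Sum>i\<in>UNIV. \<Sum>j\<in>UNIV. grad \<phi> x $ i * hessian \<phi> x $ i $ j * grad \<phi> x $ j)
             / (norm (grad \<phi> x))\<^sup>2
      else (SUP v \<in> {v. norm v = 1}. \<Sum>i\<in>UNIV. \<Sum>j\<in>UNIV. hessian \<phi> x $ i $ j * v $ i * v $ j))"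

definition strict_local_max_on :: "'a::metric_space set \<Rightarrow> ('a \<Rightarrow> real) \<Rightarrow> 'a \<Rightarrow> bool" where
  "strict_local_max_on S g x0 \<longleftrightarrow> x0 \<in> S \<and> (\<forall>\<^sub>F y in at x0 within S. g y < g x0)"

definition viscosity_subsolution ::
  "(real ^ 'n) set \<Rightarrow> (real ^ 'n \<Rightarrow> real) \<Rightarrow> (real ^ 'n \<Rightarrow> real) \<Rightarrow> bool" where
  "viscosity_subsolution \<Omega> f u \<longleftrightarrow>
     continuous_on (closure \<Omega>) u \<and>
     (\<forall>\<phi> x0. smooth_on_closure \<Omega> \<phi> \<and> x0 \<in> closure \<Omega> \<and>
        strict_local_max_on (closure \<Omega>) (\<lambda>y. u y - \<phi> y) x0 \<longrightarrow>
          - infinity_laplacian_plus \<phi> x0 \<le> f x0 \<or>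
          x0 \<in> frontier \<Omega> \<and> frechet_derivative \<phi> (at x0) (outward_normal \<Omega> x0) \<le> 0)"

definition viscosity_supersolution ::
  "(real ^ 'n) set \<Rightarrow> (real ^ 'n \<Rightarrow> real) \<Rightarrow> (real ^ 'n \<Rightarrow> real) \<Rightarrow> bool" where
  "viscosity_supersolution \<Omega> f u \<longleftrightarrow> viscosity_subsolution \<Omega> (\<lambda>x. - f x) (\<lambda>x. - u x)"

definition viscosity_solution ::
  "(real ^ 'n) set \<Rightarrow> (real ^ 'n \<Rightarrow> real) \<Rightarrow> (real ^ 'n \<Rightarrow> real) \<Rightarrow> bool" where
  "viscosity_solution \<Omega> f u \<longleftrightarrow> viscosity_subsolution \<Omega> f u \<and> viscosity_supersolution \<Omega> f u"

end

theory Submission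
  imports Defs "HOL-Complex_Analysis.Great_Picard"
begin

text \<open>
  On a convex domain the intrinsic metric is Euclidean, so the iteration averages minima and maxima
  over balls intersected with the closure.

  If \<open>u\<close> is a viscosity solution, its maxima over balls of radius \<open>e\<close> form a subsolution of the
  difference equation for \<open>f\<close> at scale \<open>e\<close> up to a small error. This follows by comparing \<open>u\<close> with
  quadratic cones \<open>b r - c r\<^sup>2 / 2\<close> with vertex in \<open>\<Omega>\<close>: by convexity such a cone increases in the outward
  normal direction at every boundary point, hence the Neumann alternative never applies.
  The same holds for \<open>- u\<close>, and iterating from these functions gives growth constants tending to \<open>0\<close>.

  Conversely, discounting the difference equation makes it a contraction. A discrete cone comparison
  gives bounds on the oscillation of the discounted solutions that are uniform in the discount and in
  the scale, so along a subsequence they converge, after subtracting constants, to a viscosity solution for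
  \<open>f - c\<close> with some constant \<open>c\<close>. The first part applied to \<open>f - c\<close> identifies \<open>c\<close> as the limit of the
  growth constants, and in particular shows that this limit exists.
\<close>

section \<open>The averaging operator\<close>

text \<open>For smooth \<open>u\<close> with nonzero gradient at an interior point,
  \<open>minmax K e u x - u x\<close> is \<open>e\<^sup>2 / 2\<close> times the infinity Laplacian
  up to smaller terms. Hence there are two normalisations: the iteration adds \<open>f\<close>
  itself, the discrete equation adds \<open>e\<^sup>2 / 2 * f\<close>, and multiplication by
  \<open>2 / e\<^sup>2\<close> leads from the second to the first. The discrete functions are merely
  bounded. Their extrema need not be attained, so near-maxima replace maxima, and equations hold
  only up to a tolerance. A tolerance that is small compared with \<open>e\<^sup>2\<close> is
  harmless in the limit, and bounds uniform in the tolerance are enough to pin down a growth rate.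
  As \<open>minmax\<close> is odd in the function, supersolutions are treated as negatives of
  subsolutions throughout. The boundary condition enters through two geometric facts: vectors from
  interior points to a boundary point have a positive outward normal component, and a short step
  against a vector with such a component leads into \<Omega>. The former serves the comparison with
  cones, the latter the minimising move in the viscosity limit.\<close>

definition minmax :: "'a::metric_space set \<Rightarrow> real \<Rightarrow> ('a \<Rightarrow> real) \<Rightarrow> 'a \<Rightarrow> real" where
  "minmax K e u x = ((INF y\<in>K \<inter> cball x e. u y) + (SUP y\<in>K \<inter> cball x e. u y)) / 2"

lemma minmax_cong:
  assumes "\<And>y. y \<in> K \<Longrightarrow> u y = v y"
  shows "minmax K e u x = minmax K e v x"
proof -
  have "u ` (K \<inter> cball x e) = v ` (K \<inter> cball x e)" using assms by (auto intro!: image_cong)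
  then show ?thesis by (simp add: minmax_def)
qed

lemma bounded_image_subset: "bounded (u ` K) \<Longrightarrow> A \<subseteq> K \<Longrightarrow> bounded (u ` A)"
  by (rule bounded_subset[OF _ image_mono])

lemma bounded_image_realI:
  fixes u :: "'a \<Rightarrow> real"
  shows "(\<And>x. x \<in> K \<Longrightarrow> \<bar>u x\<bar> \<le> B) \<Longrightarrow> bounded (u ` K)"
  by (auto simp: bounded_iff)

lemma bounded_image_realE:
  fixes u :: "'a \<Rightarrow> real"
  assumes "bounded (u ` K)"
  obtains B where "B > 0" "\<And>x. x \<in> K \<Longrightarrow> \<bar>u x\<bar> \<le> B"
proof -
  obtain B where "B > 0" "\<forall>y\<in>u ` K. norm y \<le> B" using assms bounded_pos by metis
  then show ?thesis using that[of B] by simp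
qed

lemma minmax_mono:
  assumes "bounded (u ` K)" "bounded (v ` K)" "x \<in> K" "0 \<le> e"
    and le: "\<And>y. y \<in> K \<Longrightarrow> dist x y \<le> e \<Longrightarrow> u y \<le> v y + d"
  shows "minmax K e u x \<le> minmax K e v x + d"
proof -
  let ?A = "K \<inter> cball x e"
  have x: "x \<in> ?A" using assms by auto
  have bu: "bounded (u ` ?A)" and bv: "bounded (v ` ?A)"
    using assms bounded_image_subset by blast+
  have "(SUP y\<in>?A. u y) \<le> (SUP y\<in>?A. v y) + d"
  proof (rule cSUP_least)
    fix y assume "y \<in> ?A"
    moreover from this have "v y \<le> (SUP y\<in>?A. v y)"
      by (intro cSUP_upper bounded_imp_bdd_above bv)
    ultimately show "u y \<le> (SUP y\<in>?A. v y) + d" using le[of y] by auto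
  qed (use x in blast)
  moreover have "(INF y\<in>?A. u y) - d \<le> (INF y\<in>?A. v y)"
  proof (rule cINF_greatest)
    fix y assume "y \<in> ?A"
    moreover from this have "(INF y\<in>?A. u y) \<le> u y"
      by (intro cINF_lower bounded_imp_bdd_below bu)
    ultimately show "(INF y\<in>?A. u y) - d \<le> v y" using le[of y] by auto
  qed (use x in blast)
  ultimately show ?thesis by (simp add: minmax_def field_simps)
qed

text \<open>One player commits to the move \<open>z\<close>, which bounds the infimum; of the other
  player only a uniform bound is asked. Discrete cone comparison and the viscosity limit both rest
  on a good choice of \<open>z\<close>.\<close>

lemma minmax_le:
  assumes "bounded (u ` K)" "x \<in> K" "z \<in> K" "dist x z \<le> e"
    and le: "\<And>y. y \<in> K \<Longrightarrow> dist x y \<le> e \<Longrightarrow> u y \<le> M"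
  shows "minmax K e u x \<le> (u z + M) / 2"
proof -
  let ?A = "K \<inter> cball x e"
  have z: "z \<in> ?A" using assms by auto
  have "(SUP y\<in>?A. u y) \<le> M"
    using z le by (intro cSUP_least) auto
  moreover have "bounded (u ` ?A)" using assms bounded_image_subset by blast
  then have "(INF y\<in>?A. u y) \<le> u z"
    by (intro cINF_lower bounded_imp_bdd_below z)
  ultimately show ?thesis by (simp add: minmax_def)
qed

lemma minmax_uminus: "minmax K e (\<lambda>y. - u y) x = - minmax K e u x"
proof -
  have *: "(INF y\<in>A. - v y) = - (SUP y\<in>A. v y)" for v :: "'a \<Rightarrow> real" and A
    by (simp add: Inf_real_def image_image)
  from *[of "\<lambda>y. - u y" "K \<inter> cball x e"] *[of u "K \<inter> cball x e"] show ?thesis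
    by (simp add: minmax_def field_simps)
qed

lemma minmax_abs_diff_le:
  assumes "bounded (u ` K)" "bounded (v ` K)" "x \<in> K" "0 \<le> e"
    and "\<And>y. y \<in> K \<Longrightarrow> dist x y \<le> e \<Longrightarrow> \<bar>u y - v y\<bar> \<le> d"
  shows "\<bar>minmax K e u x - minmax K e v x\<bar> \<le> d"
proof -
  have le: "u y \<le> v y + d" "v y \<le> u y + d" if "y \<in> K" "dist x y \<le> e" for y
    using assms(5)[OF that] by linarith+
  have "minmax K e u x \<le> minmax K e v x + d"
    by (rule minmax_mono) (use assms(1-4) le in auto)
  moreover have "minmax K e v x \<le> minmax K e u x + d"
    by (rule minmax_mono) (use assms(1-4) le in auto)
  ultimately show ?thesis by simp
qed

lemma minmax_const: "x \<in> K \<Longrightarrow> 0 \<le> e \<Longrightarrow> minmax K e (\<lambda>y. c) x = c"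
proof -
  assume "x \<in> K" "0 \<le> e"
  then have "K \<inter> cball x e \<noteq> {}" by auto
  then show ?thesis by (simp add: minmax_def)
qed

lemma minmax_abs_le:
  assumes "x \<in> K" "0 \<le> e" and d: "\<And>y. y \<in> K \<Longrightarrow> \<bar>u y - c\<bar> \<le> d"
  shows "\<bar>minmax K e u x - c\<bar> \<le> d"
proof -
  have "bounded (u ` K)"
    by (rule bounded_image_realI[where B="\<bar>c\<bar> + d"]) (use d in force)
  moreover have "bounded ((\<lambda>y. c) ` K)" by (rule bounded_image_realI) auto
  ultimately have "\<bar>minmax K e u x - minmax K e (\<lambda>y. c) x\<bar> \<le> d"
    by (rule minmax_abs_diff_le) (use assms in auto)
  then show ?thesis using assms by (simp add: minmax_const)
qed

lemma bounded_minmax: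
  assumes "bounded (u ` K)" "0 \<le> e"
  shows "bounded (minmax K e u ` K)"
proof -
  obtain B where B: "\<And>y. y \<in> K \<Longrightarrow> \<bar>u y\<bar> \<le> B" using assms bounded_image_realE by metis
  show ?thesis
    by (rule bounded_image_realI[where B=B]) (use minmax_abs_le[of _ K e u 0 B] B assms in auto)
qed

lemma minmax_add_const:
  assumes "bounded (u ` K)" "x \<in> K" "0 \<le> e"
  shows "minmax K e (\<lambda>y. u y + c) x = minmax K e u x + c"
proof -
  obtain B where B: "\<And>y. y \<in> K \<Longrightarrow> \<bar>u y\<bar> \<le> B" using assms bounded_image_realE by metis
  have "bounded ((\<lambda>y. u y + c) ` K)"
    by (rule bounded_image_realI[where B="B + \<bar>c\<bar>"]) (use B in force)
  note b = this
  have "minmax K e (\<lambda>y. u y + c) x \<le> minmax K e u x + c"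
    by (rule minmax_mono) (use assms b in auto)
  moreover have "minmax K e u x \<le> minmax K e (\<lambda>y. u y + c) x + - c"
    by (rule minmax_mono) (use assms b in auto)
  ultimately show ?thesis by simp
qed

lemma minmax_mult:
  assumes "x \<in> K" "0 \<le> e" "bounded (u ` K)" "0 < a"
  shows "minmax K e (\<lambda>y. a * u y) x = a * minmax K e u x"
proof -
  let ?A = "K \<inter> cball x e"
  have ne: "?A \<noteq> {}" using assms by auto
  have mo: "mono ((*) a)" using \<open>0 < a\<close> by (auto intro!: monoI mult_left_mono)
  have c: "continuous (at z within S) ((*) a)" for z S by (intro continuous_intros)
  have b: "bounded (u ` ?A)" using assms bounded_image_subset by blast
  have "a * (SUP y\<in>?A. u y) = (SUP y\<in>?A. a * u y)"
    using continuous_at_Sup_mono[OF mo c _ bounded_imp_bdd_above[OF b]] ne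
    unfolding image_image by blast
  moreover have "a * (INF y\<in>?A. u y) = (INF y\<in>?A. a * u y)"
    using continuous_at_Inf_mono[OF mo c _ bounded_imp_bdd_below[OF b]] ne
    unfolding image_image by blast
  ultimately show ?thesis by (simp add: minmax_def field_simps)
qed

text \<open>The map is a contraction with factor \<open>1 - l\<close> in the sup norm and preserves
  the bound \<open>C / l\<close>. Two consecutive iterates from 0 differ by at most
  \<open>(1 - l) ^ n * C\<close>, so a late iterate is already as good as a fixed point.\<close>

lemma discounted_approximate_fixpoint:
  fixes F :: "'a::metric_space \<Rightarrow> real"
  assumes F: "\<And>x. x \<in> K \<Longrightarrow> \<bar>F x\<bar> \<le> C" and "0 \<le> e" "0 < l" "l < 1" "0 < d" "0 \<le> C"
  obtains v where "\<And>x. x \<in> K \<Longrightarrow> \<bar>l * v x\<bar> \<le> C"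
    and "\<And>x. x \<in> K \<Longrightarrow> \<bar>v x - ((1 - l) * minmax K e v x + F x)\<bar> \<le> d"
proof -
  define w where "w n = ((\<lambda>v x. (1 - l) * minmax K e v x + F x) ^^ n) (\<lambda>x. 0)" for n
  have w0: "w 0 = (\<lambda>x. 0)" and wS: "w (Suc n) = (\<lambda>x. (1 - l) * minmax K e (w n) x + F x)" for n
    by (simp_all add: w_def)
  have bd: "\<bar>w n x\<bar> \<le> C / l" if "x \<in> K" for n x
    using that
  proof (induction n arbitrary: x)
    case 0
    show ?case using \<open>0 \<le> C\<close> \<open>0 < l\<close> by (simp add: w0)
  next
    case (Suc n)
    have "\<bar>minmax K e (w n) x\<bar> \<le> C / l"
      using minmax_abs_le[OF Suc.prems \<open>0 \<le> e\<close>, of "w n" 0 "C/l"] Suc.IH by simp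
    then have "(1 - l) * \<bar>minmax K e (w n) x\<bar> \<le> (1 - l) * (C / l)"
      using assms by (intro mult_left_mono) auto
    then have "\<bar>(1 - l) * minmax K e (w n) x + F x\<bar> \<le> (1 - l) * (C / l) + C"
      using F[OF Suc.prems] assms abs_triangle_ineq[of "(1 - l) * minmax K e (w n) x" "F x"]
      by (simp add: abs_mult)
    also have "\<dots> = C / l" using assms by (simp add: field_simps)
    finally show ?case by (simp add: wS)
  qed
  have bdd: "bounded (w n ` K)" for n using bd by (rule bounded_image_realI)
  have step: "\<bar>w (Suc n) x - w n x\<bar> \<le> (1 - l) ^ n * C" if "x \<in> K" for n x
    using that
  proof (induction n arbitrary: x)
    case 0
    then show ?case using F[of x] \<open>0 \<le> e\<close> by (simp add: w0 wS minmax_const)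
  next
    case (Suc n)
    have "\<bar>minmax K e (w (Suc n)) x - minmax K e (w n) x\<bar> \<le> (1 - l) ^ n * C"
      using minmax_abs_diff_le[OF bdd bdd Suc.prems \<open>0 \<le> e\<close>] Suc.IH by blast
    then have "(1 - l) * \<bar>minmax K e (w (Suc n)) x - minmax K e (w n) x\<bar> \<le> (1 - l) * ((1 - l) ^ n * C)"
      using assms by (intro mult_left_mono) auto
    moreover have "\<bar>w (Suc (Suc n)) x - w (Suc n) x\<bar>
        = (1 - l) * \<bar>minmax K e (w (Suc n)) x - minmax K e (w n) x\<bar>"
      using \<open>l < 1\<close> by (simp add: wS abs_mult flip: right_diff_distrib)
    ultimately show ?case by simp
  qed
  \<comment> \<open>The denominator \<open>C + 1\<close> instead of \<open>C\<close> covers the case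
    \<open>C = 0\<close>.\<close>
  obtain n where n: "(1 - l) ^ n < d / (C + 1)"
    using real_arch_pow_inv[of "d / (C + 1)" "1 - l"] assms by auto
  have "(1 - l) ^ n * C \<le> (1 - l) ^ n * (C + 1)" using assms by (intro mult_left_mono) auto
  also have "\<dots> \<le> d" using n assms by (simp add: field_simps)
  finally have *: "(1 - l) ^ n * C \<le> d" .
  show ?thesis
  proof
    fix x assume x: "x \<in> K"
    have "\<bar>l * w n x\<bar> = l * \<bar>w n x\<bar>" using assms by (simp add: abs_mult)
    also have "\<dots> \<le> l * (C / l)" using bd[OF x] assms by (intro mult_left_mono) auto
    finally show "\<bar>l * w n x\<bar> \<le> C" using assms by simp
    show "\<bar>w n x - ((1 - l) * minmax K e (w n) x + F x)\<bar> \<le> d"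
      using step[OF x, of n] * by (simp add: wS abs_minus_commute)
  qed
qed

text \<open>If the excess of \<open>v\<close> over the cone had a supremum \<open>m > A\<close> on
  the ball of radius \<open>P\<close>, consider a near-maximal point at distance \<open>r\<close>
  from \<open>z\<close>. For \<open>r > e\<close>, moving \<open>e\<close> towards \<open>z\<close>
  and at most \<open>e\<close> away from it changes the concave profile by a second difference of
  \<open>- c * e\<^sup>2\<close>, more than the subsolution inequality allows because
  \<open>C < c\<close>. For \<open>r \<le> e\<close> the vertex itself is a legal move, where the
  excess is 0, so only half of \<open>m\<close> survives. The slack \<open>A\<close> is what this
  second case costs. Moves can end beyond \<open>P\<close>, whence the hypothesis on the outer shell
  and the monotonicity of the profile up to \<open>P + e\<close>.\<close>

lemma discrete_cone_comparison:
  fixes v :: "'a::real_normed_vector \<Rightarrow> real"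
  assumes "convex K" and bdv: "bounded (v ` K)" and "z \<in> K" "0 < e" "0 \<le> P" "0 \<le> c" "C < c"
    and b: "c * (P + e) \<le> b" and A: "b * e + 2 * c * e\<^sup>2 \<le> A"
    and sub: "\<And>y. y \<in> K \<Longrightarrow> dist z y \<le> P \<Longrightarrow> v y \<le> minmax K e v y + e\<^sup>2 / 2 * C"
    and outer: "\<And>y. y \<in> K \<Longrightarrow> P < dist z y \<Longrightarrow> dist z y \<le> P + e \<Longrightarrow>
      v y \<le> v z + (b * dist z y - c / 2 * (dist z y)\<^sup>2) + A"
    and x: "x \<in> K" "dist z x \<le> P"
  shows "v x \<le> v z + (b * dist z x - c / 2 * (dist z x)\<^sup>2) + A"
proof (rule ccontr)
  assume neg: "\<not> ?thesis"
  define \<phi> where "\<phi> r = b * r - c / 2 * r\<^sup>2" for r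
  have \<phi>_mono: "\<phi> s \<le> \<phi> t" if "s \<le> t" "t \<le> P + e" for s t
  proof -
    have "c * (s + t) \<le> c * (2 * (P + e))" using that \<open>0 \<le> c\<close> by (intro mult_left_mono) auto
    also have "\<dots> = 2 * (c * (P + e))" by simp
    finally have "c * (s + t) / 2 \<le> b" using b by linarith
    then have "0 \<le> (t - s) * (b - c * (s + t) / 2)" using that by simp
    also have "\<dots> = \<phi> t - \<phi> s" by (simp add: \<phi>_def field_simps power2_eq_square)
    finally show ?thesis by simp
  qed
  have "0 \<le> c * (P + e)" using assms by simp
  then have b0: "0 \<le> b" using b by simp
  then have A0: "0 \<le> A" using A assms by (smt (verit) mult_nonneg_nonneg zero_le_power2)
  define S where "S = K \<inter> cball z P"
  define g where "g y = v y - v z - \<phi> (dist z y)" for y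
  define m where "m = (SUP y\<in>S. g y)"
  have xS: "x \<in> S" and zS: "z \<in> S" using assms by (auto simp: S_def)
  obtain B where B: "\<And>y. y \<in> K \<Longrightarrow> \<bar>v y\<bar> \<le> B" using bdv bounded_image_realE by metis
  have "g y \<le> B - v z" if "y \<in> S" for y
    using that B[of y] \<phi>_mono[of 0 "dist z y"] \<open>0 < e\<close> by (auto simp: S_def g_def \<phi>_def)
  then have bdd: "bdd_above (g ` S)" by fast
  have gm: "g y \<le> m" if "y \<in> S" for y
    unfolding m_def using bdd that by (rule cSUP_upper2) simp
  have mA: "m > A" using neg gm[OF xS] by (simp add: g_def \<phi>_def)
  \<comment> \<open>The tolerance for near-maximality lies strictly below the defects that yield the
    contradictions: \<open>(c - C) * e\<^sup>2 / 2\<close> away from the vertex and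
    \<open>(m - A) / 2\<close> near it.\<close>
  define \<tau> where "\<tau> = min ((c - C) * e\<^sup>2 / 2) ((m - A) / 2) / 2"
  have \<tau>: "\<tau> > 0" "\<tau> < (c - C) * e\<^sup>2 / 2" "\<tau> < (m - A) / 2"
  proof -
    have "0 < (c - C) * e\<^sup>2 / 2" using assms by simp
    then show "\<tau> > 0" "\<tau> < (c - C) * e\<^sup>2 / 2" "\<tau> < (m - A) / 2"
      using mA unfolding \<tau>_def by (simp_all add: min_def)
  qed
  obtain y where y: "y \<in> S" "m - \<tau> < g y"
    using less_cSUP_iff[OF _ bdd, of "m - \<tau>"] zS \<tau>(1) unfolding m_def by fastforce
  define r where "r = dist z y"
  have yK: "y \<in> K" and rP: "r \<le> P" using y by (auto simp: S_def r_def)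
  have "y \<noteq> z" using y(2) \<tau> mA A0 by (auto simp: g_def \<phi>_def)
  then have r0: "0 < r" by (simp add: r_def)
  have vy: "v y = v z + \<phi> r + g y" by (simp add: g_def r_def)
  have ub: "v y' \<le> v z + \<phi> (r + e) + m" if "y' \<in> K" "dist y y' \<le> e" for y'
  proof -
    have d: "dist z y' \<le> r + e" using that dist_triangle[of z y' y] by (simp add: r_def)
    have "v y' \<le> v z + \<phi> (dist z y') + m"
    proof (cases "dist z y' \<le> P")
      case True
      then show ?thesis using gm[of y'] that by (simp add: S_def g_def)
    next
      case False
      then show ?thesis using outer[of y'] that d rP mA by (simp add: \<phi>_def)
    qed
    moreover have "\<phi> (dist z y') \<le> \<phi> (r + e)" using d rP by (intro \<phi>_mono) auto
    ultimately show ?thesis by simp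
  qed
  have sub_y: "v y \<le> minmax K e v y + e\<^sup>2 / 2 * C" using sub yK rP by (simp add: r_def)
  show False
  proof (cases "r \<le> e")
    case True
    \<comment> \<open>The minimising move goes to the vertex, so that \<open>m\<close> enters
      through the supremum alone and with weight one half.\<close>
    have "minmax K e v y \<le> (v z + (v z + \<phi> (r + e) + m)) / 2"
      by (rule minmax_le) (use bdv yK \<open>z \<in> K\<close> True ub in \<open>auto simp: r_def dist_commute\<close>)
    then have 1: "m / 2 < \<tau> + (\<phi> (r + e) / 2 - \<phi> r) + e\<^sup>2 / 2 * C"
      using sub_y vy y(2) by (simp add: field_simps)
    have "\<phi> (r + e) / 2 - \<phi> r = b * e / 2 - b * r / 2 + c * r\<^sup>2 / 2 - c * (r + e)\<^sup>2 / 4"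
      by (simp add: \<phi>_def field_simps)
    also have "\<dots> \<le> b * e / 2 + c * e\<^sup>2 / 2"
    proof -
      have "c * r\<^sup>2 \<le> c * e\<^sup>2" using True r0 \<open>0 \<le> c\<close> by (intro mult_left_mono power_mono) auto
      moreover have "0 \<le> b * r" "0 \<le> c * (r + e)\<^sup>2" using b0 r0 \<open>0 \<le> c\<close> by auto
      ultimately show ?thesis by linarith
    qed
    finally have 2: "\<phi> (r + e) / 2 - \<phi> r \<le> b * e / 2 + c * e\<^sup>2 / 2" .
    have "e\<^sup>2 / 2 * C \<le> e\<^sup>2 / 2 * c" using \<open>C < c\<close> by (intro mult_left_mono) auto
    then have "m / 2 < \<tau> + A / 2" using 1 2 A by (simp add: field_simps)
    then show False using \<tau> by (simp add: field_simps)
  next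
    case False
    \<comment> \<open>The point at distance \<open>e\<close> from \<open>y\<close> on the segment
      towards \<open>z\<close>; convexity keeps it in \<open>K\<close>.\<close>
    define y1 where "y1 = (1 - e / r) *\<^sub>R y + (e / r) *\<^sub>R z"
    have y1K: "y1 \<in> K"
      using False \<open>0 < e\<close> r0 yK \<open>z \<in> K\<close> \<open>convex K\<close> unfolding y1_def by (intro convexD) auto
    have "y - y1 = (e / r) *\<^sub>R (y - z)" by (simp add: y1_def algebra_simps)
    then have d1: "dist y y1 = e" using r0 \<open>0 < e\<close> by (simp add: dist_norm r_def norm_minus_commute)
    have "z - y1 = (1 - e / r) *\<^sub>R (z - y)" by (simp add: y1_def algebra_simps)
    then have "dist z y1 = \<bar>1 - e / r\<bar> * r" by (simp add: dist_norm r_def)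
    also have "\<dots> = r - e" using False r0 \<open>0 < e\<close> by (simp add: abs_if field_simps)
    finally have d2: "dist z y1 = r - e" .
    then have "v y1 \<le> v z + \<phi> (r - e) + m"
      using gm[of y1] y1K rP \<open>0 < e\<close> by (simp add: S_def g_def)
    moreover have "minmax K e v y \<le> (v y1 + (v z + \<phi> (r + e) + m)) / 2"
      by (rule minmax_le) (use bdv yK y1K d1 ub in auto)
    moreover have "\<phi> (r + e) + \<phi> (r - e) = 2 * \<phi> r - c * e\<^sup>2"
      by (simp add: \<phi>_def field_simps power2_eq_square)
    ultimately have "(c - C) * e\<^sup>2 / 2 < \<tau>"
      using sub_y vy y(2) by (simp add: field_simps)
    then show False using \<tau> by simp
  qed
qed

text \<open>Cone comparison with \<open>P = D\<close>, so that the outer shell is empty, curvature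
  \<open>C + 1\<close> and slope \<open>(C + 1) * (D + 1)\<close>. The slack is of order
  \<open>e\<close> because \<open>e\<^sup>2 \<le> e\<close>; it leaves room for jumps of that size,
  so this is a Lipschitz bound only at distances large compared with \<open>e\<close>.\<close>

lemma large_scale_lipschitz:
  fixes v :: "'a::real_normed_vector \<Rightarrow> real"
  assumes "convex K" "bounded (v ` K)" and D: "\<And>x y. x \<in> K \<Longrightarrow> y \<in> K \<Longrightarrow> dist x y \<le> D"
    and "0 < e" "e \<le> 1" "0 \<le> C" "0 \<le> D"
    and sub: "\<And>y. y \<in> K \<Longrightarrow> v y \<le> minmax K e v y + e\<^sup>2 / 2 * C"
    and "z \<in> K" "x \<in> K"
  shows "v x - v z \<le> (C + 1) * (D + 1) * dist z x + (C + 1) * (D + 3) * e"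
proof -
  have "v x \<le> v z + ((C + 1) * (D + 1) * dist z x - (C + 1) / 2 * (dist z x)\<^sup>2) + (C + 1) * (D + 3) * e"
  proof (rule discrete_cone_comparison[where K=K and v=v and e=e and P=D and C=C])
    show "(C + 1) * (D + e) \<le> (C + 1) * (D + 1)" using assms by simp
    have "e * e \<le> 1 * e" using assms by (intro mult_right_mono) auto
    then have "2 * (C + 1) * e\<^sup>2 \<le> 2 * (C + 1) * e"
      using assms unfolding power2_eq_square by (intro mult_left_mono) auto
    then show "(C + 1) * (D + 1) * e + 2 * (C + 1) * e\<^sup>2 \<le> (C + 1) * (D + 3) * e"
      by (simp add: algebra_simps)
    show "v y \<le> v z + ((C + 1) * (D + 1) * dist z y - (C + 1) / 2 * (dist z y)\<^sup>2) + (C + 1) * (D + 3) * e"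
      if "y \<in> K" "D < dist z y" for y
      using D[OF \<open>z \<in> K\<close> that(1)] that(2) by simp
  qed (use assms in auto)
  moreover have "0 \<le> (C + 1) / 2 * (dist z x)\<^sup>2" using assms by simp
  ultimately show ?thesis by linarith
qed

text \<open>Vanishing discount: in the discounted equation the term \<open>l * w\<close> is replaced
  by the constant \<open>l * w x0\<close>. The error is at most \<open>l\<close> times the
  oscillation of \<open>w\<close>, which is bounded independently of \<open>l\<close>. The factor
  \<open>2 * C + 3\<close> is the curvature in the Lipschitz estimate for the right-hand side bound
  \<open>2 * C + 2\<close>.\<close>

lemma approximate_ergodic_solution:
  fixes f :: "'a::real_normed_vector \<Rightarrow> real"
  assumes "convex K" and D: "\<And>x y. x \<in> K \<Longrightarrow> y \<in> K \<Longrightarrow> dist x y \<le> D" and "x0 \<in> K"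
    and f: "\<And>x. x \<in> K \<Longrightarrow> \<bar>f x\<bar> \<le> C" and "0 < e" "e \<le> 1" "0 < \<tau>"
  defines "L \<equiv> (2 * C + 3) * (D + 1)" and "A \<equiv> (2 * C + 3) * (D + 3)"
  shows "\<exists>v k. \<bar>k\<bar> \<le> C \<and> (\<forall>x\<in>K. \<bar>v x\<bar> \<le> L * D + A) \<and>
    (\<forall>x\<in>K. \<forall>y\<in>K. v x - v y \<le> L * dist y x + A * e) \<and>
    (\<forall>x\<in>K. \<bar>v x - (minmax K e v x + e\<^sup>2 / 2 * (f x - k))\<bar> \<le> \<tau>)"
proof -
  have C0: "0 \<le> C" using f[OF \<open>x0 \<in> K\<close>] by simp
  have D0: "0 \<le> D" using D[OF \<open>x0 \<in> K\<close> \<open>x0 \<in> K\<close>] by simp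
  have LA: "0 \<le> L" "0 \<le> A" using C0 D0 by (auto simp: L_def A_def)
  define N where "N = L * D + A"
  have N0: "0 \<le> N" using LA D0 by (simp add: N_def)
  \<comment> \<open>\<open>N\<close> bounds the oscillation for every discount, so \<open>l\<close>
    may be chosen after it.\<close>
  define l where "l = min (1 / 2) (\<tau> / (2 * (N + 1)))"
  define d where "d = min (e\<^sup>2) (\<tau> / 2)"
  have l: "0 < l" "l < 1" using N0 \<open>0 < \<tau>\<close> by (auto simp: l_def)
  have lN: "l * N \<le> \<tau> / 2"
  proof -
    have "l * N \<le> \<tau> / (2 * (N + 1)) * N" using N0 by (intro mult_right_mono) (auto simp: l_def)
    also have "\<dots> \<le> \<tau> / 2" using N0 \<open>0 < \<tau>\<close> by (simp add: field_simps)
    finally show ?thesis .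
  qed
  have d: "0 < d" "d \<le> e\<^sup>2" "d \<le> \<tau> / 2" using \<open>0 < e\<close> \<open>0 < \<tau>\<close> by (auto simp: d_def)
  have F: "\<bar>e\<^sup>2 / 2 * f x\<bar> \<le> e\<^sup>2 / 2 * C" if "x \<in> K" for x
    using mult_left_mono[OF f[OF that], of "e\<^sup>2 / 2"] by (simp add: abs_mult)
  obtain w where w1: "\<And>x. x \<in> K \<Longrightarrow> \<bar>l * w x\<bar> \<le> e\<^sup>2 / 2 * C"
    and w2: "\<And>x. x \<in> K \<Longrightarrow> \<bar>w x - ((1 - l) * minmax K e w x + e\<^sup>2 / 2 * f x)\<bar> \<le> d"
    using discounted_approximate_fixpoint[of K "\<lambda>x. e\<^sup>2 / 2 * f x" "e\<^sup>2 / 2 * C" e l d] F l d C0 \<open>0 < e\<close>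
    by auto
  have w3: "\<bar>w x\<bar> \<le> e\<^sup>2 / 2 * C / l" if "x \<in> K" for x
    using w1[OF that] l by (simp add: abs_mult field_simps)
  then have bdw: "bounded (w ` K)" by (rule bounded_image_realI)
  have mm: "\<bar>l * minmax K e w x\<bar> \<le> e\<^sup>2 / 2 * C" if "x \<in> K" for x
    using minmax_abs_le[OF that, of e w 0 "e\<^sup>2 / 2 * C / l"] w3 l \<open>0 < e\<close> by (simp add: abs_mult field_simps)
  \<comment> \<open>The discount term and \<open>f\<close> contribute \<open>C\<close> each, the
    tolerance \<open>d \<le> e\<^sup>2\<close> contributes 2.\<close>
  have wmm: "w x \<le> minmax K e w x + e\<^sup>2 / 2 * (2 * C + 2)" if "x \<in> K" for x
  proof -
    have "w x - minmax K e w x \<le> d - l * minmax K e w x + e\<^sup>2 / 2 * f x"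
      using w2[OF that] by (simp add: algebra_simps abs_le_iff)
    also have "\<dots> \<le> e\<^sup>2 + e\<^sup>2 / 2 * C + e\<^sup>2 / 2 * C"
      using d mm[OF that] F[OF that] by linarith
    finally show ?thesis by (simp add: field_simps)
  qed
  have lip: "w x - w y \<le> L * dist y x + A * e" if "x \<in> K" "y \<in> K" for x y
    using large_scale_lipschitz[OF \<open>convex K\<close> bdw D \<open>0 < e\<close> \<open>e \<le> 1\<close> _ D0 wmm that(2,1)] C0
    by (simp add: L_def A_def add.assoc)
  have osc: "\<bar>w x - w y\<bar> \<le> N" if "x \<in> K" "y \<in> K" for x y
  proof -
    have "L * dist x y \<le> L * D" "A * e \<le> A * 1"
      using D[OF that] LA \<open>e \<le> 1\<close> by (intro mult_left_mono; simp)+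
    then show ?thesis using lip[OF that] lip[OF that(2,1)] by (simp add: N_def dist_commute abs_le_iff)
  qed
  \<comment> \<open>The ergodic constant: the discount term at the base point, in units of
    \<open>e\<^sup>2 / 2\<close>.\<close>
  define k where "k = 2 / e\<^sup>2 * (l * w x0)"
  have ek: "e\<^sup>2 / 2 * k = l * w x0" using \<open>0 < e\<close> by (simp add: k_def)
  show ?thesis
  proof (intro exI[of _ "\<lambda>x. w x - w x0"] exI[of _ k] conjI ballI)
    have "\<bar>k\<bar> = 2 / e\<^sup>2 * \<bar>l * w x0\<bar>" unfolding k_def abs_mult by simp
    also have "\<dots> \<le> 2 / e\<^sup>2 * (e\<^sup>2 / 2 * C)" using w1[OF \<open>x0 \<in> K\<close>] by (intro mult_left_mono) auto
    also have "\<dots> = C" using \<open>0 < e\<close> by simp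
    finally show "\<bar>k\<bar> \<le> C" .
    show "\<bar>w x - w x0\<bar> \<le> L * D + A" if "x \<in> K" for x
      using osc[OF that \<open>x0 \<in> K\<close>] by (simp add: N_def)
    show "w x - w x0 - (w y - w x0) \<le> L * dist y x + A * e" if "x \<in> K" "y \<in> K" for x y
      using lip[OF that] by simp
    show "\<bar>w x - w x0 - (minmax K e (\<lambda>x. w x - w x0) x + e\<^sup>2 / 2 * (f x - k))\<bar> \<le> \<tau>" if x: "x \<in> K" for x
    proof -
      have eq1: "minmax K e (\<lambda>x. w x - w x0) x = minmax K e w x - w x0"
        using minmax_add_const[OF bdw x, of e "- w x0"] \<open>0 < e\<close> by simp
      have eq2: "e\<^sup>2 / 2 * (f x - k) = e\<^sup>2 / 2 * f x - l * w x0"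
        by (simp only: right_diff_distrib ek)
      have "w x - w x0 - (minmax K e (\<lambda>x. w x - w x0) x + e\<^sup>2 / 2 * (f x - k))
          = (w x - ((1 - l) * minmax K e w x + e\<^sup>2 / 2 * f x)) - l * (minmax K e w x - w x0)"
        unfolding eq1 eq2 by (simp add: left_diff_distrib right_diff_distrib)
      moreover have "\<bar>minmax K e w x - w x0\<bar> \<le> N"
        using x osc \<open>x0 \<in> K\<close> \<open>0 < e\<close> by (intro minmax_abs_le) auto
      then have "l * \<bar>minmax K e w x - w x0\<bar> \<le> \<tau> / 2"
        using mult_left_mono[of "\<bar>minmax K e w x - w x0\<bar>" N l] l lN by linarith
      then have "\<bar>l * (minmax K e w x - w x0)\<bar> \<le> \<tau> / 2" using l by (simp add: abs_mult)
      ultimately show ?thesis using w2[OF x] d by linarith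
    qed
  qed
qed

section \<open>Growth of the value iteration\<close>

lemma dist_le_path_length: "ennreal (dist (pathstart g) (pathfinish g)) \<le> path_length g"
proof -
  define t :: "nat \<Rightarrow> real" where "t i = (if i = 0 then 0 else 1)" for i
  have "(1, t) \<in> {(n, t). mono t \<and> range t \<subseteq> {0..1}}"
    by (auto simp: t_def mono_def)
  then have "(case (1, t) of (n, t) \<Rightarrow> \<Sum>i<n. ennreal (dist (g (t i)) (g (t (Suc i))))) \<le> path_length g"
    unfolding path_length_def by (rule SUP_upper)
  then show ?thesis by (simp add: t_def pathstart_def pathfinish_def)
qed

lemma path_length_linepath_le:
  fixes x y :: "'a::real_normed_vector"
  shows "path_length (linepath x y) \<le> ennreal (dist x y)"
  unfolding path_length_def
proof (rule SUP_least)
  fix p :: "nat \<times> (nat \<Rightarrow> real)"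
  assume "p \<in> {(n, t). mono t \<and> range t \<subseteq> {0..1}}"
  then obtain n t where p: "p = (n, t)" and t: "mono t" "range t \<subseteq> {0..1}" by auto
  have le: "t i \<le> t (Suc i)" for i using t by (simp add: mono_def)
  have "dist (linepath x y a) (linepath x y b) = \<bar>b - a\<bar> * dist x y" for a b
  proof -
    have "linepath x y a - linepath x y b = (b - a) *\<^sub>R (x - y)"
      by (simp add: linepath_def algebra_simps)
    then show ?thesis by (simp add: dist_norm)
  qed
  then have "(\<Sum>i<n. ennreal (dist (linepath x y (t i)) (linepath x y (t (Suc i)))))
      = (\<Sum>i<n. ennreal ((t (Suc i) - t i) * dist x y))"
    using le by simp
  also have "\<dots> = ennreal (\<Sum>i<n. (t (Suc i) - t i) * dist x y)"
    using le by (intro sum_ennreal) simp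
  also have "(\<Sum>i<n. (t (Suc i) - t i) * dist x y) = (t n - t 0) * dist x y"
    by (simp add: sum_lessThan_telescope flip: sum_distrib_right)
  \<comment> \<open>The partition need not begin at 0 or end at 1, so \<open>t n - t 0\<close> is
    only bounded by 1.\<close>
  also have "ennreal \<dots> \<le> ennreal (dist x y)"
  proof (rule ennreal_leI)
    have "t i \<in> {0..1}" for i using t(2) by blast
    from this[of n] this[of 0] have "(t n - t 0) * dist x y \<le> 1 * dist x y" by (intro mult_right_mono) auto
    then show "(t n - t 0) * dist x y \<le> dist x y" by simp
  qed
  finally show "(case p of (n, t) \<Rightarrow> \<Sum>i<n. ennreal (dist (linepath x y (t i)) (linepath x y (t (Suc i)))))
      \<le> ennreal (dist x y)"
    by (simp add: p)
qed

lemma intrinsic_dist_convex: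
  assumes "convex \<Omega>" "x \<in> closure \<Omega>" "y \<in> closure \<Omega>"
  shows "intrinsic_dist \<Omega> x y = ennreal (dist x y)"
proof (rule antisym)
  have "closed_segment x y \<subseteq> closure \<Omega>"
    using assms by (intro closed_segment_subset convex_closure)
  then have "intrinsic_dist \<Omega> x y \<le> path_length (linepath x y)"
    unfolding intrinsic_dist_def by (intro INF_lower) simp
  then show "intrinsic_dist \<Omega> x y \<le> ennreal (dist x y)"
    using path_length_linepath_le order_trans by blast
  show "ennreal (dist x y) \<le> intrinsic_dist \<Omega> x y"
    unfolding intrinsic_dist_def
  proof (rule INF_greatest)
    fix g assume "g \<in> {g. path g \<and> path_image g \<subseteq> closure \<Omega> \<and> pathstart g = x \<and> pathfinish g = y}"
    then show "ennreal (dist x y) \<le> path_length g"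
      using dist_le_path_length[of g] by auto
  qed
qed

lemma intrinsic_cball_convex:
  assumes "convex \<Omega>" "x \<in> closure \<Omega>" "0 \<le> e"
  shows "intrinsic_cball \<Omega> x e = closure \<Omega> \<inter> cball x e"
  using assms by (auto simp: intrinsic_cball_def intrinsic_dist_convex)

section \<open>Comparison principle for the iteration\<close>

lemma game_iter_Suc_convex:
  assumes "convex \<Omega>" "x \<in> closure \<Omega>" "0 \<le> e"
  shows "game_iter \<Omega> f e u0 (Suc n) x = minmax (closure \<Omega>) e (game_iter \<Omega> f e u0 n) x + f x"
  using assms by (simp add: intrinsic_cball_convex minmax_def)

lemma bounded_game_iter:
  assumes "convex \<Omega>" "0 \<le> e" "bounded (f ` closure \<Omega>)" "bounded (u0 ` closure \<Omega>)"
  shows "bounded (game_iter \<Omega> f e u0 n ` closure \<Omega>)"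
proof (induction n)
  case (Suc n)
  obtain B where B: "\<And>x. x \<in> closure \<Omega> \<Longrightarrow> \<bar>minmax (closure \<Omega>) e (game_iter \<Omega> f e u0 n) x\<bar> \<le> B"
    using bounded_minmax[OF Suc assms(2)] bounded_image_realE by metis
  obtain C where C: "\<And>x. x \<in> closure \<Omega> \<Longrightarrow> \<bar>f x\<bar> \<le> C"
    using assms(3) bounded_image_realE by metis
  show ?case
  proof (rule bounded_image_realI)
    fix x assume x: "x \<in> closure \<Omega>"
    show "\<bar>game_iter \<Omega> f e u0 (Suc n) x\<bar> \<le> B + C"
      unfolding game_iter_Suc_convex[OF assms(1) x assms(2)] using B[OF x] C[OF x] by linarith
  qed
qed (use assms in simp)

lemma game_iter_uminus:
  assumes "convex \<Omega>" "0 \<le> e" "x \<in> closure \<Omega>"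
  shows "game_iter \<Omega> (\<lambda>x. - f x) e (\<lambda>x. - u0 x) n x = - game_iter \<Omega> f e u0 n x"
  using assms(3)
proof (induction n arbitrary: x)
  case (Suc n)
  let ?K = "closure \<Omega>"
  have "minmax ?K e (game_iter \<Omega> (\<lambda>x. - f x) e (\<lambda>x. - u0 x) n) x
      = minmax ?K e (\<lambda>y. - game_iter \<Omega> f e u0 n y) x"
    by (rule minmax_cong) (use Suc.IH in auto)
  then show ?case
    unfolding game_iter_Suc_convex[OF assms(1) Suc.prems assms(2)] by (simp add: minmax_uminus)
qed simp

text \<open>\<open>minmax\<close> is monotone and commutes with adding constants. An initial
  ordering up to \<open>B\<close> is therefore preserved, while \<open>u\<close> gains at least
  \<open>k\<close> in each step.\<close>

lemma game_iter_lower: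
  assumes "convex \<Omega>" "0 \<le> e" "bounded (f ` closure \<Omega>)" "bounded (u0 ` closure \<Omega>)"
    and bdu: "bounded (u ` closure \<Omega>)"
    and sub: "\<And>x. x \<in> closure \<Omega> \<Longrightarrow> u x + k \<le> minmax (closure \<Omega>) e u x + f x"
    and B: "\<And>x. x \<in> closure \<Omega> \<Longrightarrow> u x \<le> u0 x + B"
    and "x \<in> closure \<Omega>"
  shows "u x + real n * k \<le> game_iter \<Omega> f e u0 n x + B"
  using assms(8)
proof (induction n arbitrary: x)
  case (Suc n)
  let ?K = "closure \<Omega>"
  have bd: "bounded (game_iter \<Omega> f e u0 n ` ?K)" using bounded_game_iter assms by blast
  have "minmax ?K e u x + (real n * k - B) = minmax ?K e (\<lambda>y. u y + (real n * k - B)) x"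
    using minmax_add_const[OF bdu Suc.prems \<open>0 \<le> e\<close>] by simp
  also have "\<dots> \<le> minmax ?K e (game_iter \<Omega> f e u0 n) x + 0"
  proof (rule minmax_mono[OF _ bd Suc.prems \<open>0 \<le> e\<close>])
    obtain M where "\<And>x. x \<in> ?K \<Longrightarrow> \<bar>u x\<bar> \<le> M" using bdu bounded_image_realE by metis
    then show "bounded ((\<lambda>y. u y + (real n * k - B)) ` ?K)"
      by (intro bounded_image_realI[where B="M + \<bar>real n * k - B\<bar>"]) force
  qed (use Suc.IH in force)
  finally show ?case
    unfolding game_iter_Suc_convex[OF assms(1) Suc.prems assms(2)]
    using sub[OF Suc.prems] by (simp add: algebra_simps)
qed (use B in simp)

lemma game_iter_upper:
  assumes "convex \<Omega>" "0 \<le> e" "bounded (f ` closure \<Omega>)" "bounded (u0 ` closure \<Omega>)"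
    and bdu: "bounded (u ` closure \<Omega>)"
    and super: "\<And>x. x \<in> closure \<Omega> \<Longrightarrow> minmax (closure \<Omega>) e u x + f x \<le> u x + k"
    and B: "\<And>x. x \<in> closure \<Omega> \<Longrightarrow> u0 x \<le> u x + B"
    and x: "x \<in> closure \<Omega>"
  shows "game_iter \<Omega> f e u0 n x \<le> u x + real n * k + B"
proof -
  have "- u x + real n * (- k) \<le> game_iter \<Omega> (\<lambda>x. - f x) e (\<lambda>x. - u0 x) n x + B"
  proof (rule game_iter_lower)
    show "bounded ((\<lambda>x. - f x) ` closure \<Omega>)" "bounded ((\<lambda>x. - u0 x) ` closure \<Omega>)" "bounded ((\<lambda>x. - u x) ` closure \<Omega>)"
      using assms by (simp_all add: bounded_iff)
    show "- u x + - k \<le> minmax (closure \<Omega>) e (\<lambda>x. - u x) x + - f x" if "x \<in> closure \<Omega>" for x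
      using super[OF that] by (simp add: minmax_uminus)
    show "- u x \<le> - u0 x + B" if "x \<in> closure \<Omega>" for x using B[OF that] by simp
  qed (use assms in auto)
  then show ?thesis using game_iter_uminus[OF assms(1,2) x] by simp
qed

text \<open>The rate in the hypothesis depends on \<tau>, but the constant \<open>N\<close> does
  not. Two averages \<open>g n / n\<close> are therefore at distance at most the sum of their terms
  \<open>N / n\<close>, since \<tau> disappears in the limit at fixed indices. The averages form a
  Cauchy sequence, and letting one index tend to infinity preserves the bound.\<close>

lemma linear_growth_rate_exists:
  fixes g :: "nat \<Rightarrow> real"
  assumes g: "\<And>\<tau>. 0 < \<tau> \<Longrightarrow> \<exists>c. \<forall>n. \<bar>g n - real n * c\<bar> \<le> N + real n * \<tau>"
  obtains c where "\<And>n. \<bar>g n - real n * c\<bar> \<le> N"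
proof -
  define a where "a n = g (Suc n) / real (Suc n)" for n
  have N0: "0 \<le> N" using g[of 1] by (smt (verit) of_nat_0 mult_zero_left zero_less_one)
  have a: "\<bar>a n - a m\<bar> \<le> N / real (Suc n) + N / real (Suc m)" for n m
  proof (rule field_le_epsilon)
    fix e :: real assume "0 < e"
    obtain c where c: "\<And>n. \<bar>g n - real n * c\<bar> \<le> N + real n * (e / 2)"
      using g[of "e / 2"] \<open>0 < e\<close> by auto
    have "\<bar>a n - c\<bar> \<le> N / real (Suc n) + e / 2" for n
    proof -
      have "a n - c = (g (Suc n) - real (Suc n) * c) / real (Suc n)"
        by (simp add: a_def field_simps)
      then have "\<bar>a n - c\<bar> = \<bar>g (Suc n) - real (Suc n) * c\<bar> / real (Suc n)" by simp
      also have "\<dots> \<le> (N + real (Suc n) * (e / 2)) / real (Suc n)"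
        by (intro divide_right_mono c) simp
      also have "\<dots> = N / real (Suc n) + e / 2" by (simp add: field_simps)
      finally show ?thesis .
    qed
    from this[of n] this[of m] show "\<bar>a n - a m\<bar> \<le> N / real (Suc n) + N / real (Suc m) + e"
      by linarith
  qed
  have lim0: "(\<lambda>m. N / real (Suc m)) \<longlonglongrightarrow> 0"
    by (rule LIMSEQ_Suc[OF lim_const_over_n])
  have "Cauchy a"
  proof (rule metric_CauchyI)
    fix e :: real assume "0 < e"
    then have "\<forall>\<^sub>F m in sequentially. N / real (Suc m) < e / 2"
      using order_tendstoD(2)[OF lim0, of "e / 2"] by simp
    then obtain M where M: "\<And>m. m \<ge> M \<Longrightarrow> N / real (Suc m) < e / 2"
      by (auto simp: eventually_sequentially)
    show "\<exists>M. \<forall>m\<ge>M. \<forall>n\<ge>M. dist (a m) (a n) < e"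
    proof (intro exI allI impI)
      fix m n assume "m \<ge> M" "n \<ge> M"
      then show "dist (a m) (a n) < e" using a[of m n] M[of m] M[of n] unfolding dist_real_def by linarith
    qed
  qed
  then obtain c where c: "a \<longlonglongrightarrow> c" using convergent_eq_Cauchy by blast
  have ac: "\<bar>a n - c\<bar> \<le> N / real (Suc n)" for n
  proof (rule LIMSEQ_le)
    show "(\<lambda>m. \<bar>a n - a m\<bar>) \<longlonglongrightarrow> \<bar>a n - c\<bar>" by (intro tendsto_intros c)
    show "(\<lambda>m. N / real (Suc n) + N / real (Suc m)) \<longlonglongrightarrow> N / real (Suc n)"
      using tendsto_add[OF tendsto_const lim0] by simp
  qed (use a in blast)
  show ?thesis
  proof (rule that[of c])
    fix n show "\<bar>g n - real n * c\<bar> \<le> N"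
    \<comment> \<open>The averages say nothing about index 0; there the hypothesis gives the bound
      directly, whatever the rate.\<close>
    proof (cases n)
      case 0
      obtain c' where "\<forall>n. \<bar>g n - real n * c'\<bar> \<le> N + real n * 1" using g[of 1] by auto
      from spec[OF this, of 0] show ?thesis using 0 by simp
    next
      case (Suc m)
      have "g n - real n * c = real n * (a m - c)" by (simp add: Suc a_def field_simps)
      then have "\<bar>g n - real n * c\<bar> = real n * \<bar>a m - c\<bar>" by (simp add: abs_mult)
      also have "\<dots> \<le> real n * (N / real (Suc m))" by (intro mult_left_mono ac) simp
      also have "\<dots> = N" by (simp add: Suc)
      finally show ?thesis .
    qed
  qed
qed

section \<open>Existence and elementary properties of the growth constant\<close>

lemma compact_closure_domain: "bounded_domain \<Omega> \<Longrightarrow> compact (closure \<Omega>)"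
  by (simp add: bounded_domain_def compact_closure)

lemma bounded_image_domain:
  fixes f :: "real ^ 'n \<Rightarrow> real"
  assumes "bounded_domain \<Omega>" "continuous_on (closure \<Omega>) f"
  shows "bounded (f ` closure \<Omega>)"
  using assms compact_closure_domain compact_continuous_image compact_imp_bounded by blast

text \<open>The iteration is trapped between translates of one rescaled approximate ergodic
  solution. What matters is the order of the quantifiers: \<open>N\<close> depends on
  \<open>e\<close> but not on \<tau>, and the rate \<open>k\<close> depends on \<tau> but not on
  \<open>u0\<close>.\<close>

lemma game_iter_growth:
  fixes f :: "real ^ 'n \<Rightarrow> real"
  assumes dom: "bounded_domain \<Omega>" and conv: "convex \<Omega>" and f: "continuous_on (closure \<Omega>) f"
    and e: "0 < e" "e \<le> 1"
  obtains N where "\<And>\<tau>. 0 < \<tau> \<Longrightarrow> \<exists>k. \<forall>u0 B n. \<forall>x\<in>closure \<Omega>. (\<forall>x\<in>closure \<Omega>. \<bar>u0 x\<bar> \<le> B) \<longrightarrow>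
    \<bar>game_iter \<Omega> f e u0 n x - real n * k\<bar> \<le> N + B + real n * \<tau>"
proof -
  let ?K = "closure \<Omega>"
  obtain x0 where x0: "x0 \<in> ?K" using dom closure_subset by (auto simp: bounded_domain_def)
  have bdf: "bounded (f ` ?K)" using dom f by (rule bounded_image_domain)
  obtain C where C: "\<And>x. x \<in> ?K \<Longrightarrow> \<bar>f x\<bar> \<le> C"
    using bdf bounded_image_realE by metis
  have "bounded ?K" using compact_closure_domain[OF dom] compact_imp_bounded by blast
  then obtain D where D: "\<And>x y. x \<in> ?K \<Longrightarrow> y \<in> ?K \<Longrightarrow> dist x y \<le> D"
    using bounded_two_points by metis
  define N where "N = (2 * C + 3) * (D + 1) * D + (2 * C + 3) * (D + 3)"
  show ?thesis
  \<comment> \<open>One copy of the bound on \<open>u\<close> compares \<open>u\<close> with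
    \<open>u0\<close>, the other removes \<open>u x\<close> from the estimate.\<close>
  proof (rule that[of "2 * (2 / e\<^sup>2 * N)"])
    fix \<tau> :: real assume "0 < \<tau>"
    then have pos: "0 < e\<^sup>2 / 2 * \<tau>" using e by simp
    obtain v k where v': "\<forall>x\<in>?K. \<bar>v x\<bar> \<le> (2 * C + 3) * (D + 1) * D + (2 * C + 3) * (D + 3)"
      and vk: "\<forall>x\<in>?K. \<bar>v x - (minmax ?K e v x + e\<^sup>2 / 2 * (f x - k))\<bar> \<le> e\<^sup>2 / 2 * \<tau>"
      using approximate_ergodic_solution[of ?K D x0 f C e "e\<^sup>2 / 2 * \<tau>", OF convex_closure[OF conv] D x0 C e pos]
      by blast
    have v: "\<And>x. x \<in> ?K \<Longrightarrow> \<bar>v x\<bar> \<le> N" using v' by (simp only: N_def)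
    define u where "u x = 2 / e\<^sup>2 * v x" for x
    have bdv: "bounded (v ` ?K)" using v by (rule bounded_image_realI)
    have u: "\<bar>u x\<bar> \<le> 2 / e\<^sup>2 * N" if "x \<in> ?K" for x
      using mult_left_mono[OF v[OF that], of "2 / e\<^sup>2"] by (simp add: u_def abs_mult)
    then have bdu: "bounded (u ` ?K)" by (rule bounded_image_realI)
    have uk: "\<bar>u x - (minmax ?K e u x + (f x - k))\<bar> \<le> \<tau>" if x: "x \<in> ?K" for x
    proof -
      have "minmax ?K e u x = 2 / e\<^sup>2 * minmax ?K e v x"
        unfolding u_def using x e bdv by (intro minmax_mult) auto
      then have "u x - (minmax ?K e u x + (f x - k))
          = 2 / e\<^sup>2 * (v x - (minmax ?K e v x + e\<^sup>2 / 2 * (f x - k)))"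
        using e by (simp add: u_def field_simps)
      then have "\<bar>u x - (minmax ?K e u x + (f x - k))\<bar>
          = 2 / e\<^sup>2 * \<bar>v x - (minmax ?K e v x + e\<^sup>2 / 2 * (f x - k))\<bar>"
        by (simp only: abs_mult) simp
      also have "\<dots> \<le> 2 / e\<^sup>2 * (e\<^sup>2 / 2 * \<tau>)" by (intro mult_left_mono bspec[OF vk x]) simp
      also have "\<dots> = \<tau>" using e by simp
      finally show ?thesis .
    qed
    show "\<exists>k. \<forall>u0 B n. \<forall>x\<in>?K. (\<forall>x\<in>?K. \<bar>u0 x\<bar> \<le> B) \<longrightarrow>
      \<bar>game_iter \<Omega> f e u0 n x - real n * k\<bar> \<le> 2 * (2 / e\<^sup>2 * N) + B + real n * \<tau>"
    proof (intro exI allI ballI impI)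
      fix u0 :: "real ^ 'n \<Rightarrow> real" and B n x assume u0: "\<forall>x\<in>?K. \<bar>u0 x\<bar> \<le> B" and x: "x \<in> ?K"
      have bd0: "bounded (u0 ` ?K)" using u0 by (intro bounded_image_realI) auto
      have "u x + real n * (k - \<tau>) \<le> game_iter \<Omega> f e u0 n x + (2 / e\<^sup>2 * N + B)"
      proof (rule game_iter_lower[OF conv _ bdf bd0 bdu _ _ x])
        show "u x + (k - \<tau>) \<le> minmax ?K e u x + f x" if "x \<in> ?K" for x using uk[OF that] by linarith
        show "u x \<le> u0 x + (2 / e\<^sup>2 * N + B)" if "x \<in> ?K" for x using u[OF that] u0 that by force
      qed (use e in simp)
      moreover have "game_iter \<Omega> f e u0 n x \<le> u x + real n * (k + \<tau>) + (2 / e\<^sup>2 * N + B)"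
      proof (rule game_iter_upper[OF conv _ bdf bd0 bdu _ _ x])
        show "minmax ?K e u x + f x \<le> u x + (k + \<tau>)" if "x \<in> ?K" for x using uk[OF that] by linarith
        show "u0 x \<le> u x + (2 / e\<^sup>2 * N + B)" if "x \<in> ?K" for x using u[OF that] u0 that by force
      qed (use e in simp)
      ultimately show "\<bar>game_iter \<Omega> f e u0 n x - real n * k\<bar> \<le> 2 * (2 / e\<^sup>2 * N) + B + real n * \<tau>"
        using u[OF x] unfolding distrib_left right_diff_distrib by linarith
    qed
  qed
qed

lemma growth_const_unique_rate:
  fixes g :: "nat \<Rightarrow> real"
  assumes "\<And>n. \<bar>g n - real n * c\<bar> \<le> M" "\<And>n. \<bar>g n - real n * c'\<bar> \<le> M'"
  shows "c = c'"
proof -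
  have "real n * \<bar>c - c'\<bar> \<le> M + M'" for n
  proof -
    have "real n * \<bar>c - c'\<bar> = \<bar>real n * c - real n * c'\<bar>"
      by (simp add: abs_mult flip: right_diff_distrib)
    then show ?thesis using assms(1)[of n] assms(2)[of n] by linarith
  qed
  moreover have "0 \<le> M + M'" using assms(1)[of 0] assms(2)[of 0] by linarith
  ultimately have "\<bar>c - c'\<bar> = 0" by (intro real_archimedian_rdiv_eq_0[where c="M + M'"]) auto
  then show ?thesis by simp
qed

text \<open>Uniqueness for the definite description: the iteration from 0, followed at a single
  point, admits only one rate.\<close>

lemma growth_const_eqI:
  fixes f :: "real ^ 'n \<Rightarrow> real"
  assumes "\<Omega> \<noteq> {}"
    and c: "\<And>u0. continuous_on (closure \<Omega>) u0 \<Longrightarrow>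
      \<exists>M. \<forall>n. \<forall>x\<in>closure \<Omega>. \<bar>game_iter \<Omega> f e u0 n x - real n * c\<bar> \<le> M"
  shows "growth_const \<Omega> f e = c"
  unfolding growth_const_def
proof (rule the_equality)
  fix c' assume "\<forall>u0. continuous_on (closure \<Omega>) u0 \<longrightarrow>
    (\<exists>M. \<forall>n. \<forall>x\<in>closure \<Omega>. \<bar>game_iter \<Omega> f e u0 n x - real n * c'\<bar> \<le> M)"
  then obtain M' where M': "\<forall>n. \<forall>x\<in>closure \<Omega>. \<bar>game_iter \<Omega> f e (\<lambda>x. 0) n x - real n * c'\<bar> \<le> M'"
    using continuous_on_const by blast
  obtain M where M: "\<forall>n. \<forall>x\<in>closure \<Omega>. \<bar>game_iter \<Omega> f e (\<lambda>x. 0) n x - real n * c\<bar> \<le> M"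
    using c continuous_on_const by blast
  obtain x0 where "x0 \<in> closure \<Omega>" using \<open>\<Omega> \<noteq> {}\<close> closure_subset by auto
  then show "c' = c"
    using M M' by (intro growth_const_unique_rate[of "\<lambda>n. game_iter \<Omega> f e (\<lambda>x. 0) n x0" c' M' c M]) auto
qed (use c in blast)

text \<open>Existence for the definite description. The rate is read off from the iteration from 0
  at one point and transferred to other initial functions and points through the common approximate
  rate \<open>k\<close>. Of the constant \<open>3 * N\<close>, one \<open>N\<close> comes from the
  iterate in question and two from the reference sequence \<open>g\<close>.\<close>

lemma growth_const_bound:
  fixes f :: "real ^ 'n \<Rightarrow> real"
  assumes dom: "bounded_domain \<Omega>" and conv: "convex \<Omega>" and f: "continuous_on (closure \<Omega>) f"
    and e: "0 < e" "e \<le> 1" and u0: "continuous_on (closure \<Omega>) u0"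
  shows "\<exists>M. \<forall>n. \<forall>x\<in>closure \<Omega>. \<bar>game_iter \<Omega> f e u0 n x - real n * growth_const \<Omega> f e\<bar> \<le> M"
proof -
  let ?K = "closure \<Omega>"
  obtain N where N: "\<And>\<tau>. 0 < \<tau> \<Longrightarrow> \<exists>k. \<forall>u0 B n. \<forall>x\<in>?K. (\<forall>x\<in>?K. \<bar>u0 x\<bar> \<le> B) \<longrightarrow>
    \<bar>game_iter \<Omega> f e u0 n x - real n * k\<bar> \<le> N + B + real n * \<tau>"
    using game_iter_growth[OF dom conv f e] by blast
  have ne: "\<Omega> \<noteq> {}" using dom by (simp add: bounded_domain_def)
  then obtain x0 where x0: "x0 \<in> ?K" using closure_subset by auto
  define g where "g n = game_iter \<Omega> f e (\<lambda>x. 0) n x0" for n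
  have "\<exists>c. \<forall>n. \<bar>g n - real n * c\<bar> \<le> N + real n * \<tau>" if \<tau>: "0 < \<tau>" for \<tau>
  proof -
    obtain k where "\<forall>u0 B n. \<forall>x\<in>?K. (\<forall>x\<in>?K. \<bar>u0 x\<bar> \<le> B) \<longrightarrow>
      \<bar>game_iter \<Omega> f e u0 n x - real n * k\<bar> \<le> N + B + real n * \<tau>" using N[OF \<tau>] by blast
    from this[rule_format, of x0 "\<lambda>x. 0" 0] show ?thesis using x0 by (auto simp: g_def)
  qed
  then obtain c where c: "\<And>n. \<bar>g n - real n * c\<bar> \<le> N" using linear_growth_rate_exists by metis
  have main: "\<exists>M. \<forall>n. \<forall>x\<in>?K. \<bar>game_iter \<Omega> f e u0 n x - real n * c\<bar> \<le> M"
    if u0: "continuous_on ?K u0" for u0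
  proof -
    obtain B where B: "\<And>x. x \<in> ?K \<Longrightarrow> \<bar>u0 x\<bar> \<le> B"
      using bounded_image_domain[OF dom u0] bounded_image_realE by metis
    have "\<bar>game_iter \<Omega> f e u0 n x - real n * c\<bar> \<le> 3 * N + B" if x: "x \<in> ?K" for n x
    proof (rule field_le_epsilon)
      fix d :: real assume "0 < d"
      \<comment> \<open>Here \<open>n\<close> is fixed already, so \<tau> may depend on it; twice
        \<open>real n * \<tau>\<close> is at most \<open>d\<close>.\<close>
      define \<tau> where "\<tau> = d / (2 * (real n + 1))"
      have "0 < \<tau>" using \<open>0 < d\<close> by (simp add: \<tau>_def)
      have "real n * \<tau> \<le> d / 2" using \<open>0 < d\<close> by (simp add: \<tau>_def field_simps)
      obtain k where k: "\<forall>u0 B n. \<forall>x\<in>?K. (\<forall>x\<in>?K. \<bar>u0 x\<bar> \<le> B) \<longrightarrow>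
        \<bar>game_iter \<Omega> f e u0 n x - real n * k\<bar> \<le> N + B + real n * \<tau>" using N[OF \<open>0 < \<tau>\<close>] by blast
      have "\<bar>g n - real n * k\<bar> \<le> N + real n * \<tau>"
        using k[rule_format, OF x0, of "\<lambda>x. 0" 0 n] by (simp add: g_def)
      moreover have "\<bar>game_iter \<Omega> f e u0 n x - real n * k\<bar> \<le> N + B + real n * \<tau>"
        using k x B by blast
      ultimately show "\<bar>game_iter \<Omega> f e u0 n x - real n * c\<bar> \<le> 3 * N + B + d"
        using c[of n] \<open>real n * \<tau> \<le> d / 2\<close> by linarith
    qed
    then show ?thesis by blast
  qed
  then have "growth_const \<Omega> f e = c" using growth_const_eqI[OF ne] by blast
  then show ?thesis using main[OF u0] by simp
qed

lemma growth_const_uminus: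
  fixes f :: "real ^ 'n \<Rightarrow> real"
  assumes dom: "bounded_domain \<Omega>" and conv: "convex \<Omega>" and f: "continuous_on (closure \<Omega>) f"
    and e: "0 < e" "e \<le> 1"
  shows "growth_const \<Omega> (\<lambda>x. - f x) e = - growth_const \<Omega> f e"
proof (rule growth_const_eqI)
  show "\<Omega> \<noteq> {}" using dom by (simp add: bounded_domain_def)
  fix u0 :: "real ^ 'n \<Rightarrow> real" assume "continuous_on (closure \<Omega>) u0"
  then have "continuous_on (closure \<Omega>) (\<lambda>x. - u0 x)" by (intro continuous_intros)
  then obtain M where M: "\<forall>n. \<forall>x\<in>closure \<Omega>.
      \<bar>game_iter \<Omega> f e (\<lambda>x. - u0 x) n x - real n * growth_const \<Omega> f e\<bar> \<le> M"
    using growth_const_bound[OF dom conv f e] by blast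
  have "\<bar>game_iter \<Omega> (\<lambda>x. - f x) e u0 n x - real n * - growth_const \<Omega> f e\<bar> \<le> M"
    if x: "x \<in> closure \<Omega>" for n x
  proof -
    have "game_iter \<Omega> (\<lambda>x. - f x) e u0 n x = - game_iter \<Omega> f e (\<lambda>x. - u0 x) n x"
      using game_iter_uminus[OF conv _ x, of e f "\<lambda>x. - u0 x" n] e by simp
    then show ?thesis using M x by (simp add: abs_le_iff)
  qed
  then show "\<exists>M. \<forall>n. \<forall>x\<in>closure \<Omega>.
      \<bar>game_iter \<Omega> (\<lambda>x. - f x) e u0 n x - real n * - growth_const \<Omega> f e\<bar> \<le> M" by blast
qed

lemma growth_const_diff:
  fixes f :: "real ^ 'n \<Rightarrow> real"
  assumes dom: "bounded_domain \<Omega>" and conv: "convex \<Omega>" and f: "continuous_on (closure \<Omega>) f"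
    and e: "0 < e" "e \<le> 1"
  shows "growth_const \<Omega> (\<lambda>x. f x - c) e = growth_const \<Omega> f e - c"
proof (rule growth_const_eqI)
  show "\<Omega> \<noteq> {}" using dom by (simp add: bounded_domain_def)
  fix u0 :: "real ^ 'n \<Rightarrow> real" assume u0: "continuous_on (closure \<Omega>) u0"
  have bd: "bounded (game_iter \<Omega> f e u0 n ` closure \<Omega>)" for n
    using e by (intro bounded_game_iter conv bounded_image_domain[OF dom f] bounded_image_domain[OF dom u0]) simp
  have e0: "0 \<le> e" using e by simp
  have shift: "game_iter \<Omega> (\<lambda>x. f x - c) e u0 n x = game_iter \<Omega> f e u0 n x - real n * c"
    if "x \<in> closure \<Omega>" for n x
    using that
  proof (induction n arbitrary: x)
    case (Suc n)
    have "minmax (closure \<Omega>) e (game_iter \<Omega> (\<lambda>x. f x - c) e u0 n) x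
        = minmax (closure \<Omega>) e (\<lambda>y. game_iter \<Omega> f e u0 n y + (- (real n * c))) x"
      by (rule minmax_cong) (use Suc.IH in simp)
    also have "\<dots> = minmax (closure \<Omega>) e (game_iter \<Omega> f e u0 n) x + (- (real n * c))"
      by (rule minmax_add_const) (use bd Suc.prems e in auto)
    finally show ?case
      unfolding game_iter_Suc_convex[OF conv Suc.prems e0] by (simp add: algebra_simps)
  qed simp
  obtain M where M: "\<forall>n. \<forall>x\<in>closure \<Omega>. \<bar>game_iter \<Omega> f e u0 n x - real n * growth_const \<Omega> f e\<bar> \<le> M"
    using growth_const_bound[OF dom conv f e u0] by blast
  then show "\<exists>M. \<forall>n. \<forall>x\<in>closure \<Omega>.
      \<bar>game_iter \<Omega> (\<lambda>x. f x - c) e u0 n x - real n * (growth_const \<Omega> f e - c)\<bar> \<le> M"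
    by (intro exI[of _ M]) (simp add: shift algebra_simps)
qed

text \<open>A bounded \<open>u\<close> that gains \<open>k\<close> per step forces the iteration
  from 0 to grow at least like \<open>real n * k\<close> up to a constant, which is incompatible
  with a smaller linear rate.\<close>

lemma growth_const_ge:
  fixes f :: "real ^ 'n \<Rightarrow> real"
  assumes dom: "bounded_domain \<Omega>" and conv: "convex \<Omega>" and f: "continuous_on (closure \<Omega>) f"
    and e: "0 < e" "e \<le> 1" and bdu: "bounded (u ` closure \<Omega>)"
    and sub: "\<And>x. x \<in> closure \<Omega> \<Longrightarrow> u x + k \<le> minmax (closure \<Omega>) e u x + f x"
  shows "k \<le> growth_const \<Omega> f e"
proof (rule ccontr)
  let ?K = "closure \<Omega>" and ?c = "growth_const \<Omega> f e"
  assume "\<not> k \<le> ?c"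
  obtain x0 where x0: "x0 \<in> ?K" using dom closure_subset by (auto simp: bounded_domain_def)
  obtain B where B: "\<And>x. x \<in> ?K \<Longrightarrow> \<bar>u x\<bar> \<le> B" using bdu bounded_image_realE by metis
  obtain M where M: "\<And>n x. x \<in> ?K \<Longrightarrow> \<bar>game_iter \<Omega> f e (\<lambda>x. 0) n x - real n * ?c\<bar> \<le> M"
    using growth_const_bound[OF dom conv f e continuous_on_const] by blast
  have "real n * (k - ?c) \<le> 2 * B + M" for n
  proof -
    have "u x0 + real n * k \<le> game_iter \<Omega> f e (\<lambda>x. 0) n x0 + B"
    proof (rule game_iter_lower[OF conv _ bounded_image_domain[OF dom f] _ bdu sub _ x0])
      show "bounded ((\<lambda>x. 0::real) ` ?K)" by (rule bounded_image_realI[where B=0]) simp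
      show "u x \<le> 0 + B" if "x \<in> ?K" for x using B[OF that] by simp
    qed (use e in auto)
    then show ?thesis using M[OF x0, of n] B[OF x0] unfolding right_diff_distrib by linarith
  qed
  moreover obtain n where "real n * (k - ?c) > 2 * B + M"
    using reals_Archimedean3[of "k - ?c"] \<open>\<not> k \<le> ?c\<close> by auto
  ultimately show False using not_less by blast
qed

section \<open>Smooth test functions\<close>

lemma partial_deriv_eq:
  assumes "(\<phi> has_derivative \<phi>') (at x)"
  shows "partial_deriv i \<phi> x = \<phi>' (axis i 1)"
  using frechet_derivative_at[OF assms] by (simp add: partial_deriv_def)

lemma grad_eq:
  assumes "(\<phi> has_derivative (\<lambda>h. g \<bullet> h)) (at x)"
  shows "grad \<phi> x = g"
  by (simp add: grad_def partial_deriv_eq[OF assms] inner_axis vec_eq_iff)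

lemma has_derivative_grad:
  assumes "\<phi> differentiable (at x)"
  shows "(\<phi> has_derivative (\<lambda>h. grad \<phi> x \<bullet> h)) (at x)"
proof -
  let ?D = "frechet_derivative \<phi> (at x)"
  have D: "(\<phi> has_derivative ?D) (at x)" using assms by (simp add: frechet_derivative_works)
  then have lin: "linear ?D" by (rule has_derivative_linear)
  have "?D h = grad \<phi> x \<bullet> h" for h
  proof -
    have "?D h = ?D (\<Sum>i\<in>UNIV. h $ i *\<^sub>R axis i 1)"
      by (simp add: basis_expansion flip: scalar_mult_eq_scaleR)
    also have "\<dots> = (\<Sum>i\<in>UNIV. h $ i * ?D (axis i 1))"
      by (simp add: linear_sum[OF lin] linear_cmul[OF lin])
    also have "\<dots> = grad \<phi> x \<bullet> h"
      by (simp add: grad_def partial_deriv_def inner_vec_def mult.commute)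
    finally show ?thesis .
  qed
  then have "?D = (\<lambda>h. grad \<phi> x \<bullet> h)" by blast
  then show ?thesis using D by simp
qed

lemma frechet_derivative_eq_grad:
  "\<phi> differentiable (at x) \<Longrightarrow> frechet_derivative \<phi> (at x) h = grad \<phi> x \<bullet> h"
  using frechet_derivative_at[OF has_derivative_grad] by metis

text \<open>The test functions built below are polynomials, a class closed under partial
  derivatives; \<open>Ck_on\<close> for every order then follows by induction.\<close>

lemma real_polynomial_function_partial_deriv:
  fixes p :: "real ^ 'n \<Rightarrow> real"
  assumes "real_polynomial_function p"
  shows "p differentiable (at x)" "real_polynomial_function (partial_deriv i p)"
proof -
  have "(\<forall>x. p differentiable (at x)) \<and> real_polynomial_function (partial_deriv i p)"
    using assms
  proof (induction p rule: real_polynomial_function.induct)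
    case (linear f)
    then have f: "(f has_derivative f) (at x)" for x by (rule bounded_linear_imp_has_derivative)
    then have "partial_deriv i f = (\<lambda>x. f (axis i 1))" using partial_deriv_eq by blast
    then show ?case using f by (auto simp: differentiable_def)
  next
    case (const c)
    have "((\<lambda>x. c) has_derivative (\<lambda>h. 0)) (at x)" for x :: "real ^ 'n" by simp
    then have "partial_deriv i (\<lambda>x. c) = (\<lambda>x. 0)" using partial_deriv_eq by blast
    then show ?case by auto
  next
    case (add f g)
    then have D: "((\<lambda>x. f x + g x) has_derivative (\<lambda>h. grad f x \<bullet> h + grad g x \<bullet> h)) (at x)" for x
      by (intro has_derivative_add has_derivative_grad) auto
    have "partial_deriv i (\<lambda>x. f x + g x) = (\<lambda>x. partial_deriv i f x + partial_deriv i g x)"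
      by (intro ext) (simp add: partial_deriv_eq[OF D], simp add: grad_def inner_axis)
    then show ?case using add by auto
  next
    case (mult f g)
    then have D: "((\<lambda>x. f x * g x) has_derivative (\<lambda>h. f x * (grad g x \<bullet> h) + (grad f x \<bullet> h) * g x)) (at x)" for x
      by (intro has_derivative_mult has_derivative_grad) auto
    have "partial_deriv i (\<lambda>x. f x * g x) = (\<lambda>x. f x * partial_deriv i g x + partial_deriv i f x * g x)"
      by (intro ext) (simp add: partial_deriv_eq[OF D], simp add: grad_def inner_axis)
    then show ?case using mult by auto
  qed
  then show "p differentiable (at x)" "real_polynomial_function (partial_deriv i p)" by auto
qed

lemma Ck_on_real_polynomial_function:
  fixes p :: "real ^ 'n \<Rightarrow> real"
  assumes "real_polynomial_function p"
  shows "Ck_on k p U"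
  using assms
proof (induction k arbitrary: p)
  case 0
  then show ?case
    by (simp add: continuous_on_polymonial_function real_polynomial_function_eq)
next
  case (Suc k)
  then show ?case by (simp add: real_polynomial_function_partial_deriv)
qed

lemma smooth_on_closure_real_polynomial_function:
  "real_polynomial_function p \<Longrightarrow> smooth_on_closure \<Omega> p"
  unfolding smooth_on_closure_def
  by (intro exI[of _ UNIV]) (simp add: Ck_on_real_polynomial_function)

text \<open>A polynomial in \<open>(norm (y - x))\<^sup>2\<close> centred at its value at \<open>y0\<close>. The last summand makes a touching at
  \<open>y0\<close> strict and does not affect the derivatives at \<open>y0\<close> up to order two.\<close>

definition radial_test ::
  "real \<Rightarrow> real \<Rightarrow> real \<Rightarrow> real ^ 'n \<Rightarrow> real ^ 'n \<Rightarrow> real ^ 'n \<Rightarrow> real" where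
  "radial_test a1 a2 a3 x y0 y =
     a1 * ((y - x) \<bullet> (y - x) - (y0 - x) \<bullet> (y0 - x))
     + a2 * ((y - x) \<bullet> (y - x) - (y0 - x) \<bullet> (y0 - x))\<^sup>2
     + a3 * ((y - x) \<bullet> (y - x) - (y0 - x) \<bullet> (y0 - x)) ^ 3
     + ((y - y0) \<bullet> (y - y0))\<^sup>2"

lemma real_polynomial_function_radial_test:
  fixes x y0 :: "real ^ 'n"
  shows "real_polynomial_function (radial_test a1 a2 a3 x y0)"
proof -
  have "real_polynomial_function (\<lambda>y. y $ i)" for i :: 'n
    using bounded_linear_vec_nth by (rule real_polynomial_function.intros)
  then have "real_polynomial_function (\<lambda>y. (y - z) \<bullet> (y - z))" for z :: "real ^ 'n"
    by (simp add: inner_vec_def real_polynomial_function_sum real_polynomial_function_diff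
        real_polynomial_function.intros)
  then show ?thesis unfolding radial_test_def
    by (intro real_polynomial_function.intros(2-4) real_polynomial_function_power real_polynomial_function_diff)
qed

lemma grad_radial_test:
  "grad (radial_test a1 a2 a3 x y0) y =
     (2 * (a1 + 2 * a2 * ((y - x) \<bullet> (y - x) - (y0 - x) \<bullet> (y0 - x))
       + 3 * a3 * ((y - x) \<bullet> (y - x) - (y0 - x) \<bullet> (y0 - x))\<^sup>2)) *\<^sub>R (y - x)
     + (4 * ((y - y0) \<bullet> (y - y0))) *\<^sub>R (y - y0)"
  unfolding radial_test_def
  apply (rule grad_eq)
  apply (rule derivative_eq_intros refl | simp)+
  apply (rule ext)
  apply (simp add: inner_add_left inner_commute algebra_simps power2_eq_square)
  done

lemma hessian_radial_test:
  "hessian (radial_test a1 a2 a3 x y0) y0 $ i $ j =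
     8 * a2 * (y0 - x) $ i * (y0 - x) $ j + (if i = j then 2 * a1 else 0)"
proof -
  let ?s = "\<lambda>y. (y - x) \<bullet> (y - x) - (y0 - x) \<bullet> (y0 - x)"
  have eq: "partial_deriv i (radial_test a1 a2 a3 x y0) =
    (\<lambda>y. (2 * (a1 + 2 * a2 * ?s y + 3 * a3 * (?s y)\<^sup>2)) * (y $ i - x $ i)
     + (4 * ((y - y0) \<bullet> (y - y0))) * (y $ i - y0 $ i))"
  proof
    fix y
    have "partial_deriv i (radial_test a1 a2 a3 x y0) y = grad (radial_test a1 a2 a3 x y0) y $ i"
      by (simp add: grad_def)
    then show "partial_deriv i (radial_test a1 a2 a3 x y0) y =
     (2 * (a1 + 2 * a2 * ?s y + 3 * a3 * (?s y)\<^sup>2)) * (y $ i - x $ i)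
     + (4 * ((y - y0) \<bullet> (y - y0))) * (y $ i - y0 $ i)" by (simp add: grad_radial_test)
  qed
  have "((\<lambda>y. (2 * (a1 + 2 * a2 * ?s y + 3 * a3 * (?s y)\<^sup>2)) * (y $ i - x $ i)
     + (4 * ((y - y0) \<bullet> (y - y0))) * (y $ i - y0 $ i)) has_derivative
     (\<lambda>h. 8 * a2 * ((y0 - x) \<bullet> h) * (y0 $ i - x $ i) + 2 * a1 * h $ i)) (at y0)"
    apply (rule derivative_eq_intros bounded_linear.has_derivative[OF bounded_linear_vec_nth] refl | simp)+
    apply (rule ext)
    apply (simp add: inner_commute algebra_simps)
    done
  then have "partial_deriv j (partial_deriv i (radial_test a1 a2 a3 x y0)) y0 =
      8 * a2 * ((y0 - x) \<bullet> axis j 1) * (y0 $ i - x $ i) + 2 * a1 * axis j 1 $ i"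
    unfolding eq by (rule partial_deriv_eq)
  then have "hessian (radial_test a1 a2 a3 x y0) y0 $ i $ j =
      8 * a2 * (y0 - x) $ j * (y0 $ i - x $ i) + 2 * a1 * axis j 1 $ i"
    by (simp add: hessian_def inner_axis)
  then show ?thesis by (simp add: axis_def)
qed

lemma quadratic_form_radial_test:
  "(\<Sum>i\<in>UNIV. \<Sum>j\<in>UNIV. hessian (radial_test a1 a2 a3 x y0) y0 $ i $ j * v $ i * v $ j)
     = 8 * a2 * ((y0 - x) \<bullet> v)\<^sup>2 + 2 * a1 * (v \<bullet> v)"
proof -
  have "(\<Sum>i\<in>UNIV. \<Sum>j\<in>UNIV. 8 * a2 * (y0 - x) $ i * (y0 - x) $ j * v $ i * v $ j)
      = 8 * a2 * ((y0 - x) \<bullet> v)\<^sup>2"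
    unfolding inner_vec_def power2_eq_square sum_product
    unfolding sum_distrib_left by (intro sum.cong refl) simp
  moreover have "(\<Sum>i\<in>UNIV. \<Sum>j\<in>UNIV. (if i = j then 2 * a1 else 0) * v $ i * v $ j) = 2 * a1 * (v \<bullet> v)"
  proof -
    have "(if i = j then 2 * a1 else 0) * v $ i * v $ j = (if i = j then 2 * a1 * v $ i * v $ j else 0)" for i j
      by simp
    then show ?thesis by (simp add: inner_vec_def sum_distrib_left mult_ac)
  qed
  ultimately show ?thesis
    unfolding hessian_radial_test by (simp add: distrib_right sum.distrib)
qed

text \<open>The gradient at \<open>y0\<close> is a nonzero multiple of \<open>y0 - x\<close>, so the
  infinity Laplacian is the second derivative in the radial direction. With
  \<open>s = r\<^sup>2 - r0\<^sup>2\<close> it is that of \<open>a1 * s + a2 * s\<^sup>2\<close> at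
  \<open>r = r0\<close>.\<close>

lemma infinity_laplacian_plus_radial_test:
  assumes "y0 \<noteq> x" "a1 \<noteq> 0"
  shows "infinity_laplacian_plus (radial_test a1 a2 a3 x y0) y0 = 8 * a2 * (norm (y0 - x))\<^sup>2 + 2 * a1"
proof -
  let ?d = "y0 - x"
  have g: "grad (radial_test a1 a2 a3 x y0) y0 = (2 * a1) *\<^sub>R ?d"
    by (simp add: grad_radial_test)
  have "(\<Sum>i\<in>UNIV. \<Sum>j\<in>UNIV. ((2 * a1) *\<^sub>R ?d) $ i * hessian (radial_test a1 a2 a3 x y0) y0 $ i $ j * ((2 * a1) *\<^sub>R ?d) $ j)
      = 8 * a2 * (?d \<bullet> ((2 * a1) *\<^sub>R ?d))\<^sup>2 + 2 * a1 * (((2 * a1) *\<^sub>R ?d) \<bullet> ((2 * a1) *\<^sub>R ?d))"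
    unfolding quadratic_form_radial_test[of a1 a2 a3 x y0 "(2 * a1) *\<^sub>R ?d", symmetric] by (intro sum.cong refl) (simp only: mult_ac)
  also have "\<dots> = (8 * a2 * (norm ?d)\<^sup>2 + 2 * a1) * (norm ((2 * a1) *\<^sub>R ?d))\<^sup>2"
    by (simp only: power2_norm_eq_inner inner_scaleR_left inner_scaleR_right) algebra
  finally show ?thesis using assms by (simp add: infinity_laplacian_plus_def g)
qed

lemma infinity_laplacian_plus_radial_test_centre:
  fixes x :: "real ^ 'n"
  shows "infinity_laplacian_plus (radial_test a1 0 0 x x) x = 2 * a1"
proof -
  have g: "grad (radial_test a1 0 0 x x) x = 0" by (simp add: grad_radial_test)
  have "(SUP v\<in>{v :: real ^ 'n. norm v = 1}. 2 * a1 * (v \<bullet> v)) = (SUP v\<in>{v :: real ^ 'n. norm v = 1}. 2 * a1)"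
    by (intro SUP_cong) (auto simp: norm_eq_1)
  moreover have "{v :: real ^ 'n. norm v = 1} \<noteq> {}" using vector_choose_size[of 1] by auto
  ultimately have "(SUP v\<in>{v :: real ^ 'n. norm v = 1}. 2 * a1 * (v \<bullet> v)) = 2 * a1"
    using cSUP_const by metis
  then show ?thesis unfolding infinity_laplacian_plus_def g quadratic_form_radial_test by simp
qed

text \<open>The bound is the third order Taylor polynomial of the square root at \<open>r0\<^sup>2\<close>, evaluated at \<open>r\<^sup>2\<close>.\<close>

lemma le_cubic_in_square:
  fixes r r0 :: real
  assumes "0 \<le> r" "0 < r0"
  shows "r \<le> r0 + (r\<^sup>2 - r0\<^sup>2) / (2 * r0) - (r\<^sup>2 - r0\<^sup>2)\<^sup>2 / (8 * r0 ^ 3) + (r\<^sup>2 - r0\<^sup>2) ^ 3 / (16 * r0 ^ 5)"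
proof -
  \<comment> \<open>Third order is the right one: the second order polynomial crosses the square
    root at \<open>r0\<^sup>2\<close>, while the tangent lies above it but has the wrong second
    derivative.\<close>
  have "r0 + (r\<^sup>2 - r0\<^sup>2) / (2 * r0) - (r\<^sup>2 - r0\<^sup>2)\<^sup>2 / (8 * r0 ^ 3) + (r\<^sup>2 - r0\<^sup>2) ^ 3 / (16 * r0 ^ 5) - r
      = (r - r0) ^ 4 * (r\<^sup>2 + 4 * r * r0 + 5 * r0\<^sup>2) / (16 * r0 ^ 5)"
    using assms(2) by (simp add: field_simps eval_nat_numeral)
  also have "\<dots> \<ge> 0" using assms by (intro divide_nonneg_nonneg mult_nonneg_nonneg) auto
  finally show ?thesis by simp
qed

section \<open>Cone comparison for viscosity subsolutions\<close>

lemma C1_defining_function_has_derivative: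
  assumes "C1_defining_function \<Omega> x U \<rho>"
  shows "(\<rho> has_derivative (\<lambda>h. grad \<rho> x \<bullet> h)) (at x)"
  using assms by (intro has_derivative_grad) (auto simp: C1_defining_function_def)

lemma C1_defining_function_directional:
  assumes "C1_defining_function \<Omega> x U \<rho>"
  shows "((\<lambda>t. \<rho> (x + t *\<^sub>R d)) has_real_derivative (grad \<rho> x \<bullet> d)) (at 0)"
proof -
  have "((\<lambda>t. x + t *\<^sub>R d) has_derivative (\<lambda>t. t *\<^sub>R d)) (at (0::real))"
    by (rule derivative_eq_intros refl | simp)+
  moreover have "(\<rho> has_derivative (\<lambda>h. grad \<rho> x \<bullet> h)) (at (x + 0 *\<^sub>R d))"
    using C1_defining_function_has_derivative[OF assms] by simp
  ultimately have "((\<lambda>t. \<rho> (x + t *\<^sub>R d)) has_derivative (\<lambda>t. grad \<rho> x \<bullet> (t *\<^sub>R d))) (at 0)"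
    by (rule has_derivative_compose)
  then show ?thesis by (simp add: has_field_derivative_def mult_commute_abs)
qed

lemma C1_defining_function_eq_0:
  assumes "open \<Omega>" "x \<in> frontier \<Omega>" and def: "C1_defining_function \<Omega> x U \<rho>"
  shows "\<rho> x = 0"
proof (rule antisym)
  have U: "open U" "x \<in> U" "\<Omega> \<inter> U = {y \<in> U. \<rho> y < 0}" using def by (auto simp: C1_defining_function_def)
  have "x \<notin> \<Omega>" using assms(1,2) by (simp add: frontier_def interior_open)
  then show "0 \<le> \<rho> x" using U by force
  show "\<rho> x \<le> 0"
  proof (rule ccontr)
    assume "\<not> \<rho> x \<le> 0"
    have "continuous (at x) \<rho>"
      using C1_defining_function_has_derivative[OF def] has_derivative_continuous by blast
    then have "\<forall>\<^sub>F y in nhds x. 0 < \<rho> y"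
      using \<open>\<not> \<rho> x \<le> 0\<close> by (simp add: continuous_at_imp_continuous_at_within isCont_def tendsto_at_iff_tendsto_nhds order_tendstoD(1))
    moreover have "\<forall>\<^sub>F y in nhds x. y \<in> U" using U eventually_nhds_in_open by blast
    ultimately have "\<forall>\<^sub>F y in nhds x. 0 < \<rho> y \<and> y \<in> U" by eventually_elim simp
    then obtain d where d: "d > 0" "\<And>y. dist y x < d \<Longrightarrow> 0 < \<rho> y \<and> y \<in> U"
      unfolding eventually_nhds_metric by blast
    have "x \<in> closure \<Omega>" using assms(2) by (simp add: frontier_def)
    then obtain y where "y \<in> \<Omega>" "dist y x < d"
      using \<open>d > 0\<close> unfolding closure_approachable by blast
    then have "0 < \<rho> y" "y \<in> \<Omega> \<inter> U" using d(2)[of y] by auto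
    then show False unfolding U(3) by simp
  qed
qed

lemma inward_direction_in_domain:
  assumes "open \<Omega>" "x \<in> frontier \<Omega>" and def: "C1_defining_function \<Omega> x U \<rho>" and "grad \<rho> x \<bullet> d < 0"
  obtains s where "0 < s" "\<And>t. 0 < t \<Longrightarrow> t < s \<Longrightarrow> x + t *\<^sub>R d \<in> \<Omega>"
proof -
  have U: "open U" "x \<in> U" "\<Omega> \<inter> U = {y \<in> U. \<rho> y < 0}" using def by (auto simp: C1_defining_function_def)
  obtain s1 where s1: "s1 > 0" "\<And>h. 0 < h \<Longrightarrow> h < s1 \<Longrightarrow> \<rho> (x + h *\<^sub>R d) < 0"
    using DERIV_neg_dec_right[OF C1_defining_function_directional[OF def, of d] assms(4)]
      C1_defining_function_eq_0[OF assms(1,2) def] by auto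
  have "((\<lambda>t. x + t *\<^sub>R d) \<longlongrightarrow> x + 0 *\<^sub>R d) (at 0)" by (intro tendsto_intros)
  then have "\<forall>\<^sub>F t in at 0. x + t *\<^sub>R d \<in> U" using U by (simp add: topological_tendstoD)
  then obtain s2 where s2: "s2 > 0" "\<And>t. t \<noteq> 0 \<Longrightarrow> dist t 0 < s2 \<Longrightarrow> x + t *\<^sub>R d \<in> U"
    unfolding eventually_at by auto
  show ?thesis
  proof (rule that[of "min s1 s2"])
    fix t :: real assume "0 < t" "t < min s1 s2"
    then have "x + t *\<^sub>R d \<in> U" "\<rho> (x + t *\<^sub>R d) < 0" using s1 s2 by auto
    then show "x + t *\<^sub>R d \<in> \<Omega>" using U by blast
  qed (use s1 s2 in simp)
qed

lemma outward_direction_not_in_domain: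
  assumes "open \<Omega>" "x \<in> frontier \<Omega>" and def: "C1_defining_function \<Omega> x U \<rho>" and "grad \<rho> x \<bullet> d > 0"
  obtains s where "0 < s" "\<And>t. 0 < t \<Longrightarrow> t < s \<Longrightarrow> x + t *\<^sub>R d \<notin> \<Omega>"
proof -
  have U: "open U" "x \<in> U" "\<Omega> \<inter> U = {y \<in> U. \<rho> y < 0}" using def by (auto simp: C1_defining_function_def)
  obtain s1 where s1: "s1 > 0" "\<And>h. 0 < h \<Longrightarrow> h < s1 \<Longrightarrow> \<rho> (x + h *\<^sub>R d) > 0"
    using DERIV_pos_inc_right[OF C1_defining_function_directional[OF def, of d] assms(4)]
      C1_defining_function_eq_0[OF assms(1,2) def] by auto
  have "((\<lambda>t. x + t *\<^sub>R d) \<longlongrightarrow> x + 0 *\<^sub>R d) (at 0)" by (intro tendsto_intros)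
  then have "\<forall>\<^sub>F t in at 0. x + t *\<^sub>R d \<in> U" using U by (simp add: topological_tendstoD)
  then obtain s2 where s2: "s2 > 0" "\<And>t. t \<noteq> 0 \<Longrightarrow> dist t 0 < s2 \<Longrightarrow> x + t *\<^sub>R d \<in> U"
    unfolding eventually_at by auto
  show ?thesis
  proof (rule that[of "min s1 s2"])
    fix t :: real assume "0 < t" "t < min s1 s2"
    then have "x + t *\<^sub>R d \<in> U" "\<rho> (x + t *\<^sub>R d) > 0" using s1 s2 by auto
    then show "x + t *\<^sub>R d \<notin> \<Omega>" using U by force
  qed (use s1 s2 in simp)
qed

text \<open>The definite description ranges over all defining functions. If two of them gave
  different unit normals \<open>n\<close> and \<nu>, the direction \<open>\<nu> - n\<close> would
  lead into \<Omega> according to the first and out of it according to the second.\<close>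

lemma outward_normal_eq:
  assumes "open \<Omega>" "x \<in> frontier \<Omega>" and def: "C1_defining_function \<Omega> x U \<rho>"
  shows "outward_normal \<Omega> x = sgn (grad \<rho> x)"
  unfolding outward_normal_def
proof (rule the_equality)
  show "\<exists>U \<rho>'. C1_defining_function \<Omega> x U \<rho>' \<and> sgn (grad \<rho> x) = sgn (grad \<rho>' x)" using def by blast
  fix \<nu> assume "\<exists>U \<rho>. C1_defining_function \<Omega> x U \<rho> \<and> \<nu> = sgn (grad \<rho> x)"
  then obtain U' \<rho>' where def': "C1_defining_function \<Omega> x U' \<rho>'" and \<nu>: "\<nu> = sgn (grad \<rho>' x)" by blast
  show "\<nu> = sgn (grad \<rho> x)"
  proof (rule ccontr)
    assume ne: "\<nu> \<noteq> sgn (grad \<rho> x)"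
    define n where "n = sgn (grad \<rho> x)"
    have g: "grad \<rho> x \<noteq> 0" "grad \<rho>' x \<noteq> 0" using def def' by (auto simp: C1_defining_function_def)
    then have n1: "n \<bullet> n = 1" "\<nu> \<bullet> \<nu> = 1" by (auto simp: n_def \<nu> norm_sgn simp flip: norm_eq_1)
    have "0 < (\<nu> - n) \<bullet> (\<nu> - n)" using ne by (simp add: n_def)
    then have lt: "n \<bullet> \<nu> < 1" using n1 by (simp add: inner_diff_left inner_diff_right inner_commute)
    have eq: "grad \<rho> x = norm (grad \<rho> x) *\<^sub>R n" "grad \<rho>' x = norm (grad \<rho>' x) *\<^sub>R \<nu>"
      using g by (simp_all add: n_def \<nu> sgn_div_norm)
    have "grad \<rho> x \<bullet> (\<nu> - n) = norm (grad \<rho> x) * (n \<bullet> \<nu> - 1)"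
      by (subst eq(1)) (simp add: inner_diff_right n1 right_diff_distrib)
    then have "grad \<rho> x \<bullet> (\<nu> - n) < 0" using lt g by (simp add: mult_pos_neg)
    from inward_direction_in_domain[OF assms(1,2) def this]
    obtain s1 where s1: "0 < s1" "\<And>t. 0 < t \<Longrightarrow> t < s1 \<Longrightarrow> x + t *\<^sub>R (\<nu> - n) \<in> \<Omega>" by blast
    have "grad \<rho>' x \<bullet> (\<nu> - n) = norm (grad \<rho>' x) * (1 - n \<bullet> \<nu>)"
      by (subst eq(2)) (simp add: inner_diff_right n1 inner_commute right_diff_distrib)
    then have "grad \<rho>' x \<bullet> (\<nu> - n) > 0" using lt g by simp
    from outward_direction_not_in_domain[OF assms(1,2) def' this]
    obtain s2 where s2: "0 < s2" "\<And>t. 0 < t \<Longrightarrow> t < s2 \<Longrightarrow> x + t *\<^sub>R (\<nu> - n) \<notin> \<Omega>" by blast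
    define t where "t = min s1 s2 / 2"
    have "0 < t" "t < s1" "t < s2" using s1(1) s2(1) by (auto simp: t_def min_def)
    then show False using s1(2) s2(2) by blast
  qed
qed

text \<open>Convexity alone gives the weak inequality; it is strict because \<open>z\<close> has a
  neighbourhood in \<Omega>. It makes radially increasing functions centred at \<open>z\<close>
  increase in the normal direction.\<close>

lemma outward_normal_inner_pos:
  assumes "open \<Omega>" "convex \<Omega>" "C1_boundary \<Omega>" and x: "x \<in> frontier \<Omega>" and z: "z \<in> \<Omega>"
  shows "0 < (x - z) \<bullet> outward_normal \<Omega> x"
proof -
  obtain U \<rho> where def: "C1_defining_function \<Omega> x U \<rho>" using assms(3) x by (auto simp: C1_boundary_def)
  let ?g = "grad \<rho> x"
  have g: "?g \<noteq> 0" using def by (auto simp: C1_defining_function_def)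
  have "0 < ?g \<bullet> (x - z)"
  proof (rule ccontr)
    assume "\<not> 0 < ?g \<bullet> (x - z)"
    obtain r where r: "r > 0" "cball z r \<subseteq> \<Omega>" using assms(1) z open_contains_cball by blast
    \<comment> \<open>A shift of \<open>z\<close> along the gradient that stays in \<Omega>. It
      makes the direction from \<open>x\<close> point strictly outwards even if
      \<open>?g \<bullet> (x - z) = 0\<close>, although the segment from \<open>x\<close> to
      \<open>z'\<close> runs through the interior.\<close>
    define z' where "z' = z + (r / norm ?g) *\<^sub>R ?g"
    have "dist z z' = r" using r g by (simp add: z'_def dist_norm)
    then have z': "z' \<in> \<Omega>" using r by auto
    have "?g \<bullet> (z' - x) = - (?g \<bullet> (x - z)) + r / norm ?g * (?g \<bullet> ?g)"
      by (simp add: z'_def inner_diff_right inner_add_right)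
    moreover have "0 < r / norm ?g * (?g \<bullet> ?g)" using r g by simp
    ultimately have "0 < ?g \<bullet> (z' - x)" using \<open>\<not> 0 < ?g \<bullet> (x - z)\<close> by linarith
    from outward_direction_not_in_domain[OF assms(1) x def this]
    obtain s where s: "0 < s" "\<And>t. 0 < t \<Longrightarrow> t < s \<Longrightarrow> x + t *\<^sub>R (z' - x) \<notin> \<Omega>" by blast
    define t where "t = min 1 (s / 2)"
    have t: "0 < t" "t < s" "t \<le> 1" using s(1) by (auto simp: t_def)
    have "x - t *\<^sub>R (x - z') \<in> interior \<Omega>"
      using mem_interior_closure_convex_shrink[OF assms(2), of z' x t] z' x t assms(1)
      by (simp add: interior_open frontier_def)
    then show False using s(2)[OF t(1,2)] assms(1) by (simp add: interior_open algebra_simps)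
  qed
  then show ?thesis
    using g by (simp add: outward_normal_eq[OF assms(1) x def] sgn_div_norm inner_commute)
qed

text \<open>Applied to the gradient direction of a test function that increases in the normal
  direction: going downhill then enters \<Omega>.\<close>

lemma inward_normal_direction:
  assumes "open \<Omega>" "C1_boundary \<Omega>" and x: "x \<in> frontier \<Omega>" and d: "0 < d \<bullet> outward_normal \<Omega> x"
  obtains s where "0 < s" "x - s *\<^sub>R d \<in> \<Omega>"
proof -
  obtain U \<rho> where def: "C1_defining_function \<Omega> x U \<rho>" using assms(2) x by (auto simp: C1_boundary_def)
  have g: "grad \<rho> x \<noteq> 0" using def by (auto simp: C1_defining_function_def)
  have "0 < d \<bullet> grad \<rho> x"
    using d g by (simp add: outward_normal_eq[OF assms(1) x def] sgn_div_norm zero_less_mult_iff)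
  then have "grad \<rho> x \<bullet> (- d) < 0" by (simp add: inner_commute)
  from inward_direction_in_domain[OF assms(1) x def this]
  obtain s where s: "0 < s" "\<And>t. 0 < t \<Longrightarrow> t < s \<Longrightarrow> x + t *\<^sub>R (- d) \<in> \<Omega>" by blast
  show ?thesis using that[of "s / 2"] s(1) s(2)[of "s / 2"] by simp
qed

text \<open>A maximum of \<open>u\<close> minus the cone that exceeds \<open>u x\<close> lies
  neither at the vertex nor on the sphere of radius \<open>R\<close>. There the cone is replaced by
  a polynomial above it with the same derivatives up to order two, whose infinity Laplacian is
  \<open>- c\<close>. This contradicts \<open>f < c\<close>, and on the frontier the positive normal
  derivative excludes the other alternative.\<close>

lemma viscosity_cone_comparison:
  assumes dom: "bounded_domain \<Omega>" and conv: "convex \<Omega>" and bd: "C1_boundary \<Omega>"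
    and u: "viscosity_subsolution \<Omega> f u" and x: "x \<in> \<Omega>"
    and fc: "\<And>y. y \<in> closure \<Omega> \<Longrightarrow> dist x y \<le> R \<Longrightarrow> f y < c"
    and bc: "\<And>r. 0 < r \<Longrightarrow> r < R \<Longrightarrow> 0 < b - c * r" and "0 < R"
    and bdry: "\<And>y. y \<in> closure \<Omega> \<Longrightarrow> dist x y = R \<Longrightarrow> u y \<le> u x + (b * R - c / 2 * R\<^sup>2)"
    and y: "y \<in> closure \<Omega>" "dist x y \<le> R"
  shows "u y \<le> u x + (b * dist x y - c / 2 * (dist x y)\<^sup>2)"
proof -
  let ?K = "closure \<Omega>"
  define \<phi> where "\<phi> r = b * r - c / 2 * r\<^sup>2" for r
  define h where "h y = u y - \<phi> (dist x y)" for y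
  have op: "open \<Omega>" using dom by (simp add: bounded_domain_def)
  \<comment> \<open>Needed to multiply the polynomial bound for the distance by
    \<open>b\<close>.\<close>
  have b0: "0 \<le> b"
  proof (rule ccontr)
    assume "\<not> 0 \<le> b"
    show False
    proof (cases "0 \<le> c")
      case True
      then have "0 \<le> c * (R / 2)" using \<open>0 < R\<close> by simp
      then show False using bc[of "R / 2"] \<open>0 < R\<close> \<open>\<not> 0 \<le> b\<close> by simp
    next
      case False
      define r where "r = min (R / 2) (b / c)"
      have r: "0 < r" "r < R" using \<open>0 < R\<close> False \<open>\<not> 0 \<le> b\<close> by (auto simp: r_def divide_neg_neg)
      have "c * (b / c) \<le> c * r" using False by (intro mult_left_mono_neg) (auto simp: r_def)
      then show False using bc[OF r] False by simp
    qed
  qed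
  have "compact (?K \<inter> cball x R)"
    using dom by (simp add: bounded_domain_def compact_closure compact_Int)
  moreover have "?K \<inter> cball x R \<noteq> {}" using y by auto
  moreover have "continuous_on (?K \<inter> cball x R) h"
    unfolding h_def \<phi>_def using u
    by (auto simp: viscosity_subsolution_def intro!: continuous_intros intro: continuous_on_subset)
  ultimately obtain y0 where y0: "y0 \<in> ?K \<inter> cball x R" and max: "\<And>y. y \<in> ?K \<inter> cball x R \<Longrightarrow> h y \<le> h y0"
    using continuous_attains_sup by metis
  have "h y0 \<le> u x"
  proof (rule ccontr)
    assume gt: "\<not> h y0 \<le> u x"
    define r0 where "r0 = dist x y0"
    have "y0 \<noteq> x" using gt by (auto simp: h_def \<phi>_def)
    then have r0: "0 < r0" by (simp add: r0_def)
    have "r0 \<noteq> R" using bdry[of y0] y0 gt by (auto simp: r0_def h_def \<phi>_def)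
    then have rR: "r0 < R" using y0 by (simp add: r0_def)
    \<comment> \<open>Taylor coefficients of \<open>b * r - c / 2 * r\<^sup>2\<close> in the
      variable \<open>r\<^sup>2 - r0\<^sup>2\<close>; the quadratic term contributes to the first
      one only. The sign of \<open>a1\<close> is that of the slope of the cone at
      \<open>r0\<close>.\<close>
    define a1 where "a1 = b / (2 * r0) - c / 2"
    define a2 where "a2 = - b / (8 * r0 ^ 3)"
    define a3 where "a3 = b / (16 * r0 ^ 5)"
    let ?\<psi> = "radial_test a1 a2 a3 x y0"
    have a1: "0 < a1" using bc[OF r0 rR] r0 by (simp add: a1_def field_simps)
    have sq: "(z - x) \<bullet> (z - x) = (dist x z)\<^sup>2" for z
    proof -
      have "dist x z = norm (z - x)" by (simp add: dist_norm norm_minus_commute)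
      then show ?thesis by (simp add: power2_norm_eq_inner)
    qed
    have \<psi>: "\<phi> (dist x z) - \<phi> r0 + ((z - y0) \<bullet> (z - y0))\<^sup>2 \<le> ?\<psi> z" for z
    proof -
      let ?r = "dist x z"
      have "b * ?r \<le> b * (r0 + (?r\<^sup>2 - r0\<^sup>2) / (2 * r0) - (?r\<^sup>2 - r0\<^sup>2)\<^sup>2 / (8 * r0 ^ 3)
          + (?r\<^sup>2 - r0\<^sup>2) ^ 3 / (16 * r0 ^ 5))"
        using b0 r0 by (intro mult_left_mono le_cubic_in_square) auto
      also have "\<dots> = b * r0 + (a1 + c / 2) * (?r\<^sup>2 - r0\<^sup>2) + a2 * (?r\<^sup>2 - r0\<^sup>2)\<^sup>2 + a3 * (?r\<^sup>2 - r0\<^sup>2) ^ 3"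
        by (simp add: a1_def a2_def a3_def algebra_simps diff_divide_distrib)
      finally have "b * ?r - c / 2 * (?r\<^sup>2 - r0\<^sup>2) - b * r0
          \<le> a1 * (?r\<^sup>2 - r0\<^sup>2) + a2 * (?r\<^sup>2 - r0\<^sup>2)\<^sup>2 + a3 * (?r\<^sup>2 - r0\<^sup>2) ^ 3"
        by (simp add: distrib_right)
      then show ?thesis
        unfolding radial_test_def sq r0_def[symmetric] \<phi>_def by (simp add: right_diff_distrib)
    qed
    have \<psi>0: "?\<psi> y0 = 0" by (simp add: radial_test_def)
    have smooth: "smooth_on_closure \<Omega> ?\<psi>"
      by (intro smooth_on_closure_real_polynomial_function real_polynomial_function_radial_test)
    have "strict_local_max_on ?K (\<lambda>y. u y - ?\<psi> y) y0"
      unfolding strict_local_max_on_def eventually_at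
    proof (intro conjI exI[of _ "R - r0"] ballI impI)
      fix z assume z: "z \<in> ?K" "z \<noteq> y0 \<and> dist z y0 < R - r0"
      then have "z \<in> ?K \<inter> cball x R"
        using dist_triangle[of x z y0] by (simp add: r0_def dist_commute)
      then have "h z \<le> h y0" by (rule max)
      moreover have "0 < ((z - y0) \<bullet> (z - y0))\<^sup>2" using z by simp
      ultimately show "u z - ?\<psi> z < u y0 - ?\<psi> y0"
        using \<psi>[of z] \<psi>0 unfolding h_def r0_def by linarith
    qed (use y0 rR in auto)
    then have "- infinity_laplacian_plus ?\<psi> y0 \<le> f y0 \<or>
        y0 \<in> frontier \<Omega> \<and> frechet_derivative ?\<psi> (at y0) (outward_normal \<Omega> y0) \<le> 0"
      using u smooth y0 by (auto simp: viscosity_subsolution_def)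
    moreover have "infinity_laplacian_plus ?\<psi> y0 = - c"
    proof -
      have "infinity_laplacian_plus ?\<psi> y0 = 8 * a2 * r0\<^sup>2 + 2 * a1"
        using infinity_laplacian_plus_radial_test[OF \<open>y0 \<noteq> x\<close>, of a1 a2 a3] a1
        by (simp add: r0_def dist_norm norm_minus_commute)
      also have "\<dots> = - c" using r0 by (simp add: a1_def a2_def field_simps eval_nat_numeral)
      finally show ?thesis .
    qed
    ultimately have front: "y0 \<in> frontier \<Omega>" and neg: "frechet_derivative ?\<psi> (at y0) (outward_normal \<Omega> y0) \<le> 0"
      using fc[of y0] y0 by auto
    have "frechet_derivative ?\<psi> (at y0) (outward_normal \<Omega> y0) = 2 * a1 * ((y0 - x) \<bullet> outward_normal \<Omega> y0)"
      by (simp add: grad_radial_test frechet_derivative_eq_grad[OF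
            real_polynomial_function_partial_deriv(1)[OF real_polynomial_function_radial_test]])
    also have "\<dots> > 0" using a1 outward_normal_inner_pos[OF op conv bd front x] by simp
    finally show False using neg by simp
  qed
  then show ?thesis using max[of y] y by (simp add: h_def \<phi>_def)
qed

text \<open>Complements cone comparison at the vertex. The test function has vanishing gradient and
  Hessian \<open>- c\<close> times the identity, so the maximum over unit vectors is
  \<open>- c\<close>.\<close>

lemma viscosity_subsolution_paraboloid:
  assumes "open \<Omega>" and u: "viscosity_subsolution \<Omega> f u" and x: "x \<in> \<Omega>" and "0 < R"
    and le: "\<And>y. y \<in> closure \<Omega> \<Longrightarrow> dist x y \<le> R \<Longrightarrow> u y \<le> u x - c / 2 * (dist x y)\<^sup>2"
  shows "c \<le> f x"
proof -
  let ?\<psi> = "radial_test (- c / 2) 0 0 x x"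
  have xK: "x \<in> closure \<Omega>" and "x \<notin> frontier \<Omega>"
    using x assms(1) closure_subset by (auto simp: frontier_def interior_open)
  have "smooth_on_closure \<Omega> ?\<psi>"
    by (intro smooth_on_closure_real_polynomial_function real_polynomial_function_radial_test)
  moreover have "strict_local_max_on (closure \<Omega>) (\<lambda>y. u y - ?\<psi> y) x"
    unfolding strict_local_max_on_def eventually_at
  proof (intro conjI exI[of _ R] ballI impI)
    fix z assume z: "z \<in> closure \<Omega>" "z \<noteq> x \<and> dist z x < R"
    then have le_z: "u z \<le> u x - c / 2 * (dist x z)\<^sup>2" by (intro le) (auto simp: dist_commute)
    have "0 < ((z - x) \<bullet> (z - x))\<^sup>2" using z by simp
    moreover have "dist x z = norm (z - x)" by (simp add: dist_norm norm_minus_commute)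
    then have "(dist x z)\<^sup>2 = (z - x) \<bullet> (z - x)" by (simp add: power2_norm_eq_inner)
    then have "u z \<le> u x - c / 2 * ((z - x) \<bullet> (z - x))" using le_z by (simp only:)
    moreover have "?\<psi> z = - c / 2 * ((z - x) \<bullet> (z - x)) + ((z - x) \<bullet> (z - x))\<^sup>2" "?\<psi> x = 0"
      by (simp_all add: radial_test_def)
    ultimately show "u z - ?\<psi> z < u x - ?\<psi> x" by linarith
  qed (use xK \<open>0 < R\<close> in auto)
  ultimately have "- infinity_laplacian_plus ?\<psi> x \<le> f x"
    using u xK \<open>x \<notin> frontier \<Omega>\<close> by (auto simp: viscosity_subsolution_def)
  then show ?thesis by (simp add: infinity_laplacian_plus_radial_test_centre)
qed

text \<open>The quadratic cone of curvature \<open>c\<close> with vertex \<open>x\<close> that takes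
  the value \<open>M\<close> at radius \<open>2 * e\<close> has exactly the right-hand side as its
  value at radius \<open>e\<close>. Where that cone is not increasing up to \<open>2 * e\<close>, it
  is replaced by one peaking at height \<open>M\<close>, or the conclusion or a contradiction
  follows without it.\<close>

lemma viscosity_subsolution_doubling:
  assumes dom: "bounded_domain \<Omega>" and conv: "convex \<Omega>" and bd: "C1_boundary \<Omega>"
    and u: "viscosity_subsolution \<Omega> f u" and x: "x \<in> \<Omega>" and "0 < e"
    and fc: "\<And>y. y \<in> closure \<Omega> \<Longrightarrow> dist x y \<le> 2 * e \<Longrightarrow> f y < c"
    and M: "\<And>y. y \<in> closure \<Omega> \<Longrightarrow> dist x y \<le> 2 * e \<Longrightarrow> u y \<le> M"
    and y: "y \<in> closure \<Omega>" "dist x y \<le> e"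
  shows "u y \<le> (u x + M) / 2 + e\<^sup>2 / 2 * c"
proof -
  note cone = viscosity_cone_comparison[OF dom conv bd u x]
  have op: "open \<Omega>" using dom by (simp add: bounded_domain_def)
  have xK: "x \<in> closure \<Omega>" using x closure_subset by blast
  have ux: "u x \<le> M" using M[OF xK] \<open>0 < e\<close> by simp
  define r where "r = dist x y"
  have r: "0 \<le> r" "r \<le> e" using y by (auto simp: r_def)
  \<comment> \<open>The slope for which the cone reaches \<open>M\<close> at radius
    \<open>2 * e\<close>.\<close>
  define b where "b = (M - u x) / (2 * e) + c * e"
  have be: "b * (2 * e) - c / 2 * (2 * e)\<^sup>2 = M - u x"
    using \<open>0 < e\<close> by (simp add: b_def field_simps power2_eq_square)
  \<comment> \<open>In order: the cone increases up to \<open>2 * e\<close>; it is concave with its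
    peak before \<open>2 * e\<close>; \<open>u\<close> has its maximum over the ball at
    \<open>x\<close>; the cone bends upwards but starts downwards.\<close>
  consider (mono) "\<And>r. 0 < r \<Longrightarrow> r < 2 * e \<Longrightarrow> 0 < b - c * r"
    | (peak) "0 < c" "M - u x < 2 * c * e\<^sup>2" | (flat) "M \<le> u x" | (convex) "c < 0" "b < 0"
  proof (cases "0 < c")
    case True
    show ?thesis
    proof (cases "M - u x < 2 * c * e\<^sup>2")
      case False
      have "0 < b - c * r" if "r < 2 * e" for r
      proof -
        have "c * e \<le> (M - u x) / (2 * e)" using False \<open>0 < e\<close> by (simp add: field_simps power2_eq_square)
        moreover have "c * r < c * (2 * e)" using that True by (intro mult_strict_left_mono)
        ultimately show ?thesis by (simp add: b_def)
      qed
      then show ?thesis using mono by blast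
    qed (use True peak in blast)
  next
    case False
    consider "c = 0" "M - u x \<le> 0" | "c = 0" "M - u x > 0" | "c < 0" "b < 0" | "c < 0" "0 \<le> b"
      using False by linarith
    then show ?thesis
    proof cases
      case 2
      then have "0 < b - c * r" for r using \<open>0 < e\<close> by (simp add: b_def)
      then show ?thesis using mono by blast
    next
      case 4
      then have "0 < b - c * r" if "0 < r" for r using mult_neg_pos[of c r] that by linarith
      then show ?thesis using mono by blast
    next
      case 1
      then show ?thesis using flat by simp
    next
      case 3
      then show ?thesis using convex by simp
    qed
  qed
  then show ?thesis
  proof cases
    case mono
    have "u y \<le> u x + (b * r - c / 2 * r\<^sup>2)"
      unfolding r_def
    proof (rule cone[where R="2 * e"])
      show "u z \<le> u x + (b * (2 * e) - c / 2 * (2 * e)\<^sup>2)" if "z \<in> closure \<Omega>" "dist x z = 2 * e" for z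
        using M[of z] that be by simp
      show "0 < b - c * s" if "0 < s" "s < 2 * e" for s using that by (rule mono)
    qed (use y \<open>0 < e\<close> in \<open>auto intro: fc\<close>)
    also have "b * r - c / 2 * r\<^sup>2 \<le> b * e - c / 2 * e\<^sup>2"
    proof -
      have "0 \<le> (e - r) * (b - c * ((e + r) / 2))"
        using r \<open>0 < e\<close> mono[of "(e + r) / 2"] by (intro mult_nonneg_nonneg) auto
      then show ?thesis by (simp add: field_simps power2_eq_square)
    qed
    also have "b * e - c / 2 * e\<^sup>2 = (M - u x) / 2 + e\<^sup>2 / 2 * c"
      using \<open>0 < e\<close> by (simp add: b_def field_simps power2_eq_square)
    finally show ?thesis by (simp add: field_simps)
  next
    case peak
    \<comment> \<open>The peak radius of the cone of curvature \<open>c\<close> that starts at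
      \<open>u x\<close> and peaks at height \<open>M\<close>; its slope is
      \<open>c * p\<close>.\<close>
    define p where "p = sqrt (2 * (M - u x) / c)"
    have p2: "c * p\<^sup>2 = 2 * (M - u x)" using peak ux by (simp add: p_def)
    have p0: "0 \<le> p" using peak ux by (simp add: p_def)
    have "c * p\<^sup>2 < c * (2 * e)\<^sup>2"
      using p2 peak by (simp add: power2_eq_square)
    then have "p\<^sup>2 < (2 * e)\<^sup>2" using peak by (simp only: mult_less_cancel_left_pos)
    then have p: "p < 2 * e" by (rule power2_less_imp_less) (use \<open>0 < e\<close> in simp)
    show ?thesis
    proof (cases "r \<le> p \<and> 0 < p")
      case True
      have "u y \<le> u x + (c * p * r - c / 2 * r\<^sup>2)"
        unfolding r_def
      proof (rule cone[where R=p])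
        show "0 < c * p - c * s" if "s < p" for s using that peak by simp
        show "u z \<le> u x + (c * p * p - c / 2 * p\<^sup>2)" if "z \<in> closure \<Omega>" "dist x z = p" for z
        proof -
          have "c * p * p = c * p\<^sup>2" "c / 2 * p\<^sup>2 = c * p\<^sup>2 / 2" by (simp_all add: power2_eq_square)
          then have "c * p * p - c / 2 * p\<^sup>2 = M - u x" by (simp only: p2) (simp add: field_simps)
          then show ?thesis using M[of z] that p by simp
        qed
        show "f z < c" if "z \<in> closure \<Omega>" "dist x z \<le> p" for z using fc[of z] that p by simp
      qed (use y True in \<open>auto simp: r_def\<close>)
      also have "c * p * r - c / 2 * r\<^sup>2 \<le> c * p\<^sup>2 / 4 + c * r\<^sup>2 / 2"
      proof -
        have "0 \<le> c * (p / 2 - r)\<^sup>2" using peak by simp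
        then show ?thesis by (simp add: field_simps power2_eq_square)
      qed
      also have "c * r\<^sup>2 \<le> c * e\<^sup>2" using peak r by (intro mult_left_mono power_mono) auto
      finally show ?thesis using p2 by (simp add: field_simps)
    next
      \<comment> \<open>Beyond the peak radius the bound \<open>M\<close> itself suffices, as
        \<open>(M - u x) / 2 = c * p\<^sup>2 / 4\<close> with \<open>p \<le> e\<close>.\<close>
      case False
      then have "p \<le> e" using r p0 by auto
      then have "c * p\<^sup>2 \<le> c * e\<^sup>2" using peak p0 by (intro mult_left_mono power_mono) auto
      moreover have "u y \<le> M" using M[of y] y \<open>0 < e\<close> by simp
      moreover have "0 \<le> c * p\<^sup>2" using peak by simp
      ultimately show ?thesis using p2 by (simp add: field_simps)
    qed
  next
    case flat
    have "u y \<le> M" using M[of y] y \<open>0 < e\<close> by simp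
    show ?thesis
    proof (cases "0 \<le> c")
      case True
      then have "0 \<le> e\<^sup>2 / 2 * c" by simp
      then show ?thesis using flat ux \<open>u y \<le> M\<close> by simp
    next
      case False
      have "c \<le> f x"
      proof (rule viscosity_subsolution_paraboloid[OF op u x \<open>0 < e\<close>])
        fix z assume "z \<in> closure \<Omega>" "dist x z \<le> e"
        then have "u z \<le> u x" using M[of z] flat \<open>0 < e\<close> by simp
        moreover have "c / 2 * (dist x z)\<^sup>2 \<le> 0" using False by (simp add: mult_nonpos_nonneg)
        ultimately show "u z \<le> u x - c / 2 * (dist x z)\<^sup>2" by simp
      qed
      then show ?thesis using fc[OF xK] \<open>0 < e\<close> by simp
    qed
  next
    case convex
    have "c \<le> f x"
    proof (rule viscosity_subsolution_paraboloid[OF op u x, of "2 * e"])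
      fix z assume z: "z \<in> closure \<Omega>" "dist x z \<le> 2 * e"
      show "u z \<le> u x - c / 2 * (dist x z)\<^sup>2"
      proof (rule field_le_epsilon)
        fix d :: real assume "0 < d"
        \<comment> \<open>Every positive slope is admissible because \<open>c < 0\<close>, and
          raising the slope from \<open>b < 0\<close> only relaxes the condition on the sphere. In
          the limit of slope 0 a paraboloid touches at \<open>x\<close>, which contradicts
          \<open>f x < c\<close>.\<close>
        define b' where "b' = d / (2 * e)"
        have b': "0 < b'" using \<open>0 < d\<close> \<open>0 < e\<close> by (simp add: b'_def)
        have "u z \<le> u x + (b' * dist x z - c / 2 * (dist x z)\<^sup>2)"
        proof (rule cone[where R="2 * e"])
          show "0 < b' - c * s" if "0 < s" for s using b' mult_neg_pos[OF convex(1) that] by linarith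
          show "u z \<le> u x + (b' * (2 * e) - c / 2 * (2 * e)\<^sup>2)" if "z \<in> closure \<Omega>" "dist x z = 2 * e" for z
          proof -
            have "b * (2 * e) < 0" "0 < b' * (2 * e)" using convex b' \<open>0 < e\<close> by (auto simp: mult_neg_pos)
            then show ?thesis using M[of z] that be by simp
          qed
        qed (use fc z \<open>0 < e\<close> in auto)
        moreover have "b' * dist x z \<le> b' * (2 * e)" using z b' by simp
        moreover have "b' * (2 * e) = d" using \<open>0 < e\<close> by (simp add: b'_def)
        ultimately show "u z \<le> u x - c / 2 * (dist x z)\<^sup>2 + d" by linarith
      qed
    qed (use \<open>0 < e\<close> in simp)
    then show ?thesis using fc[OF xK] \<open>0 < e\<close> by simp
  qed
qed

text \<open>Balls of radius \<open>e\<close> within a convex set move no further than their centres: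
  \<open>y\<close> is pulled along the segment towards the new centre until its distance is
  \<open>e\<close>.\<close>

lemma convex_ball_transfer:
  fixes K :: "'a::real_normed_vector set"
  assumes "convex K" "x' \<in> K" "y \<in> K" "dist x y \<le> e" "0 \<le> e"
  obtains y' where "y' \<in> K" "dist x' y' \<le> e" "dist y y' \<le> dist x x'"
proof (cases "dist x' y \<le> e")
  case True
  then show ?thesis using that[of y] assms by simp
next
  case False
  define d where "d = dist x' y"
  have d: "0 < d" "e < d" using False \<open>0 \<le> e\<close> by (auto simp: d_def)
  define y' where "y' = (1 - e / d) *\<^sub>R x' + (e / d) *\<^sub>R y"
  have "y' \<in> K"
    unfolding y'_def using assms d by (intro convexD) auto
  moreover have "x' - y' = (e / d) *\<^sub>R (x' - y)" by (simp add: y'_def algebra_simps)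
  then have "dist x' y' = e" using d \<open>0 \<le> e\<close> by (simp add: dist_norm d_def)
  moreover have "y - y' = (1 - e / d) *\<^sub>R (y - x')" by (simp add: y'_def algebra_simps)
  then have "dist y y' = \<bar>1 - e / d\<bar> * d" by (simp add: dist_norm d_def norm_minus_commute)
  then have "dist y y' = d - e" using d by (simp add: left_diff_distrib)
  then have "dist y y' \<le> dist x x'"
    using assms(4) dist_triangle[of x' y x] by (simp add: d_def dist_commute)
  ultimately show ?thesis using that by simp
qed

lemma continuous_on_SUP_ball:
  fixes K :: "'a::real_normed_vector set" and u :: "'a \<Rightarrow> real"
  assumes "compact K" "convex K" "continuous_on K u" "0 \<le> e"
  shows "continuous_on K (\<lambda>x. SUP y\<in>K \<inter> cball x e. u y)"
  unfolding continuous_on_iff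
proof (intro ballI allI impI)
  fix x and \<eta> :: real assume x: "x \<in> K" and "0 < \<eta>"
  have bd: "bounded (u ` (K \<inter> cball z e))" for z
    using compact_imp_bounded[OF compact_continuous_image[OF assms(3,1)]] bounded_image_subset by blast
  have "uniformly_continuous_on K u" using assms by (intro compact_uniformly_continuous)
  then obtain \<delta> where \<delta>: "0 < \<delta>" "\<And>y y'. y \<in> K \<Longrightarrow> y' \<in> K \<Longrightarrow> dist y' y < \<delta> \<Longrightarrow> dist (u y') (u y) < \<eta> / 2"
    unfolding uniformly_continuous_on_def using \<open>0 < \<eta>\<close> half_gt_zero by metis
  have le: "(SUP y\<in>K \<inter> cball z e. u y) \<le> (SUP y\<in>K \<inter> cball z' e. u y) + \<eta> / 2"
    if z: "z \<in> K" "z' \<in> K" "dist z z' < \<delta>" for z z'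
  proof (rule cSUP_least)
    show "K \<inter> cball z e \<noteq> {}" using z \<open>0 \<le> e\<close> by auto
    fix y assume "y \<in> K \<inter> cball z e"
    then obtain y' where y': "y' \<in> K" "dist z' y' \<le> e" "dist y y' \<le> dist z z'"
      using convex_ball_transfer[OF assms(2) z(2), of y z e] \<open>0 \<le> e\<close> by auto
    have "dist (u y') (u y) < \<eta> / 2"
      using \<delta>(2)[of y y'] y' z \<open>y \<in> K \<inter> cball z e\<close> by (simp add: dist_commute)
    then have "u y \<le> u y' + \<eta> / 2" unfolding dist_real_def by linarith
    also have "u y' \<le> (SUP y\<in>K \<inter> cball z' e. u y)"
      using y' by (intro cSUP_upper bounded_imp_bdd_above bd) auto
    finally show "u y \<le> (SUP y\<in>K \<inter> cball z' e. u y) + \<eta> / 2" by simp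
  qed
  show "\<exists>d>0. \<forall>x'\<in>K. dist x' x < d \<longrightarrow> dist (SUP y\<in>K \<inter> cball x' e. u y) (SUP y\<in>K \<inter> cball x e. u y) < \<eta>"
  proof (intro exI[of _ \<delta>] conjI ballI impI)
    fix x' assume "x' \<in> K" "dist x' x < \<delta>"
    then show "dist (SUP y\<in>K \<inter> cball x' e. u y) (SUP y\<in>K \<inter> cball x e. u y) < \<eta>"
      using le[OF x, of x'] le[of x' x] x \<open>0 < \<eta>\<close> by (simp add: dist_real_def dist_commute abs_less_iff)
  qed (rule \<delta>(1))
qed

text \<open>The argument of Armstrong and Smart. The doubling estimate holds at interior points and passes to
  the closure by continuity. The minimum of \<open>w\<close> over the ball of radius \<open>e\<close> is at least \<open>u x\<close> and
  its maximum is that of \<open>u\<close> over the ball of radius \<open>2 * e\<close>, as \<open>\<Omega>\<close> is convex.\<close>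

lemma sup_ball_discrete_subsolution:
  assumes dom: "bounded_domain \<Omega>" and conv: "convex \<Omega>" and bd: "C1_boundary \<Omega>"
    and f: "continuous_on (closure \<Omega>) f" and u: "viscosity_subsolution \<Omega> f u" and "0 < e"
    and osc: "\<And>x y. x \<in> closure \<Omega> \<Longrightarrow> y \<in> closure \<Omega> \<Longrightarrow> dist x y \<le> 2 * e \<Longrightarrow> f y < f x + \<eta>"
    and x: "x \<in> closure \<Omega>"
  defines "w \<equiv> \<lambda>x. SUP y\<in>closure \<Omega> \<inter> cball x e. u y"
  shows "w x \<le> minmax (closure \<Omega>) e w x + e\<^sup>2 / 2 * (f x + \<eta>)"
proof -
  let ?K = "closure \<Omega>"
  define W where "W x = (SUP y\<in>?K \<inter> cball x (2 * e). u y)" for x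
  have K: "compact ?K" "convex ?K" using compact_closure_domain[OF dom] convex_closure[OF conv] by auto
  have uc: "continuous_on ?K u" using u by (simp add: viscosity_subsolution_def)
  have bdu: "bounded (u ` (?K \<inter> cball z r))" for z r
    using bounded_image_domain[OF dom uc] bounded_image_subset by blast
  have wc: "continuous_on ?K w" unfolding w_def using K uc \<open>0 < e\<close> by (intro continuous_on_SUP_ball) auto
  have Wc: "continuous_on ?K W" unfolding W_def using K uc \<open>0 < e\<close> by (intro continuous_on_SUP_ball) auto
  have u_le_w: "u y \<le> w z" if "y \<in> ?K" "dist z y \<le> e" for y z
    unfolding w_def using that by (intro cSUP_upper bounded_imp_bdd_above bdu) auto
  have u_le_W: "u y \<le> W z" if "y \<in> ?K" "dist z y \<le> 2 * e" for y z
    unfolding W_def using that by (intro cSUP_upper bounded_imp_bdd_above bdu) auto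
  have "w z - ((u z + W z) / 2 + e\<^sup>2 / 2 * (f z + \<eta>)) \<le> 0" if z: "z \<in> ?K" for z
  proof (rule continuous_le_on_closure[OF _ z])
    show "continuous_on ?K (\<lambda>z. w z - ((u z + W z) / 2 + e\<^sup>2 / 2 * (f z + \<eta>)))"
      using wc Wc uc f by (intro continuous_intros) auto
    fix z assume z: "z \<in> \<Omega>"
    then have zK: "z \<in> ?K" using closure_subset by blast
    have "w z \<le> (u z + W z) / 2 + e\<^sup>2 / 2 * (f z + \<eta>)"
      unfolding w_def
    proof (rule cSUP_least)
      show "?K \<inter> cball z e \<noteq> {}" using zK \<open>0 < e\<close> by auto
      fix y assume "y \<in> ?K \<inter> cball z e"
      then show "u y \<le> (u z + W z) / 2 + e\<^sup>2 / 2 * (f z + \<eta>)"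
        using osc[OF zK] u_le_W
        by (intro viscosity_subsolution_doubling[OF dom conv bd u z \<open>0 < e\<close>]) auto
    qed
    then show "w z - ((u z + W z) / 2 + e\<^sup>2 / 2 * (f z + \<eta>)) \<le> 0" by simp
  qed
  from this[OF x] have main: "w x \<le> (u x + W x) / 2 + e\<^sup>2 / 2 * (f x + \<eta>)" by simp
  have ne: "?K \<inter> cball x e \<noteq> {}" using x \<open>0 < e\<close> by auto
  have "u x \<le> (INF y\<in>?K \<inter> cball x e. w y)"
    using ne u_le_w[OF x] by (intro cINF_greatest) (auto simp: dist_commute)
  moreover have "W x \<le> (SUP y\<in>?K \<inter> cball x e. w y)"
    unfolding W_def
  proof (rule cSUP_least)
    show "?K \<inter> cball x (2 * e) \<noteq> {}" using x \<open>0 < e\<close> by auto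
    fix z assume z: "z \<in> ?K \<inter> cball x (2 * e)"
    \<comment> \<open>A point within \<open>2 * e\<close> of \<open>x\<close> is within
      \<open>e\<close> of a point that is itself within \<open>e\<close> of
      \<open>x\<close>.\<close>
    have "midpoint x z \<in> ?K"
      using K(2) x z convexD[of ?K x z "1/2" "1/2"] by (simp add: midpoint_def scaleR_add_right)
    then have m: "midpoint x z \<in> ?K \<inter> cball x e" "dist (midpoint x z) z \<le> e"
      using z by (auto simp: dist_midpoint)
    then have "u z \<le> w (midpoint x z)" using z by (intro u_le_w) auto
    also have "\<dots> \<le> (SUP y\<in>?K \<inter> cball x e. w y)"
      using m bounded_image_domain[OF dom wc] bounded_image_subset[of w ?K "?K \<inter> cball x e"]
      by (intro cSUP_upper bounded_imp_bdd_above) auto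
    finally show "u z \<le> (SUP y\<in>?K \<inter> cball x e. w y)" .
  qed
  ultimately have "(u x + W x) / 2 \<le> minmax ?K e w x" unfolding minmax_def by simp
  then show ?thesis using main add_right_mono order_trans by blast
qed

text \<open>The maxima of \<open>u\<close> over balls of radius \<open>e\<close>, multiplied by
  \<open>2 / e\<^sup>2\<close>, lose at most \<eta> in a step of the iteration. Here
  \<open>e\<close> is so small that \<open>f\<close> varies by less than \<eta> over distances up to
  \<open>2 * e\<close>, the reach of the doubling estimate.\<close>

lemma viscosity_subsolution_growth_const:
  assumes dom: "bounded_domain \<Omega>" and conv: "convex \<Omega>" and bd: "C1_boundary \<Omega>"
    and f: "continuous_on (closure \<Omega>) f" and u: "viscosity_subsolution \<Omega> f u" and "0 < \<eta>"
  shows "\<forall>\<^sub>F e in at_right 0. - \<eta> \<le> growth_const \<Omega> f e"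
proof -
  let ?K = "closure \<Omega>"
  have "uniformly_continuous_on ?K f"
    using f compact_closure_domain[OF dom] by (rule compact_uniformly_continuous)
  then obtain d where d: "0 < d" "\<And>x y. x \<in> ?K \<Longrightarrow> y \<in> ?K \<Longrightarrow> dist y x < d \<Longrightarrow> dist (f y) (f x) < \<eta>"
    unfolding uniformly_continuous_on_def using \<open>0 < \<eta>\<close> by metis
  have "- \<eta> \<le> growth_const \<Omega> f e" if e: "0 < e" "e < min 1 (d / 2)" for e
  proof -
    define w where "w = (\<lambda>x. SUP y\<in>?K \<inter> cball x e. u y)"
    have uc: "continuous_on ?K u" using u by (simp add: viscosity_subsolution_def)
    have "continuous_on ?K w"
      unfolding w_def using compact_closure_domain[OF dom] convex_closure[OF conv] uc e
      by (intro continuous_on_SUP_ball) auto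
    then have bdw: "bounded (w ` ?K)" using dom bounded_image_domain by blast
    have osc: "f y < f x + \<eta>" if "x \<in> ?K" "y \<in> ?K" "dist x y \<le> 2 * e" for x y
      using d(2)[of x y] that e by (simp add: dist_real_def dist_commute abs_less_iff)
    define w' where "w' x = 2 / e\<^sup>2 * w x" for x
    show ?thesis
    proof (rule growth_const_ge[OF dom conv f, of e w'])
      show "bounded (w' ` ?K)"
        using bounded_scaleR_comp[OF bdw, of "2 / e\<^sup>2"] by (simp add: w'_def)
      fix x assume x: "x \<in> ?K"
      have "minmax ?K e w' x = 2 / e\<^sup>2 * minmax ?K e w x"
        unfolding w'_def using x e bdw by (intro minmax_mult) auto
      moreover have "w x \<le> minmax ?K e w x + e\<^sup>2 / 2 * (f x + \<eta>)"
        unfolding w_def using sup_ball_discrete_subsolution[OF dom conv bd f u e(1) osc x] .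
      then have "2 / e\<^sup>2 * w x \<le> 2 / e\<^sup>2 * (minmax ?K e w x + e\<^sup>2 / 2 * (f x + \<eta>))"
        by (intro mult_left_mono) auto
      moreover have "2 / e\<^sup>2 * (minmax ?K e w x + e\<^sup>2 / 2 * (f x + \<eta>)) = 2 / e\<^sup>2 * minmax ?K e w x + (f x + \<eta>)"
        using e by (simp add: distrib_left)
      ultimately show "w' x + - \<eta> \<le> minmax ?K e w' x + f x" unfolding w'_def by linarith
    qed (use e in auto)
  qed
  moreover have "0 < min 1 (d / 2)" using d by simp
  ultimately show ?thesis unfolding eventually_at_right_field by blast
qed

lemma viscosity_solution_growth_const:
  assumes dom: "bounded_domain \<Omega>" and conv: "convex \<Omega>" and bd: "C1_boundary \<Omega>"
    and f: "continuous_on (closure \<Omega>) f" and u: "viscosity_solution \<Omega> f u"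
  shows "(growth_const \<Omega> f \<longlongrightarrow> 0) (at_right 0)"
proof (rule tendstoI)
  fix \<eta> :: real assume "0 < \<eta>"
  have sub: "viscosity_subsolution \<Omega> f u" and super: "viscosity_subsolution \<Omega> (\<lambda>x. - f x) (\<lambda>x. - u x)"
    using u by (auto simp: viscosity_solution_def viscosity_supersolution_def)
  have "\<forall>\<^sub>F e in at_right 0. - (\<eta> / 2) \<le> growth_const \<Omega> f e"
    using viscosity_subsolution_growth_const[OF dom conv bd f sub] \<open>0 < \<eta>\<close> by simp
  moreover have "\<forall>\<^sub>F e in at_right 0. - (\<eta> / 2) \<le> growth_const \<Omega> (\<lambda>x. - f x) e"
    using viscosity_subsolution_growth_const[OF dom conv bd _ super] f \<open>0 < \<eta>\<close> by (simp add: continuous_on_minus)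
  moreover have "\<forall>\<^sub>F e in at_right 0. (0::real) < e \<and> e < 1"
    unfolding eventually_at_right_field by (intro exI[of _ 1]) auto
  ultimately show "\<forall>\<^sub>F e in at_right 0. dist (growth_const \<Omega> f e) 0 < \<eta>"
  proof eventually_elim
    case (elim e)
    then show ?case using growth_const_uminus[OF dom conv f, of e] \<open>0 < \<eta>\<close> by (simp add: dist_real_def abs_less_iff)
  qed
qed

section \<open>Viscosity limits of discrete subsolutions\<close>

text \<open>The gradient is differentiable at \<open>x0\<close>; the mean value theorem on the
  segment turns its first order expansion into a second order expansion of
  \<open>\<phi>\<close>.\<close>

lemma second_order_taylor_upper:
  fixes \<phi> :: "real ^ 'n \<Rightarrow> real"
  assumes "open U" "x0 \<in> U" and Ck: "\<And>k. Ck_on k \<phi> U" and "0 < \<eta>"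
  obtains \<delta> where "0 < \<delta>" "\<And>h. norm h < \<delta> \<Longrightarrow>
    \<phi> (x0 + h) \<le> \<phi> x0 + grad \<phi> x0 \<bullet> h + h \<bullet> (hessian \<phi> x0 *v h) / 2 + \<eta> * (norm h)\<^sup>2"
proof -
  let ?H = "hessian \<phi> x0"
  have diff: "\<phi> differentiable (at y)" if "y \<in> U" for y using Ck[of "Suc 0"] that by simp
  have diff2: "partial_deriv i \<phi> differentiable (at x0)" for i
    using Ck[of "Suc (Suc 0)"] assms(2) by simp
  have Hk: "(?H *v k) $ i = grad (partial_deriv i \<phi>) x0 \<bullet> k" for k i
    by (simp add: matrix_vector_mult_def hessian_def grad_def inner_vec_def)
  have "(grad \<phi> has_derivative (\<lambda>k. ?H *v k)) (at x0)"
  proof (subst has_derivative_componentwise_within, intro ballI)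
    fix b :: "real ^ 'n" assume "b \<in> Basis"
    then obtain i where b: "b = axis i 1" by (auto simp: Basis_vec_def)
    have "((\<lambda>x. partial_deriv i \<phi> x) has_derivative (\<lambda>k. grad (partial_deriv i \<phi>) x0 \<bullet> k)) (at x0)"
      by (rule has_derivative_grad[OF diff2])
    then show "((\<lambda>x. grad \<phi> x \<bullet> b) has_derivative (\<lambda>k. (?H *v k) \<bullet> b)) (at x0)"
      by (simp add: b inner_axis Hk grad_def)
  qed
  then obtain d where d: "0 < d" "\<And>y. norm (y - x0) < d \<Longrightarrow>
      norm (grad \<phi> y - grad \<phi> x0 - ?H *v (y - x0)) \<le> \<eta> * norm (y - x0)"
    unfolding has_derivative_at_alt using \<open>0 < \<eta>\<close> by blast
  obtain r where r: "0 < r" "ball x0 r \<subseteq> U" using assms(1,2) open_contains_ball by blast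
  show ?thesis
  proof (rule that[of "min d r"])
    fix h :: "real ^ 'n" assume h: "norm h < min d r"
    \<comment> \<open>The remainder along the segment: its derivative is the inner product of
      \<open>h\<close> with the first order remainder of the gradient.\<close>
    define g where "g t = \<phi> (x0 + t *\<^sub>R h) - t * (grad \<phi> x0 \<bullet> h) - t\<^sup>2 / 2 * (h \<bullet> (?H *v h))" for t
    define g' where "g' t = grad \<phi> (x0 + t *\<^sub>R h) \<bullet> h - grad \<phi> x0 \<bullet> h - t * (h \<bullet> (?H *v h))" for t
    have th: "norm (t *\<^sub>R h) < min d r" if "0 \<le> t" "t \<le> 1" for t
    proof -
      have "norm (t *\<^sub>R h) \<le> 1 * norm h" using that by (simp add: mult_left_le_one_le)
      then show ?thesis using h by simp
    qed
    have g: "(g has_real_derivative g' t) (at t)" if t: "0 \<le> t" "t \<le> 1" for t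
    proof -
      have "x0 + t *\<^sub>R h \<in> U" using th[OF t] r(2) by (auto simp: dist_norm subset_eq)
      then have 1: "(\<phi> has_derivative (\<lambda>k. grad \<phi> (x0 + t *\<^sub>R h) \<bullet> k)) (at (x0 + t *\<^sub>R h))"
        using diff has_derivative_grad by blast
      have "((\<lambda>t. x0 + t *\<^sub>R h) has_derivative (\<lambda>s. s *\<^sub>R h)) (at t)"
        by (rule derivative_eq_intros refl | simp)+
      from has_derivative_compose[OF this 1]
      have "((\<lambda>t. \<phi> (x0 + t *\<^sub>R h)) has_real_derivative (grad \<phi> (x0 + t *\<^sub>R h) \<bullet> h)) (at t)"
        by (simp add: has_field_derivative_def mult_commute_abs)
      then show ?thesis unfolding g_def g'_def
        by (auto intro!: derivative_eq_intros)
    qed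
    obtain t where t: "0 < t" "t < 1" "g 1 - g 0 = (1 - 0) * g' t"
      using MVT2[of 0 1 g g'] g by auto
    have "g' t = (grad \<phi> (x0 + t *\<^sub>R h) - grad \<phi> x0 - ?H *v (t *\<^sub>R h)) \<bullet> h"
      by (simp add: g'_def inner_diff_left inner_diff_right inner_commute matrix_vector_mult_scaleR)
    also have "\<dots> \<le> norm (grad \<phi> (x0 + t *\<^sub>R h) - grad \<phi> x0 - ?H *v (t *\<^sub>R h)) * norm h"
      by (rule norm_cauchy_schwarz)
    also have "\<dots> \<le> (\<eta> * norm (t *\<^sub>R h)) * norm h"
      using d(2)[of "x0 + t *\<^sub>R h"] th[of t] t by (intro mult_right_mono) auto
    also have "\<dots> = t * (\<eta> * (norm h)\<^sup>2)" using t by (simp add: power2_eq_square)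
    also have "\<dots> \<le> 1 * (\<eta> * (norm h)\<^sup>2)" using t \<open>0 < \<eta>\<close> by (intro mult_right_mono) auto
    finally have "g' t \<le> \<eta> * (norm h)\<^sup>2" by simp
    then show "\<phi> (x0 + h) \<le> \<phi> x0 + grad \<phi> x0 \<bullet> h + h \<bullet> (?H *v h) / 2 + \<eta> * (norm h)\<^sup>2"
      using t(3) by (simp add: g_def)
  qed (use d r in simp)
qed

text \<open>Strict maxima persist under uniform convergence. The functions \<open>G k\<close> may
  have no maximum, so \<open>X k\<close> is a maximum only up to \<open>\<tau> k\<close>.\<close>

lemma near_maximum_points:
  fixes F :: "'a::metric_space \<Rightarrow> real" and G :: "nat \<Rightarrow> 'a \<Rightarrow> real"
  assumes S: "compact S" and x0: "x0 \<in> S" and F: "continuous_on S F"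
    and max: "\<And>y. y \<in> S \<Longrightarrow> y \<noteq> x0 \<Longrightarrow> F y < F x0"
    and unif: "\<And>d. 0 < d \<Longrightarrow> \<forall>\<^sub>F k in sequentially. \<forall>y\<in>S. \<bar>G k y - F y\<bar> \<le> d"
    and \<tau>: "\<And>k. 0 < \<tau> k" "\<tau> \<longlonglongrightarrow> 0"
  obtains X where "\<And>k. X k \<in> S" "X \<longlonglongrightarrow> x0"
    "\<forall>\<^sub>F k in sequentially. \<forall>y\<in>S. G k y \<le> G k (X k) + \<tau> k"
proof -
  have bF: "bounded (F ` S)" using compact_continuous_image[OF F S] compact_imp_bounded by blast
  then obtain B where B: "\<And>x. x \<in> S \<Longrightarrow> \<bar>F x\<bar> \<le> B" using bounded_image_realE by metis
  \<comment> \<open>\<open>G k\<close> is known to be bounded above only when it is close to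
    \<open>F\<close>; for the other indices any point of \<open>S\<close> will do.\<close>
  have ex: "\<exists>x\<in>S. (\<forall>y\<in>S. \<bar>G k y - F y\<bar> \<le> 1) \<longrightarrow> (\<forall>y\<in>S. G k y \<le> G k x + \<tau> k)" for k
  proof (cases "\<forall>y\<in>S. \<bar>G k y - F y\<bar> \<le> 1")
    case True
    have "\<bar>G k y\<bar> \<le> B + 1" if "y \<in> S" for y
      using bspec[OF True that] B[OF that] by linarith
    then have bdd: "bdd_above (G k ` S)" by (intro bounded_imp_bdd_above bounded_image_realI)
    have "(SUP y\<in>S. G k y) - \<tau> k < (SUP y\<in>S. G k y)" using \<tau>(1)[of k] by simp
    then obtain x where x: "x \<in> S" "(SUP y\<in>S. G k y) - \<tau> k < G k x"
      using less_cSUP_iff[OF _ bdd] x0 by blast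
    have "G k y \<le> G k x + \<tau> k" if "y \<in> S" for y
      using cSUP_upper[OF that bdd] x(2) by linarith
    then show ?thesis using x(1) by blast
  next
    case False
    then show ?thesis using x0 by blast
  qed
  then have "\<exists>X. \<forall>k. X k \<in> S \<and> ((\<forall>y\<in>S. \<bar>G k y - F y\<bar> \<le> 1) \<longrightarrow> (\<forall>y\<in>S. G k y \<le> G k (X k) + \<tau> k))"
    by (intro choice allI) blast
  then obtain X where X: "\<And>k. X k \<in> S"
    and X': "\<And>k. (\<forall>y\<in>S. \<bar>G k y - F y\<bar> \<le> 1) \<Longrightarrow> (\<forall>y\<in>S. G k y \<le> G k (X k) + \<tau> k)"
    by blast
  have ev: "\<forall>\<^sub>F k in sequentially. \<forall>y\<in>S. G k y \<le> G k (X k) + \<tau> k"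
    by (rule eventually_mono[OF unif[OF zero_less_one]]) (use X' in blast)
  have "X \<longlonglongrightarrow> x0"
  proof (rule tendstoI)
    fix r :: real assume "0 < r"
    define T where "T = S - ball x0 r"
    show "\<forall>\<^sub>F k in sequentially. dist (X k) x0 < r"
    proof (cases "T = {}")
      case True
      then have "dist (X k) x0 < r" for k using X[of k] by (auto simp: T_def dist_commute)
      then show ?thesis by simp
    next
      case False
      have "compact T" unfolding T_def by (intro compact_diff S open_ball)
      moreover have "continuous_on T F" using F by (rule continuous_on_subset) (auto simp: T_def)
      ultimately obtain y1 where y1: "y1 \<in> T" "\<And>y. y \<in> T \<Longrightarrow> F y \<le> F y1"
        using continuous_attains_sup False by metis
      \<comment> \<open>The drop of \<open>F\<close> outside the ball. Two approximation errors and
        \<open>\<tau> k\<close>, each at most a quarter of it, cannot make up for it.\<close>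
      define \<kappa> where "\<kappa> = F x0 - F y1"
      have "y1 \<noteq> x0" "y1 \<in> S" using y1(1) \<open>0 < r\<close> by (auto simp: T_def)
      then have \<kappa>: "0 < \<kappa>" using max by (simp add: \<kappa>_def)
      have "\<forall>\<^sub>F k in sequentially. \<forall>y\<in>S. \<bar>G k y - F y\<bar> \<le> \<kappa> / 4" by (rule unif) (use \<kappa> in simp)
      moreover have "\<forall>\<^sub>F k in sequentially. \<tau> k < \<kappa> / 4" by (rule order_tendstoD(2)[OF \<tau>(2)]) (use \<kappa> in simp)
      ultimately show ?thesis using ev
      proof eventually_elim
        case (elim k)
        show ?case
        proof (rule ccontr)
          assume "\<not> dist (X k) x0 < r"
          then have "X k \<in> T" using X[of k] by (simp add: T_def dist_commute)
          then have "F (X k) \<le> F y1" by (rule y1)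
          moreover have "\<bar>G k (X k) - F (X k)\<bar> \<le> \<kappa> / 4" "\<bar>G k x0 - F x0\<bar> \<le> \<kappa> / 4"
            using elim(1) X[of k] x0 by blast+
          moreover have "G k x0 \<le> G k (X k) + \<tau> k" using elim(3) x0 by blast
          moreover have "F x0 = F y1 + \<kappa>" by (simp add: \<kappa>_def)
          ultimately show False using elim(2) \<kappa> unfolding abs_le_iff by linarith
        qed
      qed
    qed
  qed
  then show ?thesis using that X ev by blast
qed

text \<open>Bounds the second order expansion on a ball of radius \<open>e\<close> by its value in the gradient
  direction. The gain \<open>norm g * t\<^sup>2 / (2 * e)\<close> of the linear term for moving a distance \<open>t\<close> away from
  that direction absorbs the change of the quadratic term.\<close>

lemma quadratic_expansion_le:
  fixes g :: "real ^ 'n" and H :: "real ^ 'n ^ 'n"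
  assumes "g \<noteq> 0" "0 < e" "0 < B" and B: "\<And>w. norm (H *v w) \<le> B * norm w" and w: "norm w \<le> e"
  defines "m \<equiv> e *\<^sub>R sgn g"
  shows "g \<bullet> w + w \<bullet> (H *v w) / 2 \<le> norm g * e + m \<bullet> (H *v m) / 2 + B\<^sup>2 * e ^ 3 / (2 * norm g)"
proof -
  define t where "t = norm (w - m)"
  have m: "norm m = e" using assms by (simp add: m_def norm_sgn)
  have ng: "0 < norm g" using \<open>g \<noteq> 0\<close> by simp
  have gm: "norm g *\<^sub>R m = e *\<^sub>R g" using \<open>g \<noteq> 0\<close> by (simp add: m_def sgn_div_norm)
  have "t\<^sup>2 = (norm w)\<^sup>2 + e\<^sup>2 - 2 * (w \<bullet> m)"
    unfolding t_def m[symmetric] power2_norm_eq_inner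
    by (simp add: inner_diff_left inner_diff_right inner_commute)
  moreover have "(norm w)\<^sup>2 \<le> e\<^sup>2" using w by (intro power_mono) auto
  ultimately have "2 * (w \<bullet> m) \<le> 2 * e\<^sup>2 - t\<^sup>2" by linarith
  then have "norm g * (2 * (w \<bullet> m)) \<le> norm g * (2 * e\<^sup>2 - t\<^sup>2)" by (intro mult_left_mono) auto
  moreover have "norm g * (w \<bullet> m) = e * (g \<bullet> w)"
    using arg_cong[OF gm, of "\<lambda>z. z \<bullet> w"] by (simp add: inner_commute)
  ultimately have "2 * e * (g \<bullet> w) \<le> norm g * (2 * e\<^sup>2 - t\<^sup>2)" by (simp add: mult.commute mult.left_commute)
  then have lin: "g \<bullet> w \<le> norm g * e - norm g * t\<^sup>2 / (2 * e)"
    using \<open>0 < e\<close> by (simp add: field_simps power2_eq_square)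
  have "w \<bullet> (H *v w) - m \<bullet> (H *v m) = (w - m) \<bullet> (H *v w) + m \<bullet> (H *v (w - m))"
    by (simp add: inner_diff_left inner_diff_right matrix_vector_mult_diff_distrib)
  also have "(w - m) \<bullet> (H *v w) \<le> t * (B * e)"
  proof -
    have "(w - m) \<bullet> (H *v w) \<le> t * norm (H *v w)" unfolding t_def by (rule norm_cauchy_schwarz)
    also have "norm (H *v w) \<le> B * e" using B[of w] w \<open>0 < B\<close> by (smt (verit) mult_left_mono)
    finally show ?thesis by (simp add: t_def mult_left_mono)
  qed
  also have "m \<bullet> (H *v (w - m)) \<le> e * (B * t)"
  proof -
    have "m \<bullet> (H *v (w - m)) \<le> norm m * norm (H *v (w - m))" by (rule norm_cauchy_schwarz)
    also have "\<dots> \<le> e * (B * t)" using B[of "w - m"] \<open>0 < e\<close> by (simp add: m t_def)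
    finally show ?thesis .
  qed
  finally have quad: "w \<bullet> (H *v w) / 2 \<le> m \<bullet> (H *v m) / 2 + B * e * t" by (simp add: mult_ac)
  \<comment> \<open>Completing the square in \<open>t\<close>; the constant term is the error in the
    claim.\<close>
  have "0 \<le> norm g / (2 * e) * (t - B * e\<^sup>2 / norm g)\<^sup>2" using \<open>0 < e\<close> by simp
  also have "\<dots> = norm g * t\<^sup>2 / (2 * e) - B * e * t + B\<^sup>2 * e ^ 3 / (2 * norm g)"
    using ng \<open>0 < e\<close> by (simp add: field_simps eval_nat_numeral)
  finally show ?thesis using lin quad by linarith
qed

text \<open>Instantiated both with approximate solutions and with their negatives. Continuity is
  available for the limit \<open>u\<close> only. The inequality is required up to
  \<open>d * (e k)\<^sup>2 / 2\<close> for every \<open>d > 0\<close>, since the equation itself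
  lives at order \<open>(e k)\<^sup>2\<close>.\<close>

locale discrete_subsolution_limit =
  fixes \<Omega> :: "(real ^ 'n) set" and f u :: "real ^ 'n \<Rightarrow> real"
    and v :: "nat \<Rightarrow> real ^ 'n \<Rightarrow> real" and e :: "nat \<Rightarrow> real"
  assumes dom: "bounded_domain \<Omega>" and conv: "convex \<Omega>"
    and f: "continuous_on (closure \<Omega>) f" and u: "continuous_on (closure \<Omega>) u"
    and e_pos: "\<And>k. 0 < e k" and e_lim: "e \<longlonglongrightarrow> 0"
    and bdv: "\<And>k. bounded (v k ` closure \<Omega>)"
    and unif: "\<And>d. 0 < d \<Longrightarrow> \<forall>\<^sub>F k in sequentially. \<forall>x\<in>closure \<Omega>. \<bar>v k x - u x\<bar> \<le> d"
    and sub: "\<And>d. 0 < d \<Longrightarrow> \<forall>\<^sub>F k in sequentially. \<forall>x\<in>closure \<Omega>.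
      v k x \<le> minmax (closure \<Omega>) (e k) (v k) x + (e k)\<^sup>2 / 2 * (f x + d)"
begin

abbreviation "K \<equiv> closure \<Omega>"

lemma open_\<Omega>: "open \<Omega>" using dom by (simp add: bounded_domain_def)

lemma compact_K: "compact K" using dom by (rule compact_closure_domain)

lemma e_small: "0 < r \<Longrightarrow> \<forall>\<^sub>F k in sequentially. e k < r"
  using order_tendstoD(2)[OF e_lim] by simp

text \<open>Near \<open>X k\<close> the function \<open>v k\<close> lies below a translate of
  \<open>\<psi>\<close> up to \<open>(e k) ^ 3\<close>, so its discrete inequality passes to
  \<open>\<psi>\<close>; the error vanishes after division by \<open>(e k)\<^sup>2\<close>. The
  minimising move \<open>Y\<close> and the bound \<open>M\<close> stay free, to be chosen for each
  \<open>k\<close>.\<close>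

lemma contact_inequality:
  assumes x0: "x0 \<in> K" and "0 < \<rho>" and \<psi>: "continuous_on K \<psi>" and "0 < d"
    and touch: "\<And>y. y \<in> K \<Longrightarrow> dist x0 y \<le> \<rho> \<Longrightarrow> y \<noteq> x0 \<Longrightarrow> u y - \<psi> y < u x0 - \<psi> x0"
  obtains X where "\<And>k. X k \<in> K" "X \<longlonglongrightarrow> x0"
    "\<forall>\<^sub>F k in sequentially. \<forall>Y M. Y \<in> K \<and> dist (X k) Y \<le> e k \<and>
      (\<forall>y\<in>K. dist (X k) y \<le> e k \<longrightarrow> \<psi> y - \<psi> (X k) \<le> M) \<longrightarrow>
      0 \<le> (\<psi> Y - \<psi> (X k) + M) / 2 + (e k) ^ 3 + (e k)\<^sup>2 / 2 * (f (X k) + d)"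
proof -
  let ?S = "K \<inter> cball x0 \<rho>"
  have S: "compact ?S" by (intro compact_Int compact_K compact_cball)
  have x0S: "x0 \<in> ?S" using x0 \<open>0 < \<rho>\<close> by simp
  have cont: "continuous_on ?S (\<lambda>y. u y - \<psi> y)"
    using u \<psi> by (intro continuous_on_diff) (auto intro: continuous_on_subset)
  have max: "u y - \<psi> y < u x0 - \<psi> x0" if "y \<in> ?S" "y \<noteq> x0" for y using touch that by auto
  have un: "\<forall>\<^sub>F k in sequentially. \<forall>y\<in>?S. \<bar>(v k y - \<psi> y) - (u y - \<psi> y)\<bar> \<le> d'" if "0 < d'" for d'
    using unif[OF that] by eventually_elim auto
  have pos: "0 < (e k) ^ 3" for k using e_pos by simp
  have lim: "(\<lambda>k. (e k) ^ 3) \<longlonglongrightarrow> 0" using tendsto_power[OF e_lim, of 3] by simp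
  have "\<exists>X. (\<forall>k. X k \<in> ?S) \<and> X \<longlonglongrightarrow> x0 \<and>
      (\<forall>\<^sub>F k in sequentially. \<forall>y\<in>?S. v k y - \<psi> y \<le> v k (X k) - \<psi> (X k) + (e k) ^ 3)"
    by (rule near_maximum_points[of ?S x0 "\<lambda>y. u y - \<psi> y" "\<lambda>k y. v k y - \<psi> y" "\<lambda>k. (e k) ^ 3",
          OF S x0S cont max un pos lim]) blast+
  then obtain X where X: "\<And>k. X k \<in> ?S" "X \<longlonglongrightarrow> x0"
    "\<forall>\<^sub>F k in sequentially. \<forall>y\<in>?S. v k y - \<psi> y \<le> v k (X k) - \<psi> (X k) + (e k) ^ 3"
    by blast
  have "\<forall>\<^sub>F k in sequentially. dist (X k) x0 < \<rho> / 2"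
    by (rule tendstoD[OF X(2)]) (use \<open>0 < \<rho>\<close> in simp)
  moreover have "\<forall>\<^sub>F k in sequentially. e k < \<rho> / 2" by (rule e_small) (use \<open>0 < \<rho>\<close> in simp)
  ultimately have "\<forall>\<^sub>F k in sequentially. \<forall>Y M. Y \<in> K \<and> dist (X k) Y \<le> e k \<and>
      (\<forall>y\<in>K. dist (X k) y \<le> e k \<longrightarrow> \<psi> y - \<psi> (X k) \<le> M) \<longrightarrow>
      0 \<le> (\<psi> Y - \<psi> (X k) + M) / 2 + (e k) ^ 3 + (e k)\<^sup>2 / 2 * (f (X k) + d)"
    using X(3) sub[OF \<open>0 < d\<close>]
  proof eventually_elim
    case (elim k)
    show ?case
    proof (intro allI impI, elim conjE)
      fix Y M assume Y: "Y \<in> K" "dist (X k) Y \<le> e k"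
        and M: "\<forall>y\<in>K. dist (X k) y \<le> e k \<longrightarrow> \<psi> y - \<psi> (X k) \<le> M"
      have le: "v k y \<le> v k (X k) + (e k) ^ 3 + (\<psi> y - \<psi> (X k))" if "y \<in> K" "dist (X k) y \<le> e k" for y
      proof -
        have "dist x0 y \<le> \<rho>" using dist_triangle[of x0 y "X k"] elim(1,2) that by (simp add: dist_commute)
        then have "y \<in> ?S" using that by simp
        then have "v k y - \<psi> y \<le> v k (X k) - \<psi> (X k) + (e k) ^ 3" using elim(3) by blast
        then show ?thesis by linarith
      qed
      have XK: "X k \<in> K" using X(1) by blast
      have "v k y \<le> v k (X k) + (e k) ^ 3 + M" if "y \<in> K" "dist (X k) y \<le> e k" for y
        using le[OF that] M that by fastforce
      then have "minmax K (e k) (v k) (X k) \<le> (v k Y + (v k (X k) + (e k) ^ 3 + M)) / 2"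
        by (intro minmax_le bdv XK Y) auto
      moreover have "v k Y \<le> v k (X k) + (e k) ^ 3 + (\<psi> Y - \<psi> (X k))" using le Y by blast
      moreover have "v k (X k) \<le> minmax K (e k) (v k) (X k) + (e k)\<^sup>2 / 2 * (f (X k) + d)"
        using elim(4) XK by blast
      ultimately show "0 \<le> (\<psi> Y - \<psi> (X k) + M) / 2 + (e k) ^ 3 + (e k)\<^sup>2 / 2 * (f (X k) + d)"
        by argo
    qed
  qed
  then show ?thesis using that X by blast
qed

lemma f_lim: "(\<And>k. X k \<in> K) \<Longrightarrow> X \<longlonglongrightarrow> x0 \<Longrightarrow> x0 \<in> K \<Longrightarrow> (\<lambda>k. f (X k)) \<longlonglongrightarrow> f x0"
  by (rule continuous_on_tendsto_compose[OF f]) (simp_all add: always_eventually)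

text \<open>The minimising move is a step of length \<open>e k\<close> against the gradient, and the
  maximum is bounded by the expansion in the gradient direction. The first order terms cancel and
  the two second order terms add up. The boundary matters only for the minimising move, which has to
  stay in \<open>K\<close>: this is the role of \<open>s\<close>.\<close>

lemma contact_with_gradient:
  assumes x0: "x0 \<in> K" and "0 < \<rho>" and "p \<noteq> 0"
    and touch: "\<And>y. y \<in> K \<Longrightarrow> dist x0 y \<le> \<rho> \<Longrightarrow> y \<noteq> x0 \<Longrightarrow>
      u y < u x0 + p \<bullet> (y - x0) + (y - x0) \<bullet> (H *v (y - x0)) / 2"
    and s: "0 < s" "x0 - s *\<^sub>R sgn p \<in> \<Omega>"
  shows "- (sgn p \<bullet> (H *v sgn p)) \<le> f x0"
proof (rule field_le_epsilon)
  fix d :: real assume "0 < d"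
  define \<psi> where "\<psi> y = p \<bullet> (y - x0) + (y - x0) \<bullet> (H *v (y - x0)) / 2" for y
  have "continuous_on K \<psi>" unfolding \<psi>_def
    by (intro continuous_intros linear_continuous_on_compose[OF _ matrix_vector_mul_linear]) auto
  moreover have "u y - \<psi> y < u x0 - \<psi> x0" if "y \<in> K" "dist x0 y \<le> \<rho>" "y \<noteq> x0" for y
    using touch[OF that] by (simp add: \<psi>_def)
  ultimately obtain X where X: "\<And>k. X k \<in> K" "X \<longlonglongrightarrow> x0"
    and contact: "\<forall>\<^sub>F k in sequentially. \<forall>Y M. Y \<in> K \<and> dist (X k) Y \<le> e k \<and>
      (\<forall>y\<in>K. dist (X k) y \<le> e k \<longrightarrow> \<psi> y - \<psi> (X k) \<le> M) \<longrightarrow>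
      0 \<le> (\<psi> Y - \<psi> (X k) + M) / 2 + (e k) ^ 3 + (e k)\<^sup>2 / 2 * (f (X k) + d)"
    using contact_inequality[OF x0 \<open>0 < \<rho>\<close> _ \<open>0 < d\<close>, of \<psi>] by blast
  \<comment> \<open>The gradient of \<open>\<psi>\<close> at \<open>X k\<close>; the transpose
    appears because \<open>H\<close> is an arbitrary matrix.\<close>
  define g where "g k = p + (1/2) *\<^sub>R (H *v (X k - x0) + transpose H *v (X k - x0))" for k
  have expand: "\<psi> (X k + w) - \<psi> (X k) = g k \<bullet> w + w \<bullet> (H *v w) / 2" for k w
  proof -
    define h where "h = X k - x0"
    have "g k \<bullet> w = p \<bullet> w + ((H *v h) \<bullet> w + h \<bullet> (H *v w)) / 2"
      by (simp add: g_def inner_add_left dot_lmul_matrix flip: h_def)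
    moreover have "(H *v h) \<bullet> w = w \<bullet> (H *v h)" by (rule inner_commute)
    moreover have "(h + w) \<bullet> (H *v (h + w)) = h \<bullet> (H *v h) + h \<bullet> (H *v w) + w \<bullet> (H *v h) + w \<bullet> (H *v w)"
      by (simp add: inner_add_left inner_add_right matrix_vector_right_distrib)
    moreover have eq: "X k + w - x0 = h + w" by (simp add: h_def)
    ultimately show ?thesis
      unfolding \<psi>_def eq h_def[symmetric] inner_add_right[of p] by argo
  qed
  have X0: "(\<lambda>k. X k - x0) \<longlonglongrightarrow> 0" using X(2) LIM_zero by blast
  have mat0: "(\<lambda>k. A *v (X k - x0)) \<longlonglongrightarrow> 0" for A :: "real ^ 'n ^ 'n"
    using bounded_linear.tendsto[OF matrix_vector_mul_bounded_linear X0, of A] by simp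
  have g_lim: "g \<longlonglongrightarrow> p"
    unfolding g_def by (rule tendsto_eq_intros mat0 refl | simp)+
  have n_lim: "(\<lambda>k. sgn (g k)) \<longlonglongrightarrow> sgn p" using g_lim \<open>p \<noteq> 0\<close> by (rule tendsto_sgn)
  obtain B where B: "0 < B" "\<And>w. norm (H *v w) \<le> B * norm w"
    using bounded_linear.pos_bounded[OF matrix_vector_mul_bounded_linear[of H]] by (auto simp: mult.commute)
  have "(\<lambda>k. X k - s *\<^sub>R sgn (g k)) \<longlonglongrightarrow> x0 - s *\<^sub>R sgn p" by (intro tendsto_intros X n_lim)
  then have "\<forall>\<^sub>F k in sequentially. X k - s *\<^sub>R sgn (g k) \<in> \<Omega>"
    using open_\<Omega> s(2) topological_tendstoD by blast
  moreover have "\<forall>\<^sub>F k in sequentially. g k \<noteq> 0"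
    using g_lim \<open>p \<noteq> 0\<close> by (rule tendsto_imp_eventually_ne)
  moreover have "\<forall>\<^sub>F k in sequentially. e k < s" by (rule e_small) (rule s(1))
  ultimately have "\<forall>\<^sub>F k in sequentially.
      0 \<le> sgn (g k) \<bullet> (H *v sgn (g k)) + B\<^sup>2 * e k / (2 * norm (g k)) + 2 * e k + (f (X k) + d)"
    using contact
  proof eventually_elim
    case (elim k)
    define n where "n = sgn (g k)"
    define q where "q = n \<bullet> (H *v n)"
    have nn: "norm n = 1" using elim(2) by (simp add: n_def norm_sgn)
    have q: "(e k *\<^sub>R n) \<bullet> (H *v (e k *\<^sub>R n)) = (e k)\<^sup>2 * q"
      by (simp add: q_def matrix_vector_mult_scaleR power2_eq_square)
    \<comment> \<open>For large \<open>k\<close> the point at distance \<open>s\<close> lies in the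
      open set \<Omega>; the shorter step is a convex combination of it with
      \<open>X k\<close>.\<close>
    have Y: "X k - e k *\<^sub>R n \<in> K"
    proof -
      have "X k - e k *\<^sub>R n = (1 - e k / s) *\<^sub>R X k + (e k / s) *\<^sub>R (X k - s *\<^sub>R n)"
        using s(1) by (simp add: algebra_simps)
      also have "\<dots> \<in> K"
        using elim(1,3) e_pos[of k] s(1) X(1) closure_subset[of \<Omega>] convex_closure[OF conv]
        by (intro convexD) (auto simp: n_def)
      finally show ?thesis .
    qed
    have "g k \<bullet> n = norm (g k)" using elim(2) by (simp add: n_def sgn_div_norm power2_norm_eq_inner[symmetric] power2_eq_square)
    then have \<psi>Y: "\<psi> (X k - e k *\<^sub>R n) - \<psi> (X k) = - (norm (g k) * e k) + (e k)\<^sup>2 * q / 2"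
      using expand[of k "- (e k *\<^sub>R n)"] q by (simp add: linear_neg[OF matrix_vector_mul_linear])
    have M: "\<psi> y - \<psi> (X k) \<le> norm (g k) * e k + (e k)\<^sup>2 * q / 2 + B\<^sup>2 * (e k) ^ 3 / (2 * norm (g k))"
      if "dist (X k) y \<le> e k" for y
    proof -
      have "norm (y - X k) \<le> e k" using that by (simp add: dist_norm norm_minus_commute)
      from quadratic_expansion_le[OF elim(2) e_pos B this]
      show ?thesis using expand[of k "y - X k"] q by (simp add: n_def)
    qed
    have "dist (X k) (X k - e k *\<^sub>R n) \<le> e k" using nn e_pos[of k] by (simp add: dist_norm)
    then have "0 \<le> ((- (norm (g k) * e k) + (e k)\<^sup>2 * q / 2) +
        (norm (g k) * e k + (e k)\<^sup>2 * q / 2 + B\<^sup>2 * (e k) ^ 3 / (2 * norm (g k)))) / 2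
        + (e k) ^ 3 + (e k)\<^sup>2 / 2 * (f (X k) + d)"
      using elim(4) Y M \<psi>Y by metis
    also have "\<dots> = (e k)\<^sup>2 / 2 * (q + B\<^sup>2 * e k / (2 * norm (g k)) + 2 * e k + (f (X k) + d))"
      using elim(2) by (simp add: field_simps eval_nat_numeral)
    finally show ?case using e_pos[of k] by (simp add: zero_le_mult_iff q_def n_def)
  qed
  moreover have "(\<lambda>k. sgn (g k) \<bullet> (H *v sgn (g k)) + B\<^sup>2 * e k / (2 * norm (g k)) + 2 * e k + (f (X k) + d))
      \<longlonglongrightarrow> sgn p \<bullet> (H *v sgn p) + B\<^sup>2 * 0 / (2 * norm p) + 2 * 0 + (f x0 + d)"
    using \<open>p \<noteq> 0\<close>
    by (intro tendsto_intros n_lim g_lim e_lim f_lim X x0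
        bounded_linear.tendsto[OF matrix_vector_mul_bounded_linear]) auto
  ultimately have "0 \<le> sgn p \<bullet> (H *v sgn p) + B\<^sup>2 * 0 / (2 * norm p) + 2 * 0 + (f x0 + d)"
    by (intro tendsto_lowerbound) auto
  then show "- (sgn p \<bullet> (H *v sgn p)) \<le> f x0 + d" by simp
qed

text \<open>Although \<open>X k\<close> may differ from \<open>x0\<close>, moves along the line
  through both give \<open>(e k - t)\<^sup>2 + (e k + t)\<^sup>2 - 2 * t\<^sup>2 = 2 * (e
  k)\<^sup>2\<close>, independently of the distance \<open>t\<close>. The sign of \<open>a\<close>
  makes the outward end the largest value on the ball.\<close>

lemma contact_convex_paraboloid:
  assumes x0: "x0 \<in> \<Omega>" and "0 < \<rho>" and "0 \<le> a"
    and touch: "\<And>y. y \<in> K \<Longrightarrow> dist x0 y \<le> \<rho> \<Longrightarrow> y \<noteq> x0 \<Longrightarrow> u y < u x0 + a / 2 * (dist x0 y)\<^sup>2"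
  shows "- a \<le> f x0"
proof (rule field_le_epsilon)
  fix d :: real assume "0 < d"
  define \<psi> where "\<psi> y = a / 2 * (dist x0 y)\<^sup>2" for y
  have x0K: "x0 \<in> K" using x0 closure_subset by blast
  have "continuous_on K \<psi>" unfolding \<psi>_def by (intro continuous_intros)
  moreover have "u y - \<psi> y < u x0 - \<psi> x0" if "y \<in> K" "dist x0 y \<le> \<rho>" "y \<noteq> x0" for y
    using touch[OF that] by (simp add: \<psi>_def)
  ultimately obtain X where X: "\<And>k. X k \<in> K" "X \<longlonglongrightarrow> x0"
    and contact: "\<forall>\<^sub>F k in sequentially. \<forall>Y M. Y \<in> K \<and> dist (X k) Y \<le> e k \<and>
      (\<forall>y\<in>K. dist (X k) y \<le> e k \<longrightarrow> \<psi> y - \<psi> (X k) \<le> M) \<longrightarrow>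
      0 \<le> (\<psi> Y - \<psi> (X k) + M) / 2 + (e k) ^ 3 + (e k)\<^sup>2 / 2 * (f (X k) + d)"
    using contact_inequality[OF x0K \<open>0 < \<rho>\<close> _ \<open>0 < d\<close>, of \<psi>] by blast
  obtain r where r: "0 < r" "ball x0 r \<subseteq> \<Omega>" using open_\<Omega> x0 open_contains_ball by blast
  have "\<forall>\<^sub>F k in sequentially. dist (X k) x0 < r / 2"
    by (rule tendstoD[OF X(2)]) (use r in simp)
  moreover have "\<forall>\<^sub>F k in sequentially. e k < r / 2" by (rule e_small) (use r in simp)
  ultimately have "\<forall>\<^sub>F k in sequentially. 0 \<le> a + 2 * e k + (f (X k) + d)"
    using contact
  proof eventually_elim
    case (elim k)
    define t where "t = dist x0 (X k)"
    \<comment> \<open>The direction from \<open>x0\<close> to \<open>X k\<close>, and an arbitrary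
      unit vector if the two coincide.\<close>
    obtain E where E: "norm E = 1" "X k - x0 = t *\<^sub>R E"
    proof (cases "X k = x0")
      case True
      obtain E :: "real ^ 'n" where "norm E = 1" using vector_choose_size[of 1] by auto
      then show ?thesis using that True by (simp add: t_def)
    next
      case False
      then show ?thesis using that[of "sgn (X k - x0)"]
        by (simp add: norm_sgn t_def dist_norm norm_minus_commute sgn_div_norm)
    qed
    define Y where "Y = X k - e k *\<^sub>R E"
    have dY: "dist (X k) Y = e k" using E(1) e_pos[of k] by (simp add: Y_def dist_norm)
    have "x0 - Y = (e k - t) *\<^sub>R E" using E(2) by (simp add: Y_def algebra_simps)
    then have "(dist x0 Y)\<^sup>2 = (e k - t)\<^sup>2" using E(1) by (simp add: dist_norm)
    then have \<psi>Y: "\<psi> Y - \<psi> (X k) = a / 2 * ((e k - t)\<^sup>2 - t\<^sup>2)" by (simp add: \<psi>_def t_def right_diff_distrib)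
    have "dist x0 Y < r" using dist_triangle[of x0 Y "X k"] elim(1,2) dY by (simp add: dist_commute)
    then have "Y \<in> K" using r(2) closure_subset[of \<Omega>] by auto
    have "\<psi> y - \<psi> (X k) \<le> a / 2 * ((e k + t)\<^sup>2 - t\<^sup>2)" if "dist (X k) y \<le> e k" for y
    proof -
      have "dist x0 y \<le> e k + t" using that dist_triangle[of x0 y "X k"] by (simp add: t_def)
      then have "a / 2 * (dist x0 y)\<^sup>2 \<le> a / 2 * (e k + t)\<^sup>2"
        using \<open>0 \<le> a\<close> by (intro mult_left_mono power_mono) auto
      then show ?thesis by (simp add: \<psi>_def t_def right_diff_distrib)
    qed
    then have "0 \<le> (a / 2 * ((e k - t)\<^sup>2 - t\<^sup>2) + a / 2 * ((e k + t)\<^sup>2 - t\<^sup>2)) / 2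
        + (e k) ^ 3 + (e k)\<^sup>2 / 2 * (f (X k) + d)"
      using elim(3) \<open>Y \<in> K\<close> dY \<psi>Y by (metis order_refl)
    also have "\<dots> = (e k)\<^sup>2 / 2 * (a + 2 * e k + (f (X k) + d))"
      by (simp add: field_simps eval_nat_numeral)
    finally show ?case using e_pos[of k] by (simp add: zero_le_mult_iff)
  qed
  moreover have "(\<lambda>k. a + 2 * e k + (f (X k) + d)) \<longlonglongrightarrow> a + 2 * 0 + (f x0 + d)"
    by (intro tendsto_intros e_lim f_lim X x0K)
  ultimately have "0 \<le> a + 2 * 0 + (f x0 + d)"
    by (intro tendsto_lowerbound) auto
  then show "- a \<le> f x0 + d" by simp
qed

text \<open>If \<open>f x0 < \<alpha>\<close>, a quadratic cone of curvature \<open>c < \<alpha>\<close> with vertex \<open>z\<close> close to \<open>x0\<close> that attains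
  the value \<open>u x0\<close> at its peak has a peak radius \<open>P > dist z x0\<close>, so that comparison with this cone
  contradicts its value at \<open>x0\<close>. Testing at near-maximum points as in the other cases would only
  give \<open>\<alpha> / 2 \<le> f x0\<close>.\<close>

lemma contact_concave_paraboloid:
  assumes x0: "x0 \<in> \<Omega>" and "0 < \<rho>" and "0 < \<alpha>"
    and touch: "\<And>y. y \<in> K \<Longrightarrow> dist x0 y \<le> \<rho> \<Longrightarrow> u y \<le> u x0 - \<alpha> / 2 * (dist x0 y)\<^sup>2"
  shows "\<alpha> \<le> f x0"
proof (rule ccontr)
  assume "\<not> \<alpha> \<le> f x0"
  have x0K: "x0 \<in> K" using x0 closure_subset by blast
  \<comment> \<open>The gap from \<open>m\<close> to \<alpha> is cut into quarters: one for the
    variation of \<open>f\<close> near \<open>x0\<close>, one for the tolerance in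
    \<open>sub\<close>, one for the strict inequality between right-hand side and curvature, and one
    to keep \<open>c < \<alpha>\<close>. The maximum with 0 ensures \<open>0 < c\<close>.\<close>
  define m where "m = max (f x0) 0"
  define \<delta> where "\<delta> = (\<alpha> - m) / 4"
  have \<delta>: "0 < \<delta>" using \<open>\<not> \<alpha> \<le> f x0\<close> \<open>0 < \<alpha>\<close> by (simp add: \<delta>_def m_def)
  define c where "c = m + 3 * \<delta>"
  have "4 * \<delta> = \<alpha> - m" "0 \<le> m" by (simp_all add: \<delta>_def m_def)
  then have c: "0 < c" "c < \<alpha>" using \<delta> unfolding c_def by linarith+
  obtain \<rho>1 where \<rho>1: "0 < \<rho>1" "\<And>y. y \<in> K \<Longrightarrow> dist y x0 < \<rho>1 \<Longrightarrow> dist (f y) (f x0) < \<delta>"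
    using f x0K \<delta> unfolding continuous_on_iff by blast
  obtain \<rho>2 where \<rho>2: "0 < \<rho>2" "ball x0 \<rho>2 \<subseteq> \<Omega>" using open_\<Omega> x0 open_contains_ball by blast
  \<comment> \<open>The comparison reaches at most \<open>R + P + e k\<close> from
    \<open>x0\<close>, which is less than \<open>3 * r\<close>.\<close>
  define r where "r = min \<rho> (min \<rho>1 \<rho>2) / 4"
  have r: "0 < r" using \<open>0 < \<rho>\<close> \<rho>1 \<rho>2 by (simp add: r_def)
  have r4: "4 * r \<le> \<rho>" "4 * r \<le> \<rho>1" "4 * r \<le> \<rho>2" by (auto simp: r_def)
  have "0 < c * r\<^sup>2 / 2" using c r by simp
  then obtain \<rho>3 where \<rho>3: "0 < \<rho>3" "\<And>y. y \<in> K \<Longrightarrow> dist y x0 < \<rho>3 \<Longrightarrow> dist (u y) (u x0) < c * r\<^sup>2 / 2"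
    using u x0K unfolding continuous_on_iff by blast
  define R where "R = min r (\<rho>3 / 2)"
  have R: "0 < R" "R \<le> r" "R < \<rho>3" using r \<rho>3 by (auto simp: R_def)
  obtain E :: "real ^ 'n" where E: "norm E = 1" using vector_choose_size[of 1] by auto
  define z where "z = x0 + R *\<^sub>R E"
  have dz: "dist x0 z = R" "dist z x0 = R" using E R by (simp_all add: z_def dist_norm)
  then have "z \<in> ball x0 \<rho>2" using R r r4 by simp
  then have zK: "z \<in> K" using \<rho>2 closure_subset by blast
  define h where "h = u x0 - u z"
  have h1: "\<alpha> / 2 * R\<^sup>2 \<le> h" using touch[OF zK] dz R r r4 by (simp add: h_def)
  have "dist (u z) (u x0) < c * r\<^sup>2 / 2" using \<rho>3(2)[OF zK] dz R by simp
  then have h2: "h < c * r\<^sup>2 / 2" unfolding h_def dist_real_def by linarith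
  have "0 < \<alpha> / 2 * R\<^sup>2" using \<open>0 < \<alpha>\<close> R by simp
  then have h0: "0 < h" using h1 by linarith
  \<comment> \<open>The peak radius of the cone of curvature \<open>c\<close> that climbs from
    \<open>u z\<close> to \<open>u x0\<close>. It exceeds \<open>R\<close> because
    \<open>c < \<alpha>\<close>, and it is below \<open>r\<close> because \<open>h\<close> is
    small.\<close>
  define P where "P = sqrt (2 * h / c)"
  have P2: "c * P\<^sup>2 = 2 * h" using c h0 by (simp add: P_def)
  have P0: "0 < P" using c h0 by (simp add: P_def)
  have "c * R\<^sup>2 < \<alpha> * R\<^sup>2" using c R by simp
  then have "c * R\<^sup>2 < c * P\<^sup>2" using P2 h1 by simp
  then have "R\<^sup>2 < P\<^sup>2" using c by simp
  then have RP: "R < P" by (rule power2_less_imp_less) (use P0 in simp)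
  have "c * P\<^sup>2 < c * r\<^sup>2" using P2 h2 by simp
  then have "P\<^sup>2 < r\<^sup>2" using c by simp
  then have Pr: "P < r" by (rule power2_less_imp_less) (use r in simp)
  \<comment> \<open>The amount by which this cone is below its peak at radius \<open>R\<close>, that
    is, at \<open>x0\<close>.\<close>
  define \<kappa> where "\<kappa> = c * (P - R)\<^sup>2 / 2"
  have \<kappa>: "0 < \<kappa>" using c RP by (simp add: \<kappa>_def)
  have "(\<lambda>k. c * e k * R + c * (P + e k) * e k + 2 * c * (e k)\<^sup>2) \<longlonglongrightarrow> c * 0 * R + c * (P + 0) * 0 + 2 * c * 0\<^sup>2"
    by (intro tendsto_intros e_lim)
  then have small: "\<forall>\<^sub>F k in sequentially. c * e k * R + c * (P + e k) * e k + 2 * c * (e k)\<^sup>2 < \<kappa> / 2"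
    by (rule order_tendstoD(2)) (use \<kappa> in simp)
  have "\<forall>\<^sub>F k in sequentially. e k < r" by (rule e_small) (use r in simp)
  moreover have "\<forall>\<^sub>F k in sequentially. \<forall>x\<in>K. \<bar>v k x - u x\<bar> \<le> \<kappa> / 8" by (rule unif) (use \<kappa> in simp)
  ultimately have "\<forall>\<^sub>F k in sequentially. False"
    using small sub[OF \<delta>]
  proof eventually_elim
    case (elim k)
    \<comment> \<open>The slope is \<open>c * (P + ?e)\<close> rather than \<open>c * P\<close> so
      that the discrete cone still increases up to \<open>P + ?e\<close>. The last summand of
      \<open>?A\<close> pays for exchanging \<open>v k\<close> and \<open>u\<close> at two
      points.\<close>
    let ?e = "e k"
    let ?b = "c * (P + ?e)" and ?A = "c * (P + ?e) * ?e + 2 * c * ?e\<^sup>2 + 2 * (\<kappa> / 8)"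
    have "v k x0 \<le> v k z + (?b * dist z x0 - c / 2 * (dist z x0)\<^sup>2) + ?A"
    proof (rule discrete_cone_comparison[where K=K and e="?e" and P=P and C="m + 2 * \<delta>"])
      show "v k y \<le> minmax K ?e (v k) y + ?e\<^sup>2 / 2 * (m + 2 * \<delta>)" if y: "y \<in> K" "dist z y \<le> P" for y
      proof -
        have "dist y x0 < \<rho>1" using dist_triangle[of y x0 z] y dz R Pr r r4 by (simp add: dist_commute)
        then have "dist (f y) (f x0) < \<delta>" using \<rho>1(2)[OF y(1)] by blast
        moreover have "f x0 \<le> m" by (simp add: m_def)
        ultimately have "f y \<le> m + \<delta>" unfolding dist_real_def by linarith
        then have "?e\<^sup>2 / 2 * (f y + \<delta>) \<le> ?e\<^sup>2 / 2 * (m + 2 * \<delta>)" by (intro mult_left_mono) auto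
        then show ?thesis using elim(4) y(1) by fastforce
      qed
      show "v k y \<le> v k z + (?b * dist z y - c / 2 * (dist z y)\<^sup>2) + ?A"
        if y: "y \<in> K" "P < dist z y" "dist z y \<le> P + ?e" for y
      proof -
        let ?t = "dist z y"
        have "dist x0 y \<le> \<rho>" using dist_triangle[of x0 y z] y dz R Pr r r4 elim(1) by simp
        then have "u y \<le> u x0 - \<alpha> / 2 * (dist x0 y)\<^sup>2" using touch y by blast
        moreover have "0 \<le> \<alpha> / 2 * (dist x0 y)\<^sup>2" using \<open>0 < \<alpha>\<close> by simp
        ultimately have "u y \<le> u z + h" by (simp add: h_def)
        moreover have "\<bar>v k y - u y\<bar> \<le> \<kappa> / 8" "\<bar>v k z - u z\<bar> \<le> \<kappa> / 8" using elim(2) y zK by auto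
        ultimately have "v k y \<le> v k z + h + 2 * (\<kappa> / 8)" by linarith
        moreover have "h \<le> ?b * ?t - c / 2 * ?t\<^sup>2"
        proof -
          have "P * (P / 2) \<le> ?t * (P + ?e - ?t / 2)"
            using y P0 e_pos[of k] by (intro mult_mono) auto
          then have "c * (P * (P / 2)) \<le> c * (?t * (P + ?e - ?t / 2))" using c by (intro mult_left_mono) auto
          then show ?thesis using P2 by (simp add: field_simps power2_eq_square)
        qed
        moreover have "0 \<le> ?b * ?e + 2 * c * ?e\<^sup>2" using c P0 e_pos[of k] by simp
        ultimately show ?thesis by linarith
      qed
    qed (use convex_closure[OF conv] bdv zK e_pos P0 c \<delta> x0K dz RP \<kappa> in \<open>auto simp: c_def\<close>)
    moreover have "\<bar>v k x0 - u x0\<bar> \<le> \<kappa> / 8" "\<bar>v k z - u z\<bar> \<le> \<kappa> / 8" using elim(2) x0K zK by auto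
    ultimately have "h \<le> (?b * R - c / 2 * R\<^sup>2) + ?A + 2 * (\<kappa> / 8)"
      unfolding h_def dz abs_le_iff by argo
    also have "\<dots> = c * P * R - c / 2 * R\<^sup>2 + \<kappa> / 2 + (c * ?e * R + c * (P + ?e) * ?e + 2 * c * ?e\<^sup>2)"
      by (simp add: algebra_simps)
    also have "\<dots> < c * P * R - c / 2 * R\<^sup>2 + \<kappa>" using elim(3) by linarith
    also have "\<dots> = c * P\<^sup>2 / 2" by (simp add: \<kappa>_def field_simps power2_eq_square)
    finally show False using P2 by simp
  qed
  then show False by simp
qed

end

section \<open>From quadratic to smooth test functions, and the limit of discrete solutions\<close>

lemma sum_matrix_quadratic_form:
  fixes H :: "real ^ 'n ^ 'n"
  shows "(\<Sum>i\<in>UNIV. \<Sum>j\<in>UNIV. H $ i $ j * w $ i * w $ j) = w \<bullet> (H *v w)"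
  by (simp add: inner_vec_def matrix_vector_mult_def sum_distrib_left mult_ac)

lemma infinity_laplacian_plus_gradient:
  assumes "grad \<phi> x \<noteq> 0"
  shows "infinity_laplacian_plus \<phi> x = sgn (grad \<phi> x) \<bullet> (hessian \<phi> x *v sgn (grad \<phi> x))"
proof -
  have "(\<Sum>i\<in>UNIV. \<Sum>j\<in>UNIV. grad \<phi> x $ i * hessian \<phi> x $ i $ j * grad \<phi> x $ j)
      = grad \<phi> x \<bullet> (hessian \<phi> x *v grad \<phi> x)"
    unfolding sum_matrix_quadratic_form[symmetric] by (intro sum.cong refl) (simp only: mult_ac)
  then show ?thesis
    using assms by (simp add: infinity_laplacian_plus_def sgn_div_norm matrix_vector_mult_scaleR
        power2_eq_square field_simps)
qed

lemma quadratic_form_le_infinity_laplacian_plus: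
  fixes \<phi> :: "real ^ 'n \<Rightarrow> real"
  assumes "grad \<phi> x = 0"
  shows "h \<bullet> (hessian \<phi> x *v h) \<le> infinity_laplacian_plus \<phi> x * (norm h)\<^sup>2"
proof (cases "h = 0")
  case False
  let ?H = "hessian \<phi> x" and ?S = "{w :: real ^ 'n. norm w = 1}"
  have L: "infinity_laplacian_plus \<phi> x = (SUP w\<in>?S. w \<bullet> (?H *v w))"
    using assms by (simp add: infinity_laplacian_plus_def sum_matrix_quadratic_form)
  obtain B where B: "\<And>w. norm (?H *v w) \<le> norm w * B"
    using bounded_linear.bounded[OF matrix_vector_mul_bounded_linear[of ?H]] by blast
  have "w \<bullet> (?H *v w) \<le> B" if "w \<in> ?S" for w
    using norm_cauchy_schwarz[of w "?H *v w"] B[of w] that by simp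
  then have "bdd_above ((\<lambda>w. w \<bullet> (?H *v w)) ` ?S)" by fast
  moreover have "sgn h \<in> ?S" using False by (simp add: norm_sgn)
  ultimately have "sgn h \<bullet> (?H *v sgn h) \<le> infinity_laplacian_plus \<phi> x"
    unfolding L by (rule cSUP_upper[rotated])
  then have "(norm h)\<^sup>2 * (sgn h \<bullet> (?H *v sgn h)) \<le> (norm h)\<^sup>2 * infinity_laplacian_plus \<phi> x"
    by (intro mult_left_mono) auto
  moreover have "(norm h)\<^sup>2 * (sgn h \<bullet> (?H *v sgn h)) = h \<bullet> (?H *v h)"
    using False by (simp add: sgn_div_norm matrix_vector_mult_scaleR power2_eq_square field_simps)
  ultimately show ?thesis by (simp add: mult.commute)
qed simp

text \<open>A smooth test function is replaced by its second order expansion with a slightly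
  enlarged quadratic part. With nonzero gradient, the failed Neumann alternative makes the downhill
  direction lead into \<Omega>. With zero gradient, the form is bounded by a multiple of the squared
  distance, whose sign decides between the two paraboloid cases.\<close>

lemma (in discrete_subsolution_limit) limit_viscosity_subsolution:
  assumes bd: "C1_boundary \<Omega>"
  shows "viscosity_subsolution \<Omega> f u"
  unfolding viscosity_subsolution_def
proof (intro conjI u allI impI, elim conjE, rule ccontr)
  fix \<phi> x0 assume "smooth_on_closure \<Omega> \<phi>" and x0: "x0 \<in> K"
    and strict: "strict_local_max_on K (\<lambda>y. u y - \<phi> y) x0"
    and neg: "\<not> (- infinity_laplacian_plus \<phi> x0 \<le> f x0 \<or>
      x0 \<in> frontier \<Omega> \<and> frechet_derivative \<phi> (at x0) (outward_normal \<Omega> x0) \<le> 0)"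
  let ?\<Lambda> = "infinity_laplacian_plus \<phi> x0"
  \<comment> \<open>The gap in the violated inequality. The remainder \<open>\<theta> / 4\<close>
    per squared length raises the second derivatives by \<open>\<theta> / 2\<close>, so half of the
    gap is left.\<close>
  define \<theta> where "\<theta> = - ?\<Lambda> - f x0"
  have \<theta>: "0 < \<theta>" using neg by (simp add: \<theta>_def)
  obtain U where U: "open U" "K \<subseteq> U" "\<And>k. Ck_on k \<phi> U"
    using \<open>smooth_on_closure \<Omega> \<phi>\<close> unfolding smooth_on_closure_def by blast
  have x0U: "x0 \<in> U" using U x0 by blast
  then have "\<phi> differentiable (at x0)" using U(3)[of "Suc 0"] by simp
  define p where "p = grad \<phi> x0"
  define H where "H = hessian \<phi> x0"
  have normal: "0 < p \<bullet> outward_normal \<Omega> x0" if "x0 \<in> frontier \<Omega>"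
    using neg that frechet_derivative_eq_grad[OF \<open>\<phi> differentiable (at x0)\<close>] by (simp add: p_def)
  obtain r where r: "0 < r" "\<And>y. y \<in> K \<Longrightarrow> y \<noteq> x0 \<Longrightarrow> dist y x0 < r \<Longrightarrow> u y - \<phi> y < u x0 - \<phi> x0"
    using strict unfolding strict_local_max_on_def eventually_at by blast
  obtain \<delta> where \<delta>: "0 < \<delta>" "\<And>h. norm h < \<delta> \<Longrightarrow>
    \<phi> (x0 + h) \<le> \<phi> x0 + p \<bullet> h + h \<bullet> (H *v h) / 2 + \<theta> / 4 * (norm h)\<^sup>2"
    using second_order_taylor_upper[OF U(1) x0U U(3), of "\<theta> / 4"] \<theta> unfolding p_def H_def
    by (metis divide_pos_pos zero_less_numeral)
  define \<rho> where "\<rho> = min r \<delta> / 2"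
  have \<rho>: "0 < \<rho>" using r \<delta> by (simp add: \<rho>_def)
  have touch: "u y < u x0 + p \<bullet> (y - x0) + (y - x0) \<bullet> (H *v (y - x0)) / 2 + \<theta> / 4 * (dist x0 y)\<^sup>2"
    if "y \<in> K" "dist x0 y \<le> \<rho>" "y \<noteq> x0" for y
  proof -
    have d: "dist x0 y < r" "dist x0 y < \<delta>" using that(2) r(1) \<delta>(1) unfolding \<rho>_def by auto
    then have "u y - \<phi> y < u x0 - \<phi> x0" using r(2) that by (simp add: dist_commute)
    moreover have n: "norm (y - x0) = dist x0 y" by (simp add: dist_norm norm_minus_commute)
    have "\<phi> y \<le> \<phi> x0 + p \<bullet> (y - x0) + (y - x0) \<bullet> (H *v (y - x0)) / 2 + \<theta> / 4 * (dist x0 y)\<^sup>2"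
      using \<delta>(2)[of "y - x0"] d n by simp
    ultimately show ?thesis by linarith
  qed
  show False
  proof (cases "p = 0")
    case False
    define H' where "H' = H + (\<theta> / 2) *\<^sub>R mat 1"
    have H': "H' *v h = H *v h + (\<theta> / 2) *\<^sub>R h" for h
      by (simp add: H'_def matrix_vector_mult_add_rdistrib scaleR_matrix_vector_assoc[symmetric])
    have "\<exists>s>0. x0 - s *\<^sub>R sgn p \<in> \<Omega>"
    proof (cases "x0 \<in> \<Omega>")
      case True
      then obtain r' where r': "0 < r'" "cball x0 r' \<subseteq> \<Omega>" using open_\<Omega> open_contains_cball by blast
      have "x0 - r' *\<^sub>R sgn p \<in> cball x0 r'" using r'(1) False by (simp add: dist_norm norm_sgn)
      then show ?thesis using r' by blast
    next
      case out: False
      then have fr: "x0 \<in> frontier \<Omega>" using x0 open_\<Omega> by (simp add: frontier_def interior_open)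
      have "0 < sgn p \<bullet> outward_normal \<Omega> x0" using normal[OF fr] False by (simp add: sgn_div_norm)
      then show ?thesis using inward_normal_direction[OF open_\<Omega> bd fr] by blast
    qed
    then obtain s where s: "0 < s" "x0 - s *\<^sub>R sgn p \<in> \<Omega>" by blast
    have "- (sgn p \<bullet> (H' *v sgn p)) \<le> f x0"
    proof (rule contact_with_gradient[OF x0 \<rho> False _ s])
      fix y assume y: "y \<in> K" "dist x0 y \<le> \<rho>" "y \<noteq> x0"
      have "(dist x0 y)\<^sup>2 = (y - x0) \<bullet> (y - x0)"
        by (metis dist_commute dist_norm power2_norm_eq_inner)
      then show "u y < u x0 + p \<bullet> (y - x0) + (y - x0) \<bullet> (H' *v (y - x0)) / 2"
        using touch[OF y] by (simp add: H' inner_add_right add_divide_distrib)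
    qed
    moreover have "sgn p \<bullet> (H' *v sgn p) = ?\<Lambda> + \<theta> / 2"
    proof -
      have "?\<Lambda> = sgn p \<bullet> (H *v sgn p)"
        using infinity_laplacian_plus_gradient[of \<phi> x0] False by (simp add: p_def H_def)
      moreover have "sgn p \<bullet> sgn p = 1" using False by (simp add: norm_sgn flip: norm_eq_1)
      ultimately show ?thesis by (simp add: H' inner_add_right)
    qed
    ultimately show False using \<theta> unfolding \<theta>_def by argo
  next
    case True
    \<comment> \<open>With zero gradient the normal derivative is 0 and the Neumann alternative
      would hold on the frontier.\<close>
    then have "x0 \<notin> frontier \<Omega>" using normal by auto
    then have x0\<Omega>: "x0 \<in> \<Omega>" using x0 open_\<Omega> by (simp add: frontier_def interior_open)
    define a where "a = ?\<Lambda> + \<theta> / 2"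
    have "- a - f x0 = \<theta> / 2" by (simp add: a_def \<theta>_def field_simps)
    then have fa: "f x0 < - a" using \<theta> by linarith
    have touch': "u y < u x0 + a / 2 * (dist x0 y)\<^sup>2" if "y \<in> K" "dist x0 y \<le> \<rho>" "y \<noteq> x0" for y
    proof -
      have "(y - x0) \<bullet> (H *v (y - x0)) \<le> ?\<Lambda> * (dist x0 y)\<^sup>2"
        using quadratic_form_le_infinity_laplacian_plus[of \<phi> x0 "y - x0"] True
        by (simp add: p_def H_def dist_norm norm_minus_commute)
      moreover have "a / 2 * (dist x0 y)\<^sup>2 = ?\<Lambda> * (dist x0 y)\<^sup>2 / 2 + \<theta> / 4 * (dist x0 y)\<^sup>2"
        by (simp add: a_def field_simps)
      moreover have "u y < u x0 + (y - x0) \<bullet> (H *v (y - x0)) / 2 + \<theta> / 4 * (dist x0 y)\<^sup>2"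
        using touch[OF that] True by simp
      ultimately show ?thesis by argo
    qed
    show False
    proof (cases "0 \<le> a")
      case True
      then have "- a \<le> f x0" using contact_convex_paraboloid[OF x0\<Omega> \<rho>] touch' by blast
      then show False using fa by simp
    next
      case False
      have "- a \<le> f x0"
      proof (rule contact_concave_paraboloid[OF x0\<Omega> \<rho>])
        fix y assume "y \<in> K" "dist x0 y \<le> \<rho>"
        then show "u y \<le> u x0 - - a / 2 * (dist x0 y)\<^sup>2" using touch'[of y] by (cases "y = x0") auto
      qed (use False in simp)
      then show False using fa by simp
    qed
  qed
qed

text \<open>The functions \<open>V n\<close> need not be equicontinuous, but their inf-convolutions are Lipschitz and
  uniformly close to them.\<close>

lemma Arzela_Ascoli_large_scale_lipschitz:
  fixes V :: "nat \<Rightarrow> 'a::euclidean_space \<Rightarrow> real"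
  assumes K: "compact K" "K \<noteq> {}" and "0 \<le> L" "0 \<le> A"
    and N: "\<And>n x. x \<in> K \<Longrightarrow> \<bar>V n x\<bar> \<le> N"
    and lip: "\<And>n x y. x \<in> K \<Longrightarrow> y \<in> K \<Longrightarrow> V n x - V n y \<le> L * dist y x + A * e n"
    and e: "\<And>n. 0 < e n" "\<And>n. e n \<le> 1" "e \<longlonglongrightarrow> 0"
  shows "\<exists>g s. continuous_on K g \<and> strict_mono (s :: nat \<Rightarrow> nat) \<and>
    (\<forall>d>0. \<forall>\<^sub>F n in sequentially. \<forall>x\<in>K. \<bar>V (s n) x - g x\<bar> \<le> d)"
proof -
  define W where "W n x = (INF y\<in>K. V n y + L * dist y x)" for n x
  have bdd: "bdd_below ((\<lambda>y. V n y + L * dist y x) ` K)" for n x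
  proof (rule bdd_belowI2)
    fix y assume "y \<in> K"
    then show "- N \<le> V n y + L * dist y x"
      using N[of y n] mult_nonneg_nonneg[OF \<open>0 \<le> L\<close> zero_le_dist[of y x]] by linarith
  qed
  have W_le: "W n x \<le> V n y + L * dist y x" if "y \<in> K" for n x y
    unfolding W_def by (rule cINF_lower[OF bdd that])
  have W1: "W n x \<le> V n x" if "x \<in> K" for n x using W_le[OF that, of n x] by simp
  have W2: "V n x - A * e n \<le> W n x" if x: "x \<in> K" for n x
    unfolding W_def
  proof (rule cINF_greatest[OF K(2)])
    fix y assume "y \<in> K"
    then show "V n x - A * e n \<le> V n y + L * dist y x" using lip[OF x, of y n] by linarith
  qed
  have Ae: "A * e n \<le> A" for n using e(2)[of n] \<open>0 \<le> A\<close> by (simp add: mult_left_le)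
  have WN: "norm (W n x) \<le> N + A" if "x \<in> K" for n x
    using W1[OF that, of n] W2[OF that, of n] N[OF that, of n] Ae[of n] by simp
  have Wlip: "W n x \<le> W n x' + L * dist x x'" for n x x'
  proof -
    have "W n x - L * dist x x' \<le> W n x'"
      unfolding W_def[of n x']
    proof (rule cINF_greatest[OF K(2)])
      fix y assume "y \<in> K"
      have "L * dist y x \<le> L * (dist y x' + dist x x')"
        using \<open>0 \<le> L\<close> dist_triangle[of y x x'] by (intro mult_left_mono) (auto simp: dist_commute)
      then show "W n x - L * dist x x' \<le> V n y + L * dist y x'"
        using W_le[OF \<open>y \<in> K\<close>, of n x] by (simp add: distrib_left)
    qed
    then show ?thesis by simp
  qed
  have equi: "\<exists>d>0. \<forall>n y. y \<in> K \<and> norm (x - y) < d \<longrightarrow> norm (W n x - W n y) < \<epsilon>" if "0 < \<epsilon>" for x \<epsilon>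
  proof (intro exI[of _ "\<epsilon> / (L + 1)"] conjI allI impI)
    show "0 < \<epsilon> / (L + 1)" using that \<open>0 \<le> L\<close> by simp
    fix n y assume "y \<in> K \<and> norm (x - y) < \<epsilon> / (L + 1)"
    then have "(L + 1) * dist x y < \<epsilon>" using \<open>0 \<le> L\<close> by (simp add: dist_norm field_simps)
    moreover have "L * dist x y \<le> (L + 1) * dist x y" by (simp add: distrib_right)
    ultimately have "L * dist x y < \<epsilon>" by linarith
    then show "norm (W n x - W n y) < \<epsilon>"
      using Wlip[of n x y] Wlip[of n y x] by (simp add: dist_commute abs_less_iff)
  qed
  obtain g s where g: "continuous_on K g" "strict_mono (s :: nat \<Rightarrow> nat)"
    and lim: "\<And>\<epsilon>. 0 < \<epsilon> \<Longrightarrow> \<exists>N. \<forall>n x. n \<ge> N \<and> x \<in> K \<longrightarrow> norm (W (s n) x - g x) < \<epsilon>"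
    using Arzela_Ascoli[OF K(1) WN equi] by metis
  show ?thesis
  proof (intro exI[of _ g] exI[of _ s] conjI g allI impI)
    fix d :: real assume "0 < d"
    then obtain n0 where n0: "\<And>n x. n \<ge> n0 \<Longrightarrow> x \<in> K \<Longrightarrow> \<bar>W (s n) x - g x\<bar> < d / 2"
      using lim[of "d / 2"] by auto
    have "(\<lambda>n. A * e (s n)) \<longlonglongrightarrow> A * 0"
      using LIMSEQ_subseq_LIMSEQ[OF e(3) g(2)] by (intro tendsto_intros) (simp add: o_def)
    then have "\<forall>\<^sub>F n in sequentially. A * e (s n) < d / 2"
      by (rule order_tendstoD(2)) (use \<open>0 < d\<close> in simp)
    moreover have "\<forall>\<^sub>F n in sequentially. n \<ge> n0" by (rule eventually_ge_at_top)
    ultimately show "\<forall>\<^sub>F n in sequentially. \<forall>x\<in>K. \<bar>V (s n) x - g x\<bar> \<le> d"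
    proof eventually_elim
      case (elim n)
      show ?case
      proof
        fix x assume x: "x \<in> K"
        show "\<bar>V (s n) x - g x\<bar> \<le> d"
          using W1[OF x, of "s n"] W2[OF x, of "s n"] n0[OF elim(2) x] elim(1) by linarith
      qed
    qed
  qed
qed

text \<open>Approximate ergodic solutions along the scales \<open>1 / real (Suc n)\<close> are
  compact: the functions by their large-scale Lipschitz bound, the ergodic constants by the bound of
  \<open>f\<close>. Their limit satisfies both one-sided conditions.\<close>

lemma ergodic_viscosity_solution:
  fixes f :: "real ^ 'n \<Rightarrow> real"
  assumes dom: "bounded_domain \<Omega>" and conv: "convex \<Omega>" and bd: "C1_boundary \<Omega>"
    and f: "continuous_on (closure \<Omega>) f"
  obtains u c where "viscosity_solution \<Omega> (\<lambda>x. f x - c) u"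
proof -
  let ?K = "closure \<Omega>"
  have K: "compact ?K" using dom by (rule compact_closure_domain)
  obtain x0 where x0: "x0 \<in> ?K" using dom closure_subset by (auto simp: bounded_domain_def)
  obtain C where C: "\<And>x. x \<in> ?K \<Longrightarrow> \<bar>f x\<bar> \<le> C"
    using bounded_image_domain[OF dom f] bounded_image_realE by metis
  obtain D where D: "\<And>x y. x \<in> ?K \<Longrightarrow> y \<in> ?K \<Longrightarrow> dist x y \<le> D"
    using bounded_two_points[THEN iffD1, OF compact_imp_bounded[OF K]] by metis
  have CD: "0 \<le> C" "0 \<le> D" using C[OF x0] D[OF x0 x0] by auto
  define L where "L = (2 * C + 3) * (D + 1)"
  define A where "A = (2 * C + 3) * (D + 3)"
  have LA: "0 \<le> L" "0 \<le> A" using CD by (auto simp: L_def A_def)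
  define e where "e n = 1 / real (Suc n)" for n
  have e: "0 < e n" "e n \<le> 1" for n by (auto simp: e_def)
  have e_lim: "e \<longlonglongrightarrow> 0" unfolding e_def using LIMSEQ_Suc[OF lim_const_over_n[of 1]] by simp
  \<comment> \<open>The tolerance \<open>(e n) ^ 3\<close> is small against
    \<open>(e n)\<^sup>2\<close>, as required in the limit. A single predicate allows
    \<open>V\<close> and \<open>k\<close> to be chosen in turn.\<close>
  define Q where "Q n V k \<longleftrightarrow> \<bar>k\<bar> \<le> C \<and> (\<forall>x\<in>?K. \<bar>V x\<bar> \<le> L * D + A) \<and>
      (\<forall>x\<in>?K. \<forall>y\<in>?K. V x - V y \<le> L * dist y x + A * e n) \<and>
      (\<forall>x\<in>?K. \<bar>V x - (minmax ?K (e n) V x + (e n)\<^sup>2 / 2 * (f x - k))\<bar> \<le> (e n) ^ 3)" for n V k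
  have "\<exists>V k. Q n V k" for n
    unfolding Q_def L_def A_def
    by (rule approximate_ergodic_solution[of ?K D x0 f C "e n" "(e n) ^ 3",
          OF convex_closure[OF conv] D x0 C e zero_less_power[OF e(1)]])
  then have "\<forall>n. \<exists>V k. Q n V k" ..
  from choice[OF this] obtain V where "\<forall>n. \<exists>k. Q n (V n) k" ..
  from choice[OF this] obtain k where Q: "\<forall>n. Q n (V n) (k n)" ..
  have k: "\<bar>k n\<bar> \<le> C" for n using Q by (simp add: Q_def)
  have VN: "\<bar>V n x\<bar> \<le> L * D + A" if "x \<in> ?K" for n x using Q that by (simp add: Q_def)
  have Vlip: "V n x - V n y \<le> L * dist y x + A * e n" if "x \<in> ?K" "y \<in> ?K" for n x y
    using Q that by (simp add: Q_def)
  have Veq: "\<bar>V n x - (minmax ?K (e n) (V n) x + (e n)\<^sup>2 / 2 * (f x - k n))\<bar> \<le> (e n) ^ 3" if "x \<in> ?K" for n x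
    using Q that by (simp add: Q_def)
  have "?K \<noteq> {}" using x0 by auto
  obtain g s where g: "continuous_on ?K g" and s: "strict_mono (s :: nat \<Rightarrow> nat)"
    and lim: "\<And>d. 0 < d \<Longrightarrow> \<forall>\<^sub>F n in sequentially. \<forall>x\<in>?K. \<bar>V (s n) x - g x\<bar> \<le> d"
    using Arzela_Ascoli_large_scale_lipschitz[OF K \<open>?K \<noteq> {}\<close> LA VN Vlip e e_lim] by blast
  have "bounded (range (k \<circ> s))" unfolding bounded_iff using k by auto
  \<comment> \<open>A further subsequence makes the ergodic constants converge; their limit is the
    \<open>c\<close> of the statement.\<close>
  then obtain c t where t: "strict_mono (t :: nat \<Rightarrow> nat)" and c: "(k \<circ> s \<circ> t) \<longlonglongrightarrow> c"
    using bounded_imp_convergent_subsequence by metis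
  define r where "r = s \<circ> t"
  have "filterlim t sequentially sequentially" using t by (rule filterlim_subseq)
  then have lim': "\<forall>\<^sub>F n in sequentially. \<forall>x\<in>?K. \<bar>V (r n) x - g x\<bar> \<le> d" if "0 < d" for d
    using lim[OF that] unfolding r_def o_def by (rule eventually_compose_filterlim[rotated])
  have r: "strict_mono r" unfolding r_def using s t by (rule strict_mono_o)
  have er: "(\<lambda>n. e (r n)) \<longlonglongrightarrow> 0" using LIMSEQ_subseq_LIMSEQ[OF e_lim r] by (simp add: o_def)
  have bdV: "bounded (V n ` ?K)" for n using VN by (rule bounded_image_realI)
  have near: "\<forall>\<^sub>F n in sequentially. \<forall>x\<in>?K.
      \<bar>V (r n) x - (minmax ?K (e (r n)) (V (r n)) x + (e (r n))\<^sup>2 / 2 * (f x - c))\<bar> \<le> (e (r n))\<^sup>2 / 2 * d"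
    if "0 < d" for d
  proof -
    have "\<forall>\<^sub>F n in sequentially. dist ((k \<circ> s \<circ> t) n) c < d / 2" by (rule tendstoD[OF c]) (use that in simp)
    moreover have "\<forall>\<^sub>F n in sequentially. e (r n) < d / 4" by (rule order_tendstoD(2)[OF er]) (use that in simp)
    ultimately show ?thesis
    proof eventually_elim
      case (elim n)
      let ?e = "e (r n)"
      have "\<bar>?e\<^sup>2 / 2 * (k (r n) - c)\<bar> = ?e\<^sup>2 / 2 * \<bar>k (r n) - c\<bar>" by (simp add: abs_mult)
      also have "\<dots> \<le> ?e\<^sup>2 / 2 * (d / 2)"
        using elim(1) by (intro mult_left_mono) (auto simp: dist_real_def r_def)
      finally have 1: "\<bar>?e\<^sup>2 / 2 * (k (r n) - c)\<bar> \<le> ?e\<^sup>2 / 2 * (d / 2)" .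
      have "?e ^ 3 = ?e\<^sup>2 / 2 * (2 * ?e)" by (simp add: power2_eq_square power3_eq_cube)
      also have "\<dots> \<le> ?e\<^sup>2 / 2 * (d / 2)" using elim(2) by (intro mult_left_mono) auto
      finally have 2: "?e ^ 3 \<le> ?e\<^sup>2 / 2 * (d / 2)" .
      show ?case
      proof
        fix x assume x: "x \<in> ?K"
        have "?e\<^sup>2 / 2 * (f x - c) = ?e\<^sup>2 / 2 * (f x - k (r n)) + ?e\<^sup>2 / 2 * (k (r n) - c)"
          by (simp add: field_simps)
        moreover have "?e\<^sup>2 / 2 * d = ?e\<^sup>2 / 2 * (d / 2) + ?e\<^sup>2 / 2 * (d / 2)" by simp
        ultimately show "\<bar>V (r n) x - (minmax ?K ?e (V (r n)) x + ?e\<^sup>2 / 2 * (f x - c))\<bar> \<le> ?e\<^sup>2 / 2 * d"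
          using Veq[OF x, of "r n"] 1 2 by linarith
      qed
    qed
  qed
  have "viscosity_subsolution \<Omega> (\<lambda>x. f x - c) g"
  proof (rule discrete_subsolution_limit.limit_viscosity_subsolution[OF _ bd], unfold_locales)
    show "bounded_domain \<Omega>" "convex \<Omega>" "continuous_on ?K g" by fact+
    show "continuous_on ?K (\<lambda>x. f x - c)" using f by (intro continuous_intros)
    show "0 < e (r n)" "(\<lambda>n. e (r n)) \<longlonglongrightarrow> 0" "bounded (V (r n) ` ?K)" for n by (rule e er bdV)+
    show "\<forall>\<^sub>F n in sequentially. \<forall>x\<in>?K. \<bar>V (r n) x - g x\<bar> \<le> d" if "0 < d" for d using that by (rule lim')
    show "\<forall>\<^sub>F n in sequentially. \<forall>x\<in>?K. V (r n) x \<le> minmax ?K (e (r n)) (V (r n)) x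
        + (e (r n))\<^sup>2 / 2 * (f x - c + d)" if "0 < d" for d
      using near[OF that]
    proof eventually_elim
      case (elim n)
      show ?case
      proof
        fix x assume "x \<in> ?K"
        then show "V (r n) x \<le> minmax ?K (e (r n)) (V (r n)) x + (e (r n))\<^sup>2 / 2 * (f x - c + d)"
          using bspec[OF elim \<open>x \<in> ?K\<close>] unfolding distrib_left[of _ "f x - c" d] abs_le_iff by linarith
      qed
    qed
  qed
  moreover have "viscosity_subsolution \<Omega> (\<lambda>x. - (f x - c)) (\<lambda>x. - g x)"
  proof (rule discrete_subsolution_limit.limit_viscosity_subsolution[OF _ bd], unfold_locales)
    show "bounded_domain \<Omega>" "convex \<Omega>" by fact+
    show "continuous_on ?K (\<lambda>x. - g x)" using g by (intro continuous_intros)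
    show "continuous_on ?K (\<lambda>x. - (f x - c))" using f by (intro continuous_intros)
    show "0 < e (r n)" "(\<lambda>n. e (r n)) \<longlonglongrightarrow> 0" for n by (rule e er)+
    show "bounded ((\<lambda>x. - V (r n) x) ` ?K)" for n
      using VN by (intro bounded_image_realI[where B="L * D + A"]) simp
    show "\<forall>\<^sub>F n in sequentially. \<forall>x\<in>?K. \<bar>- V (r n) x - - g x\<bar> \<le> d" if "0 < d" for d
      using lim'[OF that] by eventually_elim (simp add: abs_minus_commute)
    show "\<forall>\<^sub>F n in sequentially. \<forall>x\<in>?K. - V (r n) x \<le> minmax ?K (e (r n)) (\<lambda>x. - V (r n) x) x
        + (e (r n))\<^sup>2 / 2 * (- (f x - c) + d)" if "0 < d" for d
      using near[OF that]
    proof eventually_elim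
      case (elim n)
      show ?case
      proof
        fix x assume "x \<in> ?K"
        have "(e (r n))\<^sup>2 / 2 * (- (f x - c) + d) = - ((e (r n))\<^sup>2 / 2 * (f x - c)) + (e (r n))\<^sup>2 / 2 * d"
          by (simp only: distrib_left mult_minus_right)
        then show "- V (r n) x \<le> minmax ?K (e (r n)) (\<lambda>x. - V (r n) x) x + (e (r n))\<^sup>2 / 2 * (- (f x - c) + d)"
          using bspec[OF elim \<open>x \<in> ?K\<close>] unfolding minmax_uminus abs_le_iff by linarith
      qed
    qed
  qed
  ultimately have "viscosity_solution \<Omega> (\<lambda>x. f x - c) g"
    by (simp add: viscosity_solution_def viscosity_supersolution_def)
  then show ?thesis by (rule that)
qed

theorem theorem1p12:
  fixes \<Omega> :: "(real ^ 'n) set" and f :: "real ^ 'n \<Rightarrow> real"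
  assumes "bounded_domain \<Omega>" and "convex \<Omega>"
    and "finite_intrinsic_diameter \<Omega>"
    and "C1_boundary \<Omega>"
    and "continuous_on (closure \<Omega>) f"
  shows "(\<exists>u. viscosity_solution \<Omega> f u) \<longleftrightarrow> limit_growth_const \<Omega> f = 0"
proof
  assume "\<exists>u. viscosity_solution \<Omega> f u"
  then have "(growth_const \<Omega> f \<longlongrightarrow> 0) (at_right 0)"
    using viscosity_solution_growth_const assms by blast
  then show "limit_growth_const \<Omega> f = 0"
    unfolding limit_growth_const_def by (intro tendsto_Lim) simp
next
  assume lim: "limit_growth_const \<Omega> f = 0"
  \<comment> \<open>\<open>Lim\<close> always has a value, so the assumption says something only
    once convergence is known. This solution provides it: the growth constants for
    \<open>f - c\<close> tend to 0, hence those for \<open>f\<close> tend to \<open>c\<close>, and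
    \<open>c = 0\<close>.\<close>
  obtain u c where u: "viscosity_solution \<Omega> (\<lambda>x. f x - c) u"
    using ergodic_viscosity_solution assms by blast
  have "continuous_on (closure \<Omega>) (\<lambda>x. f x - c)" using assms by (intro continuous_intros)
  then have "(growth_const \<Omega> (\<lambda>x. f x - c) \<longlongrightarrow> 0) (at_right 0)"
    using viscosity_solution_growth_const u assms by blast
  then have "((\<lambda>e. growth_const \<Omega> (\<lambda>x. f x - c) e + c) \<longlongrightarrow> 0 + c) (at_right 0)"
    by (intro tendsto_intros)
  moreover have "\<forall>\<^sub>F e in at_right 0. growth_const \<Omega> (\<lambda>x. f x - c) e + c = growth_const \<Omega> f e"
    unfolding eventually_at_right_field
    using growth_const_diff[of \<Omega> f] assms by (intro exI[of _ 1]) simp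
  ultimately have "(growth_const \<Omega> f \<longlongrightarrow> c) (at_right 0)"
    using Lim_transform_eventually by fastforce
  then have "limit_growth_const \<Omega> f = c"
    unfolding limit_growth_const_def by (intro tendsto_Lim) simp
  then show "\<exists>u. viscosity_solution \<Omega> f u" using u lim by auto
qed

end
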